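(* For any $\gamma>0$ and $\alpha>0$ there exists a randomized algorithm that, except with probability at most $n^{-\alpha}$, finds an optimal solution to the Noisy Signal Aggregation problem on strongly $\gamma$-biased signals (i.e. a permutation $\sigma$ of $[n]$ maximizing $s_q(\sigma)$) in time $n^{\tilde{O}((\alpha+1)\gamma^{-3})}$.
   Context: Noisy Signal Aggregation (NSA): there are $n$ items $1,\dots,n$ and an unknown true order given by a permutation $\pi$ of $[n]$; write $a<_\pi b$ if $\pi(a)<\pi(b)$. For each unordered pair $\{a,b\}$ a signal $s_{a,b}=s_{b,a}$ is observed, with distribution ${\cal D}_{a<b}$ if $\pi(a)<\pi(b)$ and ${\cal D}_{b<a}$ if $\pi(b)<\pi(a)$; conditioned on $\pi$ the signals are independent. Define $q(a<b)=\log\frac{{\cal D}_{a<b}(s_{a,b})}{{\cal D}_{b<a}(s_{a,b})}$, so $q(b<a)=-q(a<b)$, and for a permutation $\sigma$ the score $s_q(\sigma)=\sum_{i,j:\ \sigma(i)<\sigma(j)} q(i<j)$. An optimal solution (optimal order) is a permutation maximizing $s_q$ (equivalently a maximum likelihood permutation under a uniform prior). The signal distributions are strongly $\gamma$-biased if (a) for every integer $m$ with $\frac{\log n}{\gamma}<m\le n$ and any $m$ distinct pairs $(a_k,b_k)$, $k=1,\dots,m$, such that $a_k<_\pi b_k$ for at least $2/3$ of the $k$'s, $\P\left[\sum_{k=1}^m q(a_k<b_k)>0\right]>1-2^{-\gamma m}$; and (b) there is a constant $A$ such that for any $A$ distinct pairs $(a_k,b_k)$ with $a_k<_\pi b_k$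 for all $k$, $\P\left[\sum_{k=1}^A q(a_k<b_k)>0\right]>1-10^{-3}$. The notation $\tilde O(\cdot)$ means order of magnitude up to logarithmic factors in the variables inside.
   Formalization: The exponent is Õ((α+1)·max(1, γ^{-3})) instead of Õ((α+1)γ^{-3}): for large γ the stated exponent tends to 0, giving less time than is needed to write down a permutation of [n]. *)

theory Defs
  imports "HOL-Probability.Probability" "HOL-Combinatorics.Permutations"
begin

section \<open>A randomized random-access machine with real inputs\<close>

text \<open>
  Running time is measured on a uniform-cost machine in the form of a while language.  There is
  a bank of natural-number registers and a bank of real registers (both addressed by constants
  of the program), and a natural-number and a real memory (both addressed by the contents of a
  natural-number register).  Every instruction and every evaluation of a test costs one unit.

  The instruction set is deliberately weak: numbers are only added, subtracted, compared and
  copied.  Unit-cost multiplication combined with further arithmetic would permit exponential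
  parallelism within single numbers and would make time bounds meaningless.  There are no real
  constants, and reals influence the rest of the computation only through comparisons.
\<close>

datatype instr =
    Const nat nat
  | Add nat nat nat
  | Sub nat nat nat
  | Load nat nat
  | Store nat nat
  | RAdd nat nat nat
  | RSub nat nat nat
  | RLoad nat nat
  | RStore nat nat
  | Flip nat

datatype test = NLess nat nat | RLess nat nat

datatype prog =
    Instr instr
  | Seq prog prog
  | If test prog prog
  | While test prog

text \<open>\<open>coins\<close> is the infinite sequence of coin tosses that have not been consumed yet.\<close>

record state =
  nreg :: "nat \<Rightarrow> nat"
  nmem :: "nat \<Rightarrow> nat"
  rreg :: "nat \<Rightarrow> real"
  rmem :: "nat \<Rightarrow> real"
  coins :: "nat \<Rightarrow> bool"

fun step :: "instr \<Rightarrow> state \<Rightarrow> state" where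
  "step (Const x c) s = s\<lparr>nreg := (nreg s)(x := c)\<rparr>"
| "step (Add x y z) s = s\<lparr>nreg := (nreg s)(x := nreg s y + nreg s z)\<rparr>"
| "step (Sub x y z) s = s\<lparr>nreg := (nreg s)(x := nreg s y - nreg s z)\<rparr>"
| "step (Load x y) s = s\<lparr>nreg := (nreg s)(x := nmem s (nreg s y))\<rparr>"
| "step (Store x y) s = s\<lparr>nmem := (nmem s)(nreg s x := nreg s y)\<rparr>"
| "step (RAdd u v w) s = s\<lparr>rreg := (rreg s)(u := rreg s v + rreg s w)\<rparr>"
| "step (RSub u v w) s = s\<lparr>rreg := (rreg s)(u := rreg s v - rreg s w)\<rparr>"
| "step (RLoad u x) s = s\<lparr>rreg := (rreg s)(u := rmem s (nreg s x))\<rparr>"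
| "step (RStore x u) s = s\<lparr>rmem := (rmem s)(nreg s x := rreg s u)\<rparr>"
| "step (Flip x) s =
     s\<lparr>nreg := (nreg s)(x := (if coins s 0 then 1 else 0)), coins := (\<lambda>i. coins s (Suc i))\<rparr>"

fun holds :: "test \<Rightarrow> state \<Rightarrow> bool" where
  "holds (NLess x y) s \<longleftrightarrow> nreg s x < nreg s y"
| "holds (RLess u v) s \<longleftrightarrow> rreg s u < rreg s v"

text \<open>\<open>exec c s t s'\<close>: started in \<open>s\<close>, the program \<open>c\<close> halts in \<open>s'\<close> after exactly \<open>t\<close> units of time.\<close>

inductive exec :: "prog \<Rightarrow> state \<Rightarrow> nat \<Rightarrow> state \<Rightarrow> bool" where
  Instr: "exec (Instr i) s 1 (step i s)"
| Seq: "exec c s t s' \<Longrightarrow> exec d s' t' s'' \<Longrightarrow> exec (Seq c d) s (t + t') s''"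
| IfTrue: "holds b s \<Longrightarrow> exec c s t s' \<Longrightarrow> exec (If b c d) s (Suc t) s'"
| IfFalse: "\<not> holds b s \<Longrightarrow> exec d s t s' \<Longrightarrow> exec (If b c d) s (Suc t) s'"
| WhileFalse: "\<not> holds b s \<Longrightarrow> exec (While b c) s 1 s"
| WhileTrue: "holds b s \<Longrightarrow> exec c s t s' \<Longrightarrow> exec (While b c) s' t' s'' \<Longrightarrow>
    exec (While b c) s (Suc (t + t')) s''"

lemma exec_deterministic:
  assumes "exec c s t s'" "exec c s u s''"
  shows "u = t \<and> s'' = s'"
  using assms
proof (induction arbitrary: u s'' rule: exec.induct)
  case (Instr i s)
  then show ?case by (auto elim: exec.cases)
next
  case (Seq c s t s' d t' s2)
  from Seq.prems show ?case by cases (use Seq.IH in blast)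
next
  case (IfTrue b s c t s' d)
  from IfTrue.prems show ?case by cases (use IfTrue in blast)+
next
  case (IfFalse b s d t s' c)
  from IfFalse.prems show ?case by cases (use IfFalse in blast)+
next
  case (WhileFalse b s c)
  from WhileFalse.prems show ?case by cases (use WhileFalse in blast)+
next
  case (WhileTrue b s c t s' t' s2)
  from WhileTrue.prems show ?case by cases (use WhileTrue in blast)+
qed

text \<open>Input: \<open>n\<close> in register \<open>0\<close> and the matrix \<open>q\<close> in row-major order in the real memory.\<close>

definition init :: "nat \<Rightarrow> (nat \<Rightarrow> nat \<Rightarrow> real) \<Rightarrow> (nat \<Rightarrow> bool) \<Rightarrow> state" where
  "init n q \<omega> =
     \<lparr>nreg = (\<lambda>_. 0)(0 := n), nmem = (\<lambda>_. 0),
      rreg = (\<lambda>_. 0), rmem = (\<lambda>i. if i < n * n then q (i div n) (i mod n) else 0),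
      coins = \<omega>\<rparr>"

text \<open>
  Output: the position of item \<open>i < n\<close> is the final content of cell \<open>i\<close> of the natural-number
  memory.  It is extended by the identity to match the library's \<open>permutes\<close>.
\<close>

definition outcome :: "nat \<Rightarrow> state \<Rightarrow> nat \<Rightarrow> nat" where
  "outcome n s = (\<lambda>i. if i < n then nmem s i else i)"

definition coin_measure :: "(nat \<Rightarrow> bool) measure" where
  "coin_measure = Pi\<^sub>M UNIV (\<lambda>_. measure_pmf (bernoulli_pmf (1 / 2)))"


section \<open>Noisy signal aggregation\<close>

text \<open>
  Items are \<open>0, \<dots>, n - 1\<close>.  \<open>D a b\<close> is the density, with respect to a reference measure \<open>M\<close> on the
  signal space, of the signal of the pair \<open>{a, b}\<close> when \<open>a\<close> precedes \<open>b\<close>.  The two densities of a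
  pair vanish at the same signals, so that the log-likelihood ratio is finite wherever a density
  is positive.
\<close>

definition signal_densities :: "nat \<Rightarrow> 's measure \<Rightarrow> (nat \<Rightarrow> nat \<Rightarrow> 's \<Rightarrow> real) \<Rightarrow> bool" where
  "signal_densities n M D \<longleftrightarrow>
     (\<forall>a<n. \<forall>b<n. a \<noteq> b \<longrightarrow>
        D a b \<in> borel_measurable M \<and>
        (\<forall>x\<in>space M. 0 \<le> D a b x) \<and>
        (\<integral>\<^sup>+x. ennreal (D a b x) \<partial>M) = 1 \<and>
        (\<forall>x\<in>space M. D a b x = 0 \<longleftrightarrow> D b a x = 0))"

text \<open>The unordered pair \<open>{a, b}\<close> is represented by \<open>(min a b, max a b)\<close>.\<close>

definition upair :: "nat \<Rightarrow> nat \<Rightarrow> nat \<times> nat" where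
  "upair a b = (min a b, max a b)"

definition upairs :: "nat \<Rightarrow> (nat \<times> nat) set" where
  "upairs n = {(a, b). a < b \<and> b < n}"

text \<open>The joint law of all signals when the true order is \<open>\<pi>\<close>.\<close>

definition signal_measure ::
  "nat \<Rightarrow> 's measure \<Rightarrow> (nat \<Rightarrow> nat \<Rightarrow> 's \<Rightarrow> real) \<Rightarrow> (nat \<Rightarrow> nat) \<Rightarrow> (nat \<times> nat \<Rightarrow> 's) measure" where
  "signal_measure n M D \<pi> =
     Pi\<^sub>M (upairs n)
       (\<lambda>(a, b). density M (\<lambda>x. ennreal (if \<pi> a < \<pi> b then D a b x else D b a x)))"

definition llr ::
  "(nat \<Rightarrow> nat \<Rightarrow> 's \<Rightarrow> real) \<Rightarrow> (nat \<times> nat \<Rightarrow> 's) \<Rightarrow> nat \<Rightarrow> nat \<Rightarrow> real" where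
  "llr D s a b = ln (D a b (s (upair a b)) / D b a (s (upair a b)))"

definition score :: "nat \<Rightarrow> (nat \<Rightarrow> nat \<Rightarrow> real) \<Rightarrow> (nat \<Rightarrow> nat) \<Rightarrow> real" where
  "score n q \<sigma> = (\<Sum>(i, j) | i < n \<and> j < n \<and> \<sigma> i < \<sigma> j. q i j)"

definition optimal_order :: "nat \<Rightarrow> (nat \<Rightarrow> nat \<Rightarrow> real) \<Rightarrow> (nat \<Rightarrow> nat) \<Rightarrow> bool" where
  "optimal_order n q \<sigma> \<longleftrightarrow> is_arg_max (score n q) (\<lambda>\<tau>. \<tau> permutes {..<n}) \<sigma>"

text \<open>Sequences of \<open>m\<close> pairs of distinct items that are pairwise distinct as unordered pairs.\<close>

definition distinct_pairs :: "nat \<Rightarrow> nat \<Rightarrow> (nat \<Rightarrow> nat) \<Rightarrow> (nat \<Rightarrow> nat) \<Rightarrow> bool" where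
  "distinct_pairs n m a b \<longleftrightarrow>
     (\<forall>k<m. a k < n \<and> b k < n \<and> a k \<noteq> b k) \<and> inj_on (\<lambda>k. upair (a k) (b k)) {..<m}"

text \<open>The constant \<open>A\<close> of the second condition is a parameter, as it must not depend on \<open>n\<close>.\<close>

definition strongly_biased ::
  "nat \<Rightarrow> real \<Rightarrow> nat \<Rightarrow> 's measure \<Rightarrow> (nat \<Rightarrow> nat \<Rightarrow> 's \<Rightarrow> real) \<Rightarrow> (nat \<Rightarrow> nat) \<Rightarrow> bool" where
  "strongly_biased A \<gamma> n M D \<pi> \<longleftrightarrow>
     (\<forall>m a b. log 2 (real n) / \<gamma> < real m \<and> m \<le> n \<and> distinct_pairs n m a b \<and>
          real (card {k. k < m \<and> \<pi> (a k) < \<pi> (b k)}) \<ge> 2 / 3 * real m \<longrightarrow>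
        measure (signal_measure n M D \<pi>)
          {s \<in> space (signal_measure n M D \<pi>). (\<Sum>k<m. llr D s (a k) (b k)) > 0}
        > 1 - 2 powr (- \<gamma> * real m)) \<and>
     (\<forall>a b. distinct_pairs n A a b \<and> (\<forall>k<A. \<pi> (a k) < \<pi> (b k)) \<longrightarrow>
        measure (signal_measure n M D \<pi>)
          {s \<in> space (signal_measure n M D \<pi>). (\<Sum>k<A. llr D s (a k) (b k)) > 0}
        > 1 - 1 / 10 ^ 3)"

text \<open>
  \<open>soft_O C k x\<close> is the bound hidden in \<open>O~(x)\<close> for \<open>x \<ge> 1\<close>: a constant factor \<open>C\<close> and a
  polylogarithmic factor of degree \<open>k\<close>; \<open>1 + ln x\<close> replaces \<open>ln x\<close> so as not to vanish at \<open>x = 1\<close>.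
\<close>

definition soft_O :: "real \<Rightarrow> nat \<Rightarrow> real \<Rightarrow> real" where
  "soft_O C k x = C * x * (1 + ln x) ^ k"

end

theory Submission
  imports Defs "HOL-Library.Nat_Bijection"
begin

text \<open>
  The algorithm is deterministic and inserts the items one by one, keeping an optimal order of the
  first \<open>k\<close> items.  With high probability, for every \<open>k\<close>, every optimal order of the first \<open>k\<close> items
  displaces each item by less than \<open>d = O~((\<alpha> + 1) \<gamma>\<^sup>-\<^sup>3) log n\<close> positions relative to the true order.
  Consequently two consecutive optimal orders never interchange old items at distance more than
  \<open>4 d\<close>, and the next one is found by dynamic programming over the sets of placed items, only
  \<open>n 2\<^bsup>O(d)\<^esup>\<close> of which have to be considered.

  The displacement bound needs condition (a) of strong bias and union bounds only.  Sorting a window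
  of an optimal order cannot increase the score, so a window of length about \<open>log n / \<gamma>\<^sup>2\<close> with many
  inversions would give a nonpositive sum over many correctly oriented pairs; there are few
  enough lists of items to exclude this.  If \<open>d\<close> is the maximal displacement, then these local
  estimates show that only a fraction of about \<open>\<gamma> / log (1 / \<gamma>)\<close> of \<open>d\<close> items cross any given position.
  Hence, if an item is displaced by \<open>d\<close>, the \<open>d\<close> items that it has jumped over are, up to few
  exceptions, those of an interval of the true order.  There are at most \<open>2\<^bsup>\<gamma> d / 2\<^esup>\<close> such sets, and
  moving the item back contradicts condition (a).
\<close>


section \<open>Programs and weakest preconditions\<close>

text \<open>An optimal order depends on the signals, so condition (a) cannot be applied to pairs
  read off from it. The bad events therefore speak of arbitrary short lists of items and of sets
  near an interval of true ranks, which \<pi> alone determines, and they must survive a union bound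
  over all of these. A window of \<open>4 * h\<close> positions costs about
  \<open>n ^ (4 * h)\<close> lists, and \<open>h * (e + 1)\<close> inversions pay for them once
  \<open>e\<close> is of order log n / \<gamma>. A set of \<open>d\<close> items near an interval
  must cost at most 2 to the power \<gamma> d / 2, which forces \<open>\<Delta>\<close> to be of
  order log (1 / \<gamma>) / \<gamma>. With \<open>h\<close> about (\<alpha> + 1)
  \<open>\<Delta> * e\<close> and \<open>d\<close> a logarithmic factor times
  \<open>\<Delta> * h\<close>, the third power of 1 / \<gamma> results. A further obstacle is
  formal: a nonmeasurable set has measure 0 by convention, so a bound on the success probability
  requires measurability of the success event, and thus of the final state of a program as a
  function of the signals and coins.\<close>

definition wp :: "prog \<Rightarrow> (nat \<Rightarrow> state \<Rightarrow> bool) \<Rightarrow> state \<Rightarrow> bool" where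
  "wp c Q s \<longleftrightarrow> (\<exists>t s'. exec c s t s' \<and> Q t s')"

lemma wp_mono: "wp c P s \<Longrightarrow> (\<And>t s'. P t s' \<Longrightarrow> Q t s') \<Longrightarrow> wp c Q s"
  unfolding wp_def by blast

lemma wp_Instr [simp]: "wp (Instr i) Q s \<longleftrightarrow> Q 1 (step i s)"
proof
  assume "wp (Instr i) Q s"
  then show "Q 1 (step i s)"
    unfolding wp_def by (auto elim: exec.cases)
next
  assume "Q 1 (step i s)"
  then show "wp (Instr i) Q s"
    unfolding wp_def using exec.Instr by blast
qed

lemma wp_Seq [simp]: "wp (Seq c d) Q s \<longleftrightarrow> wp c (\<lambda>t s'. wp d (\<lambda>t' s''. Q (t + t') s'') s') s"
proof
  assume "wp (Seq c d) Q s"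
  then obtain t s' where e: "exec (Seq c d) s t s'" and q: "Q t s'"
    unfolding wp_def by blast
  from e show "wp c (\<lambda>t s'. wp d (\<lambda>t' s''. Q (t + t') s'') s') s"
    by cases (use q in \<open>auto simp: wp_def\<close>)
next
  assume "wp c (\<lambda>t s'. wp d (\<lambda>t' s''. Q (t + t') s'') s') s"
  then show "wp (Seq c d) Q s"
    unfolding wp_def by (blast intro: exec.Seq)
qed

lemma wp_If [simp]:
  "wp (If b c d) Q s \<longleftrightarrow>
     (if holds b s then wp c (\<lambda>t. Q (Suc t)) s else wp d (\<lambda>t. Q (Suc t)) s)"
proof
  assume "wp (If b c d) Q s"
  then obtain t s' where e: "exec (If b c d) s t s'" and q: "Q t s'"
    unfolding wp_def by blast
  from e show "if holds b s then wp c (\<lambda>t. Q (Suc t)) s else wp d (\<lambda>t. Q (Suc t)) s"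
    by cases (use q in \<open>auto simp: wp_def\<close>)
next
  assume "if holds b s then wp c (\<lambda>t. Q (Suc t)) s else wp d (\<lambda>t. Q (Suc t)) s"
  then show "wp (If b c d) Q s"
    by (auto simp: wp_def split: if_splits intro: exec.IfTrue exec.IfFalse)
qed

text \<open>Total correctness with a variant \<open>V\<close> that also bounds the number of iterations.\<close>

lemma wp_While:
  assumes I: "I s"
    and step: "\<And>s. I s \<Longrightarrow> holds b s \<Longrightarrow> wp c (\<lambda>t s'. t \<le> B \<and> I s' \<and> V s' < V s) s"
    and fin: "\<And>t s'. I s' \<Longrightarrow> \<not> holds b s' \<Longrightarrow> t \<le> V s * (B + 1) + 1 \<Longrightarrow> Q t s'"
  shows "wp (While b c) Q s"
proof -
  have "I s \<Longrightarrow> \<exists>t s'. exec (While b c) s t s' \<and> I s' \<and> \<not> holds b s' \<and> t \<le> V s * (B + 1) + 1"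
    for s
  proof (induction "V s" arbitrary: s rule: less_induct)
    case less
    show ?case
    proof (cases "holds b s")
      case True
      from step[OF less.prems True] obtain t s'
        where 1: "exec c s t s'" "t \<le> B" "I s'" "V s' < V s"
        unfolding wp_def by blast
      from less.hyps[OF 1(4) 1(3)] obtain t' s''
        where 2: "exec (While b c) s' t' s''" "I s''" "\<not> holds b s''" "t' \<le> V s' * (B + 1) + 1"
        by blast
      have "Suc (t + t') \<le> (V s' + 1) * (B + 1) + 1"
        using 1(2) 2(4) by simp
      also have "\<dots> \<le> V s * (B + 1) + 1"
        using 1(4) mult_le_mono1[of "V s' + 1" "V s" "B + 1"] by simp
      finally show ?thesis
        using exec.WhileTrue[OF True 1(1) 2(1)] 2(2,3) by blast
    next
      case False
      then have "exec (While b c) s 1 s"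
        by (rule exec.WhileFalse)
      with False less.prems show ?thesis
        by (intro exI[of _ 1] exI[of _ s]) auto
    qed
  qed
  from this[OF I] fin show ?thesis
    unfolding wp_def by blast
qed

text \<open>Register \<open>1\<close> holds the constant \<open>1\<close>.\<close>

definition For :: "nat \<Rightarrow> nat \<Rightarrow> prog \<Rightarrow> prog" where
  "For i N c = Seq (Instr (Const i 0)) (While (NLess i N) (Seq c (Instr (Add i i 1))))"

text \<open>The counter advances only after the body, so the invariant for \<open>Suc j\<close> is
  demanded of the state in which register \<open>i\<close> is already increased. A round costs
  \<open>B\<close>, the test and the increment; the final summand 2 is the initialisation and the
  failing test.\<close>

lemma wp_For:
  assumes N: "nreg s N = m" and one: "nreg s 1 = 1" and neq: "i \<noteq> N" "i \<noteq> 1"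
    and I0: "I 0 (s\<lparr>nreg := (nreg s)(i := 0)\<rparr>)"
    and body: "\<And>j s. j < m \<Longrightarrow> nreg s i = j \<Longrightarrow> nreg s N = m \<Longrightarrow> nreg s 1 = 1 \<Longrightarrow> I j s \<Longrightarrow>
        wp c (\<lambda>t s'. t \<le> B \<and> nreg s' i = j \<and> nreg s' N = m \<and> nreg s' 1 = 1 \<and>
                I (Suc j) (s'\<lparr>nreg := (nreg s')(i := Suc j)\<rparr>)) s"
    and fin: "\<And>t s'. nreg s' i = m \<Longrightarrow> nreg s' N = m \<Longrightarrow> nreg s' 1 = 1 \<Longrightarrow> I m s' \<Longrightarrow>
        t \<le> m * (B + 2) + 2 \<Longrightarrow> Q t s'"
  shows "wp (For i N c) Q s"
proof -
  let ?I = "\<lambda>s. nreg s i \<le> m \<and> nreg s N = m \<and> nreg s 1 = 1 \<and> I (nreg s i) s"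
  have *: "wp (While (NLess i N) (Seq c (Instr (Add i i 1)))) (\<lambda>t s'. Q (Suc t) s')
    (s\<lparr>nreg := (nreg s)(i := 0)\<rparr>)"
  proof (rule wp_While[where I = ?I and B = "B + 1" and V = "\<lambda>s. m - nreg s i"], goal_cases)
    case 1
    then show ?case using N one neq I0 by auto
  next
    case (2 s)
    then have *: "nreg s i < m" by simp
    show ?case
      unfolding wp_Seq
      by (rule wp_mono[OF body[OF * refl]]) (use 2 neq in auto)
  next
    case (3 t s')
    then show ?case using fin[of s' "Suc t"] by (auto simp: algebra_simps)
  qed
  then show ?thesis
    unfolding For_def by simp
qed


section \<open>One step of the dynamic program\<close>

definition same :: "nat set \<Rightarrow> state \<Rightarrow> state \<Rightarrow> bool" where
  "same X s s' \<longleftrightarrow> (\<forall>x. x \<notin> X \<longrightarrow> nreg s' x = nreg s x)"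

lemma sameD: "same X s s' \<Longrightarrow> x \<notin> X \<Longrightarrow> nreg s' x = nreg s x"
  unfolding same_def by blast

lemma same_trans: "same X s s' \<Longrightarrow> same Y s' s'' \<Longrightarrow> X \<union> Y \<subseteq> Z \<Longrightarrow> same Z s s''"
  unfolding same_def by (metis UnCI subsetD)

text \<open>The language has no empty program, so the last element serves as the end of the
  sequence; only nonempty lists are meaningful.\<close>

definition seqs :: "prog list \<Rightarrow> prog" where
  "seqs cs = foldr Seq (butlast cs) (last cs)"

lemma seqs_simps [simp]: "seqs [c] = c" "seqs (c # d # cs) = Seq c (seqs (d # cs))"
  by (simp_all add: seqs_def)

section \<open>Reading the bits of a code\<close>

lemma mod_power_Suc:
  "(c::nat) mod 2 ^ Suc u = (if u \<in> set_decode c then 2 ^ u else 0) + c mod 2 ^ u"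
proof -
  have "c mod 2 ^ Suc u = 2 ^ u * (c div 2 ^ u mod 2) + c mod 2 ^ u"
    using mod_mult2_eq[of c "2 ^ u" 2] by (simp add: mult.commute)
  then show ?thesis
    by (auto simp: set_decode_def odd_iff_mod_2_eq_one)
qed

text \<open>Registers: \<open>0\<close>: \<open>n\<close>; \<open>1\<close>: one; \<open>2\<close>: window size \<open>W\<close>; \<open>3\<close> - \<open>8\<close>: base addresses of the tables of
  powers of two, multiples of \<open>n\<close>, current order, new order, membership bits and DP choices;
  \<open>9\<close>: \<open>n * n\<close>, the base address of the DP values; \<open>15\<close>: \<open>2 ^ W\<close>; \<open>16\<close>: length of a table;
  \<open>31\<close>: zero.\<close>

definition decode :: prog where
  "decode = Seq (Instr (Add 26 13 31)) (For 17 16 (seqs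
     [Instr (Sub 18 16 1), Instr (Sub 18 18 17), Instr (Add 19 3 18), Instr (Load 20 19),
      Instr (Add 19 7 18),
      If (NLess 26 20) (Instr (Store 19 31)) (Seq (Instr (Sub 26 26 20)) (Instr (Store 19 1)))]))"

text \<open>The common table length \<open>n + W + 2\<close> covers all exponents up to
  \<open>f + 1 + W\<close> with \<open>f \<le> n\<close> that occur in codes. The tables start above
  the cells below \<open>n\<close> that receive the output, and the choices, which are addressed by
  whole codes, come last because their extent is not fixed.\<close>

definition env :: "nat \<Rightarrow> nat \<Rightarrow> (nat \<Rightarrow> nat \<Rightarrow> real) \<Rightarrow> state \<Rightarrow> bool" where
  "env n W q s \<longleftrightarrow> (let B = n + W + 2 in
     nreg s 0 = n \<and> nreg s 1 = 1 \<and> nreg s 2 = W \<and> nreg s 3 = B \<and> nreg s 4 = 2 * B \<and>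
     nreg s 5 = 3 * B \<and> nreg s 6 = 4 * B \<and> nreg s 7 = 5 * B \<and> nreg s 8 = 6 * B \<and>
     nreg s 9 = n * n \<and> nreg s 15 = 2 ^ W \<and> nreg s 16 = B \<and> nreg s 31 = 0 \<and> rreg s 0 = 0 \<and>
     (\<forall>i<B. nmem s (B + i) = 2 ^ i) \<and> (\<forall>i<n. nmem s (2 * B + i) = i * n) \<and>
     (\<forall>i<n * n. rmem s i = q (i div n) (i mod n)))"

lemma envD:
  assumes "env n W q s"
  shows "nreg s 0 = n" "nreg s 1 = 1" "nreg s (Suc 0) = 1" "nreg s 2 = W" "nreg s 3 = n + W + 2"
    "nreg s 4 = 2 * (n + W + 2)" "nreg s 5 = 3 * (n + W + 2)" "nreg s 6 = 4 * (n + W + 2)"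
    "nreg s 7 = 5 * (n + W + 2)" "nreg s 8 = 6 * (n + W + 2)" "nreg s 9 = n * n"
    "nreg s 15 = 2 ^ W" "nreg s 16 = n + W + 2" "nreg s 31 = 0" "rreg s 0 = 0"
    "\<And>i. i < n + W + 2 \<Longrightarrow> nmem s (n + W + 2 + i) = 2 ^ i"
    "\<And>i. i < n \<Longrightarrow> nmem s (2 * (n + W + 2) + i) = i * n"
    "\<And>i. i < n * n \<Longrightarrow> rmem s i = q (i div n) (i mod n)"
  using assms unfolding env_def Let_def by simp_all

lemma env_change:
  assumes "env n W q s" "same X s s'" "X \<inter> ({0..9} \<union> {15, 16, 31}) = {}" "rreg s' 0 = rreg s 0"
    "\<And>a. n + W + 2 \<le> a \<Longrightarrow> a < 3 * (n + W + 2) \<Longrightarrow> nmem s' a = nmem s a"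
    "\<And>a. a < n * n \<Longrightarrow> rmem s' a = rmem s a"
  shows "env n W q s'"
proof -
  have r: "nreg s' x = nreg s x" if "x \<in> {0..9} \<union> {15, 16, 31}" for x
    using sameD[OF assms(2), of x] assms(3) that by blast
  show ?thesis
    unfolding env_def Let_def
    using envD[OF assms(1)] assms(4-6) by (auto simp: r)
qed

text \<open>The machine has no division, so the bits are found from the top by comparing a remainder
  with stored powers of two and subtracting. After \<open>j\<close> rounds register 26 holds the
  code modulo \<open>2 ^ (B - j)\<close>.\<close>

lemma wp_decode:
  assumes e: "env n W q s" and B: "B = n + W + 2" and c: "nreg s 13 < 2 ^ B"
  shows "wp decode (\<lambda>t s'. t \<le> B * 11 + 4 \<and> same {17, 18, 19, 20, 26} s s' \<and>
     rreg s' = rreg s \<and> rmem s' = rmem s \<and>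
     (\<forall>u<B. nmem s' (5 * B + u) = (if u \<in> set_decode (nreg s 13) then 1 else 0)) \<and>
     (\<forall>a. a < 5 * B \<or> 6 * B \<le> a \<longrightarrow> nmem s' a = nmem s a)) s"
proof -
  note E = envD[OF e, folded B]
  define C where "C = nreg s 13"
  define I where "I = (\<lambda>j s'. same {17, 18, 19, 20, 26} s s' \<and> rreg s' = rreg s \<and> rmem s' = rmem s \<and>
     nreg s' 26 = C mod 2 ^ (B - j) \<and>
     (\<forall>u<B. B - j \<le> u \<longrightarrow> nmem s' (5 * B + u) = (if u \<in> set_decode C then 1 else 0)) \<and>
     (\<forall>a. a < 5 * B \<or> 6 * B \<le> a \<longrightarrow> nmem s' a = nmem s a))"
  show ?thesis
    unfolding decode_def wp_Seq wp_Instr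
  proof (rule wp_For[where m = B and I = I and B = 9], goal_cases)
    case 5
    then show ?case using c E by (auto simp: I_def same_def C_def)
  next
    case (6 j s1)
    have sm: "nreg s1 x = nreg s x" if "x \<notin> {17, 18, 19, 20, 26}" for x
      using 6(5) that unfolding I_def by (auto dest: sameD)
    define u where "u = B - Suc j"
    have u: "u < B" "B - j = Suc u" "B - Suc 0 - j = u" "B - 1 - j = u" using 6(1) by (auto simp: u_def)
    have m: "nmem s1 (B + u) = 2 ^ u"
      using 6(5) E(16)[OF u(1)] u(1) unfolding I_def by auto
    have rem: "nreg s1 26 = (if u \<in> set_decode C then 2 ^ u else 0) + C mod 2 ^ u"
      using 6(5) u mod_power_Suc unfolding I_def by auto
    have lt: "C mod 2 ^ u < 2 ^ u" by simp
    have iff: "nreg s1 26 < 2 ^ u \<longleftrightarrow> u \<notin> set_decode C"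
      using rem lt by auto
    show ?case
      using 6 u
      apply (simp add: sm E m iff)
      apply (auto simp: I_def same_def sm E rem u_def[symmetric] dest!: less_antisym)
      done
  next
    case (7 t s')
    then show ?case by (auto simp: I_def C_def)
  qed (use E in auto)
qed

text \<open>Stands for the missing empty program; register 20 is a scratch register.\<close>

definition nop :: prog where
  "nop = Instr (Add 20 31 31)"

definition gain :: prog where
  "gain = For 21 11 (seqs
     [Instr (Add 19 7 21), Instr (Load 20 19),
      If (NLess 20 1)
        (seqs [Instr (Add 19 5 21), Instr (Load 20 19), Instr (Add 20 20 25),
           Instr (RLoad 3 20), Instr (RAdd 2 2 3)])
        nop])"

lemma wp_gain:
  assumes e: "env n W q s" and B: "B = n + W + 2" and K: "nreg s 11 = K" "K \<le> n"
    and i: "nreg s 25 = i * n" "i < n"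
    and ord: "\<And>r. r < K \<Longrightarrow> nmem s (3 * B + r) = ord r" "\<And>r. r < K \<Longrightarrow> ord r < n"
    and S: "\<And>r. r < K \<Longrightarrow> nmem s (5 * B + r) = (if r \<in> S then 1 else 0)"
  shows "wp gain (\<lambda>t s'. t \<le> K * 11 + 2 \<and> same {19, 20, 21} s s' \<and>
     nmem s' = nmem s \<and> rmem s' = rmem s \<and> (\<forall>x. x \<notin> {2, 3} \<longrightarrow> rreg s' x = rreg s x) \<and>
     rreg s' 2 = rreg s 2 + (\<Sum>r\<in>{..<K} - S. q i (ord r))) s"
proof -
  note E = envD[OF e, folded B]
  define I where "I = (\<lambda>j s'. same {19, 20, 21} s s' \<and> nmem s' = nmem s \<and> rmem s' = rmem s \<and>
     (\<forall>x. x \<notin> {2, 3} \<longrightarrow> rreg s' x = rreg s x) \<and>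
     rreg s' 2 = rreg s 2 + (\<Sum>r\<in>{..<j} - S. q i (ord r)))"
  show ?thesis
    unfolding gain_def
  proof (rule wp_For[where m = K and I = I and B = 9], goal_cases)
    case 5
    then show ?case by (auto simp: I_def same_def)
  next
    case (6 j s1)
    have sm: "nreg s1 x = nreg s x" if "x \<notin> {19, 20, 21}" for x
      using 6(5) that unfolding I_def by (auto dest: sameD)
    have mem: "nmem s1 = nmem s" "rmem s1 = rmem s"
      using 6(5) unfolding I_def by auto
    have o: "ord j < n" using ord(2) 6(1) by simp
    have lt: "ord j + i * n < n * n"
    proof -
      have "ord j + i * n < n + i * n" using o by simp
      also have "\<dots> = Suc i * n" by simp
      also have "\<dots> \<le> n * n" using i(2) by (intro mult_right_mono) auto
      finally show ?thesis .
    qed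
    have q: "rmem s (ord j + i * n) = q i (ord j)"
      using E(18)[OF lt] o by simp
    have sum: "(\<Sum>r\<in>{..<Suc j} - S. q i (ord r)) =
        (if j \<in> S then 0 else q i (ord j)) + (\<Sum>r\<in>{..<j} - S. q i (ord r))"
      by (simp add: lessThan_Suc insert_Diff_if)
    show ?case
      using 6 by (auto simp: sm mem E S[OF 6(1)] ord(1)[OF 6(1)] q nop_def I_def same_def sum i(1))
  next
    case (7 t s')
    then show ?case by (auto simp: I_def)
  qed (use E K in auto)
qed

section \<open>Evaluation of one entry of the table\<close>

definition update :: prog where
  "update = seqs [Instr (RAdd 4 2 0), Instr (Add 23 18 31), Instr (Add 22 1 31)]"

definition candidate :: prog where
  "candidate = seqs
     [Instr (Add 19 7 18), Instr (Load 20 19),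
      If (NLess 20 1)
        (If (NLess 18 24)
          (seqs [Instr (Add 19 3 18), Instr (Load 20 19), Instr (Add 20 20 13),
             Instr (Add 20 20 9), Instr (RLoad 2 20), Instr (Add 19 5 18), Instr (Load 20 19),
             Instr (Add 19 4 20), Instr (Load 25 19), gain,
             If (NLess 22 1) update (If (RLess 4 2) update nop)])
          nop)
        nop]"

definition process :: prog where
  "process = seqs
     [decode, Instr (Const 22 0), Instr (Const 23 0), Instr (RAdd 4 0 0), Instr (Add 24 12 2),
      Instr (Add 24 24 1), For 18 11 candidate,
      Instr (Add 19 8 13), Instr (Store 19 23), Instr (Add 19 9 13), Instr (RStore 19 4)]"

text \<open>In use \<open>l\<close> is the first gap plus \<open>W + 1\<close>. It is positive, so
  index 0, the new item, can be placed at any time.\<close>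

definition cands :: "nat \<Rightarrow> nat \<Rightarrow> nat set \<Rightarrow> nat set" where
  "cands K l S = {u. u < K \<and> u \<notin> S \<and> u < l}"

text \<open>The last sum includes the diagonal term of the placed item itself.  This shifts the values of
  all orders by the same amount and saves a test in the program.\<close>

definition option_value ::
    "(nat \<Rightarrow> nat \<Rightarrow> real) \<Rightarrow> (nat \<Rightarrow> nat) \<Rightarrow> nat \<Rightarrow> (nat \<Rightarrow> real) \<Rightarrow> nat \<Rightarrow> nat \<Rightarrow> real" where
  "option_value q ord K V c u =
     V (c + 2 ^ u) + (\<Sum>r\<in>{..<K} - set_decode c. q (ord u) (ord r))"

text \<open>The recursion is a local property of one code, so that it can be asserted for the part
  of the table filled so far. The value 0 in the absence of candidates is the terminal value of the
  complete set.\<close>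

definition bellman :: "(nat \<Rightarrow> nat \<Rightarrow> real) \<Rightarrow> (nat \<Rightarrow> nat) \<Rightarrow> nat \<Rightarrow> nat \<Rightarrow> (nat \<Rightarrow> real) \<Rightarrow>
    (nat \<Rightarrow> nat) \<Rightarrow> nat \<Rightarrow> bool" where
  "bellman q ord K l V ch c \<longleftrightarrow>
     (if cands K l (set_decode c) = {} then V c = 0
      else ch c \<in> cands K l (set_decode c) \<and> V c = option_value q ord K V c (ch c) \<and>
        (\<forall>u\<in>cands K l (set_decode c). option_value q ord K V c u \<le> V c))"

lemma wp_process:
  assumes e: "env n W q s" and B: "B = n + W + 2" and K: "nreg s 11 = K" "K \<le> n"
    and ord: "\<And>r. r < K \<Longrightarrow> nmem s (3 * B + r) = ord r" "\<And>r. r < K \<Longrightarrow> ord r < n"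
    and c: "nreg s 13 = C" "C < 2 ^ B" and f: "nreg s 12 = f"
  shows "wp process (\<lambda>t s'. t \<le> B * 11 + K * (K * 11 + 32) + 30 \<and> same {17..26} s s' \<and>
     rreg s' 0 = 0 \<and>
     (\<forall>a. a < 5 * B \<or> 6 * B \<le> a \<and> a \<noteq> 6 * B + C \<longrightarrow> nmem s' a = nmem s a) \<and>
     (\<forall>a. a \<noteq> n * n + C \<longrightarrow> rmem s' a = rmem s a) \<and>
     bellman q ord K (f + W + 1) (\<lambda>x. rmem s' (n * n + x)) (\<lambda>x. nmem s' (6 * B + x)) C) s"
proof -
  note E = envD[OF e, folded B]
  define S where "S = set_decode C"
  define l where "l = f + W + 1"
  define cd where "cd = (\<lambda>j. cands j l S)"
  define val where "val = option_value q ord K (\<lambda>x. rmem s (n * n + x)) C"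
  have cd_Suc: "cd (Suc j) = (if j \<notin> S \<and> j < l then insert j (cd j) else cd j)" for j
    unfolding cd_def cands_def by (auto simp: less_Suc_eq)
  have cd0: "cd 0 = {}" by (simp add: cd_def cands_def)
  \<comment> \<open>Values may be negative and there is no minus infinity; register 22 records
    whether a candidate has been seen, and the first one is accepted without comparison.\<close>
  define best where "best = (\<lambda>j (s' :: state). nreg s' 22 = (if cd j = {} then 0 else 1) \<and>
    (if cd j = {} then rreg s' 4 = 0
     else nreg s' 23 \<in> cd j \<and> rreg s' 4 = val (nreg s' 23) \<and> (\<forall>u\<in>cd j. val u \<le> rreg s' 4)))"
  have loop: "wp (For 18 11 candidate) (\<lambda>t s2. t \<le> K * (K * 11 + 32) + 2 \<and> same {18..25} s1 s2 \<and>
      nmem s2 = nmem s1 \<and> rmem s2 = rmem s1 \<and> rreg s2 0 = 0 \<and> best K s2) s1"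
    if s1: "same {17..26} s s1" "rreg s1 0 = 0" "rreg s1 4 = 0" "nreg s1 22 = 0" "nreg s1 24 = l"
      "rmem s1 = rmem s"
      "\<And>a. a < 5 * B \<or> 6 * B \<le> a \<Longrightarrow> nmem s1 a = nmem s a"
      "\<And>u. u < B \<Longrightarrow> nmem s1 (5 * B + u) = (if u \<in> S then 1 else 0)" for s1
  proof -
    define I where "I = (\<lambda>j s2. same {18..25} s1 s2 \<and> nreg s2 24 = l \<and> nmem s2 = nmem s1 \<and>
      rmem s2 = rmem s1 \<and> rreg s2 0 = 0 \<and> best j s2)"
    have r1: "nreg s1 x = nreg s x" if "x \<notin> {17..26}" for x
      using s1(1) that by (auto dest: sameD)
    show ?thesis
    proof (rule wp_For[where m = K and I = I and B = "K * 11 + 30"], goal_cases)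
      case 5
      then show ?case using s1 by (auto simp: I_def same_def best_def cd0)
    next
      case (6 j s2)
      have i2: "nmem s2 = nmem s1" "rmem s2 = rmem s" "rreg s2 0 = 0" "nreg s2 24 = l" "best j s2"
        "same {18..25} s1 s2"
        using 6(5) s1(6) unfolding I_def by auto
      have r2: "nreg s2 x = nreg s x" if "x \<notin> {17..26}" for x
        using i2(6) that r1 by (auto dest!: sameD[of _ _ _ x])
      have jK: "j < K" "j < B" "j < n" using 6(1) K(2) B by auto
      have pw: "nmem s1 (B + j) = 2 ^ j" using E(16)[OF jK(2)] s1(7)[of "B + j"] jK by simp
      have pl: "nmem s1 (5 * B + j) = (if j \<in> S then 1 else 0)" using s1(8)[OF jK(2)] .
      have od: "nmem s1 (3 * B + j) = ord j" using s1(7)[of "3 * B + j"] ord(1)[OF jK(1)] jK by simp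
      have rw: "nmem s1 (2 * B + ord j) = ord j * n"
        using s1(7)[of "2 * B + ord j"] E(17)[OF ord(2)[OF jK(1)]] ord(2)[OF jK(1)] B by simp
      have gain: "wp gain (\<lambda>t s4. t \<le> K * 11 + 2 \<and> same {19, 20, 21, 25} s2 s4 \<and>
         nmem s4 = nmem s1 \<and> rmem s4 = rmem s \<and> (\<forall>x. x \<notin> {2, 3} \<longrightarrow> rreg s4 x = rreg s2 x) \<and>
         rreg s4 2 = val j) s3"
        if s3: "same {19, 20, 25} s2 s3" "nreg s3 25 = ord j * n" "nmem s3 = nmem s1" "rmem s3 = rmem s"
          "\<forall>x. x \<notin> {2, 3} \<longrightarrow> rreg s3 x = rreg s2 x" "rreg s3 2 = rmem s (2 ^ j + C + n * n)"
        for s3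
      proof -
        have r3: "nreg s3 x = nreg s x" if "x \<notin> {17..26}" for x
          using s3(1) r2[OF that] that by (auto dest!: sameD[of _ _ _ x])
        have env3: "env n W q s3"
          by (rule env_change[OF e, where X = "{17..26}"])
            (use r3 s3 i2 s1(6,7) E in \<open>auto simp: same_def B\<close>)
        have val: "rreg s3 2 + (\<Sum>r\<in>{..<K} - S. q (ord j) (ord r)) = val j"
          unfolding val_def option_value_def S_def s3(6) by (simp add: ac_simps)
        have "wp gain (\<lambda>t s4. t \<le> K * 11 + 2 \<and> same {19, 20, 21} s3 s4 \<and>
           nmem s4 = nmem s3 \<and> rmem s4 = rmem s3 \<and> (\<forall>x. x \<notin> {2, 3} \<longrightarrow> rreg s4 x = rreg s3 x) \<and>
           rreg s4 2 = rreg s3 2 + (\<Sum>r\<in>{..<K} - S. q (ord j) (ord r))) s3"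
          by (rule wp_gain[OF env3 B _ K(2) _ ord(2)[OF jK(1)]])
            (use jK K ord s1(7,8) s3 r3 B in \<open>auto\<close>)
        then show ?thesis
          by (rule wp_mono) (use s3 val in \<open>auto simp: same_def\<close>)
      qed
      show ?case
      proof (cases "j \<notin> S \<and> j < l")
        case False
        then have cd: "cd (Suc j) = cd j" by (auto simp: cd_Suc)
        have best: "best (Suc j) s'" if "nreg s' 22 = nreg s2 22" "nreg s' 23 = nreg s2 23"
          "rreg s' 4 = rreg s2 4" for s'
          using i2(5) that by (cases "cd j = {}") (auto simp: best_def cd)
        show ?thesis
          using False 6(1-4) i2
          by (auto simp: candidate_def nop_def r2 E pl I_def same_def best s1(6))
      next
        case True
        then have cd: "cd (Suc j) = insert j (cd j)" by (auto simp: cd_Suc)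
        have keep: "best (Suc j) s'" if "nreg s' 22 = nreg s2 22" "nreg s' 23 = nreg s2 23"
          "rreg s' 4 = rreg s2 4" "cd j \<noteq> {}" "val j \<le> rreg s2 4" for s'
          using i2(5) that by (cases "cd j = {}") (auto simp: best_def cd)
        have upd: "best (Suc j) s'" if "nreg s' 22 = 1" "nreg s' 23 = j"
          "rreg s' 4 = val j" "cd j = {} \<or> rreg s2 4 < val j" for s'
        proof (cases "cd j = {}")
          case True
          then show ?thesis using that by (simp add: best_def cd)
        next
          case False
          then have "\<forall>u\<in>cd j. val u \<le> rreg s2 4" "rreg s2 4 < val j"
            using i2(5) that(4) by (auto simp: best_def)
          then have "val u \<le> val j" if "u \<in> insert j (cd j)" for u
            using that by force
          then show ?thesis
            using that(1-3) by (simp add: best_def cd)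
        qed
        have fl: "nreg s2 22 = 0 \<longleftrightarrow> cd j = {}" using i2(5) by (simp add: best_def)
        show ?thesis
          using True
          apply (simp add: candidate_def r2 i2(1-4) E pl pw od rw c(1) 6(2))
          apply (rule wp_mono[OF gain])
          apply (simp_all add: r2 i2 same_def)
          apply (auto simp: update_def nop_def I_def same_def fl s1(6) i2(1-5) r2 E K(1) 6(2)
              i2(6)[unfolded same_def, rule_format] intro: keep upd)
          done
      qed
    next
      case (7 t s')
      then show ?case by (auto simp: I_def algebra_simps)
    qed (use r1 E K in auto)
  qed
  have bell: "bellman q ord K l V' ch' C"
    if "best K s2" "V' C = rreg s2 4" "ch' C = nreg s2 23" "\<And>x. x \<noteq> C \<Longrightarrow> V' x = rmem s (n * n + x)"
    for s2 V' ch'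
  proof -
    \<comment> \<open>The recursion for \<open>C\<close> reads only entries at
      \<open>C + 2 ^ u\<close>, hence never the one being written.\<close>
    have "option_value q ord K V' C u = val u" for u
      unfolding option_value_def val_def using that(4)[of "C + 2 ^ u"] by simp
    then show ?thesis
      using that(1-3) unfolding bellman_def best_def cd_def S_def by (auto split: if_splits)
  qed
  show ?thesis
    unfolding process_def
    apply simp
    apply (rule wp_mono[OF wp_decode[OF e B]])
    using c apply simp
    apply simp
    apply (rule wp_mono[OF loop])
    apply (simp_all add: E f c same_def l_def S_def)
    apply (auto intro!: bell[unfolded l_def, simplified])
    done
qed


section \<open>The table of the dynamic program\<close>

text \<open>A set of placed items is coded by its sum of powers of two, which also serves as an unbounded
  memory address.  Bit \<open>0\<close> belongs to the item that is being inserted; bits from \<open>1\<close> on belong to the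
  old items in their current order, and \<open>f\<close> is the first of these that has not been placed.\<close>

definition code_family :: "nat \<Rightarrow> nat \<Rightarrow> nat set" where
  "code_family f W = {c. c < 2 ^ (f + 1 + W) \<and> f \<notin> set_decode c \<and> {1..<f} \<subseteq> set_decode c}"

lemma set_decode_iff_bit: "i \<in> set_decode c \<longleftrightarrow> bit c i"
  by (simp add: set_decode_def bit_iff_odd)

text \<open>The binary digits of a member: bit 0 is \<open>b\<close>, the ones at 1 to
  \<open>f - 1\<close> contribute \<open>2 ^ f - 2\<close>, bit \<open>f\<close> is zero, and
  \<open>m\<close> collects the \<open>W\<close> bits above. In this form the family can be
  enumerated by additions and subtractions alone.\<close>

lemma code_family_iff:
  assumes "1 \<le> f"
  shows "c \<in> code_family f W \<longleftrightarrow> (\<exists>b<2. \<exists>m<2 ^ W. c = b + (2 ^ f - 2) + 2 ^ (f + 1) * m)"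
proof
  assume c: "c \<in> code_family f W"
  define a where "a = take_bit (f + 1) c"
  have "bit (a div 2) i \<longleftrightarrow> bit (mask (f - 1) :: nat) i" for i
  proof -
    have "bit (a div 2) i \<longleftrightarrow> i < f \<and> bit c (Suc i)"
      unfolding a_def by (auto simp: bit_take_bit_iff simp flip: bit_Suc)
    also have "\<dots> \<longleftrightarrow> i < f - 1"
      using c by (cases "Suc i = f") (auto simp: code_family_def set_decode_iff_bit subset_iff)
    finally show ?thesis by (simp add: bit_mask_iff)
  qed
  then have "a div 2 = mask (f - 1)"
    by (rule bit_eqI)
  then have "a = a mod 2 + (2 ^ f - 2)"
    using assms mult_div_mod_eq[of 2 a] by (cases f) (auto simp: mask_eq_exp_minus_1 diff_mult_distrib2)
  moreover have "c = a + 2 ^ (f + 1) * (c div 2 ^ (f + 1))"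
    unfolding a_def take_bit_eq_mod by simp
  moreover have "c div 2 ^ (f + 1) < 2 ^ W"
    using c by (simp add: code_family_def less_mult_imp_div_less power_add mult_ac)
  ultimately show "\<exists>b<2. \<exists>m<2 ^ W. c = b + (2 ^ f - 2) + 2 ^ (f + 1) * m"
    by (metis mod_less_divisor pos2)
next
  assume "\<exists>b<2. \<exists>m<2 ^ W. c = b + (2 ^ f - 2) + 2 ^ (f + 1) * m"
  then obtain b m where b: "b < 2" and m: "m < 2 ^ W" and c: "c = b + (2 ^ f - 2) + 2 ^ (f + 1) * m"
    by blast
  have ge2: "2 \<le> (2::nat) ^ f"
    using assms by (cases f) auto
  define a where "a = b + (2 ^ f - 2)"
  have a: "a < 2 ^ f"
    using b ge2 unfolding a_def by linarith
  have "a div 2 = mask (f - 1)"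
    using assms b unfolding a_def by (cases f) (auto simp: mask_eq_exp_minus_1)
  then have abit: "bit a (Suc i) \<longleftrightarrow> i < f - 1" for i
    by (simp add: bit_Suc bit_mask_iff)
  have tb: "take_bit (f + 1) c = a"
    using a unfolding c a_def[symmetric] take_bit_eq_mod by simp
  have cbit: "bit c i \<longleftrightarrow> bit a i" if "i \<le> f" for i
    using that unfolding tb[symmetric] bit_take_bit_iff by simp
  have "a + 2 ^ (f + 1) * m < 2 ^ (f + 1) * (m + 1)"
    using a by simp
  also have "\<dots> \<le> 2 ^ (f + 1) * 2 ^ W"
    using m by (intro mult_left_mono) auto
  finally have "c < 2 ^ (f + 1 + W)"
    unfolding c a_def by (simp add: power_add)
  moreover have "\<not> bit c f"
    using cbit[of f] abit[of "f - 1"] assms by simp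
  moreover have "bit c i" if "i \<in> {1..<f}" for i
    using cbit[of i] abit[of "i - 1"] that by (cases i) auto
  ultimately show "c \<in> code_family f W"
    by (auto simp: code_family_def set_decode_iff_bit)
qed

lemma set_decode_plus:
  "u \<notin> set_decode c \<Longrightarrow> set_decode (c + 2 ^ u) = insert u (set_decode c)"
  using set_decode_plus_power_2[of u c] by (simp add: add.commute)

text \<open>The table is filled by decreasing \<open>f\<close> and, on one level, by decreasing
  code. An entry written later is never one that an earlier entry refers to: a successor of
  \<open>c\<close> exceeds \<open>c\<close> and keeps all its indices, among them \<open>f0\<close>
  if \<open>f0 < f\<close>.\<close>

lemma code_family_not_successor:
  assumes "c \<in> code_family f W" "c0 \<in> code_family f0 W" "1 \<le> f0" "f0 < f \<or> f0 = f \<and> c0 \<le> c" "u \<notin> set_decode c"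
  shows "c0 \<noteq> c + 2 ^ u"
proof
  assume eq: "c0 = c + 2 ^ u"
  then have "c < c0" by simp
  with assms(4) have "f0 < f" by auto
  then have "f0 \<in> set_decode c"
    using assms(1,3) by (auto simp: code_family_def)
  then have "f0 \<in> set_decode c0"
    using set_decode_plus[OF assms(5)] eq by simp
  with assms(2) show False by (simp add: code_family_def)
qed

lemma bellman_update:
  assumes "bellman q ord K l V ch c" "\<And>x. x \<noteq> d \<Longrightarrow> V' x = V x" "\<And>x. x \<noteq> d \<Longrightarrow> ch' x = ch x"
    "c \<noteq> d" "\<And>u. u \<notin> set_decode c \<Longrightarrow> d \<noteq> c + 2 ^ u"
  shows "bellman q ord K l V' ch' c"
proof -
  have "option_value q ord K V' c u = option_value q ord K V c u" if "u \<in> cands K l (set_decode c)" for u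
    using assms(2)[of "c + 2 ^ u"] assms(5)[of u] that
    by (auto simp: option_value_def cands_def)
  then show ?thesis
    using assms(1) assms(2)[of c] assms(3)[of c] assms(4) unfolding bellman_def
    by (cases "cands K l (set_decode c) = {}") (simp_all, metis)
qed

section \<open>The order in which the table is filled\<close>

definition bell_state :: "nat \<Rightarrow> nat \<Rightarrow> (nat \<Rightarrow> nat \<Rightarrow> real) \<Rightarrow> (nat \<Rightarrow> nat) \<Rightarrow> nat \<Rightarrow> nat \<Rightarrow> nat \<Rightarrow> state \<Rightarrow> bool" where
  "bell_state n W q ord K f c s \<longleftrightarrow>
     bellman q ord K (f + W + 1) (\<lambda>x. rmem s (n * n + x)) (\<lambda>x. nmem s (6 * (n + W + 2) + x)) c"

definition bells_done :: "nat \<Rightarrow> nat \<Rightarrow> (nat \<Rightarrow> nat \<Rightarrow> real) \<Rightarrow> (nat \<Rightarrow> nat) \<Rightarrow> nat \<Rightarrow> nat \<Rightarrow> nat \<Rightarrow> state \<Rightarrow> bool" where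
  "bells_done n W q ord K f b s \<longleftrightarrow>
     (\<forall>f' c. f \<le> f' \<longrightarrow> f' \<le> K \<longrightarrow> c \<in> code_family f' W \<longrightarrow> f < f' \<or> b \<le> c \<longrightarrow> bell_state n W q ord K f' c s)"

lemma wp_process_done:
  assumes e: "env n W q s" and B: "B = n + W + 2" and K: "nreg s 11 = K" "K \<le> n"
    and ord: "\<And>r. r < K \<Longrightarrow> nmem s (3 * B + r) = ord r" "\<And>r. r < K \<Longrightarrow> ord r < n"
    and f: "nreg s 12 = f" "1 \<le> f" "f \<le> K" and c: "nreg s 13 = C" "C \<in> code_family f W"
    and D: "bells_done n W q ord K f b s" "\<And>c. c \<in> code_family f W \<Longrightarrow> C < c \<Longrightarrow> b \<le> c"
  shows "wp process (\<lambda>t s'. t \<le> B * 11 + K * (K * 11 + 32) + 30 \<and> same {17..26} s s' \<and>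
     rreg s' 0 = 0 \<and> (\<forall>a. a < 5 * B \<longrightarrow> nmem s' a = nmem s a) \<and>
     (\<forall>a. a < n * n \<longrightarrow> rmem s' a = rmem s a) \<and> bells_done n W q ord K f C s') s"
proof -
  have "C < 2 ^ (f + 1 + W)" using c(2) by (simp add: code_family_def)
  also have "\<dots> \<le> 2 ^ B" using f K(2) B by (intro power_increasing) auto
  finally have C: "C < 2 ^ B" .
  show ?thesis
  proof (rule wp_mono[OF wp_process[OF e B K ord c(1) C f(1)]], goal_cases)
    case 3
    note P = 3
    have "bells_done n W q ord K f C s'"
      if P: "\<forall>a. a < 5 * B \<or> 6 * B \<le> a \<and> a \<noteq> 6 * B + C \<longrightarrow> nmem s' a = nmem s a"
        "\<forall>a. a \<noteq> n * n + C \<longrightarrow> rmem s' a = rmem s a"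
        "bellman q ord K (f + W + 1) (\<lambda>x. rmem s' (n * n + x)) (\<lambda>x. nmem s' (6 * B + x)) C" for s'
      unfolding bells_done_def
    proof (intro allI impI)
      fix f' c assume *: "f \<le> f'" "f' \<le> K" "c \<in> code_family f' W" "f < f' \<or> C \<le> c"
      show "bell_state n W q ord K f' c s'"
      proof (cases "c = C \<and> f' = f")
        case True
        then show ?thesis using P(3) B by (simp add: bell_state_def)
      next
        case False
        \<comment> \<open>Families of different levels are disjoint: \<open>f\<close> belongs to
          every set of a higher level, but not to the set coded by \<open>C\<close>.\<close>
        have neq: "c \<noteq> C"
        proof
          assume "c = C"
          with False *(1) have "f < f'" by auto
          then have "f \<in> set_decode c" using *(3) f(2) by (auto simp: code_family_def)
          with \<open>c = C\<close> c(2) show False by (simp add: code_family_def)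
        qed
        then have "f < f' \<or> b \<le> c"
          using *(1,3,4) neq D(2)[of c] by (cases "f < f'") auto
        then have old: "bell_state n W q ord K f' c s"
          using D(1) * unfolding bells_done_def by blast
        show ?thesis
          unfolding bell_state_def B[symmetric]
        proof (rule bellman_update[OF old[unfolded bell_state_def B[symmetric]], where d = C])
          have "f < f' \<or> f = f' \<and> C \<le> c" using *(1,4) by auto
          then show "C \<noteq> c + 2 ^ u" if "u \<notin> set_decode c" for u
            using code_family_not_successor[OF *(3) c(2) f(2)] that by blast
        qed (use P neq in auto)
      qed
    qed
    then show ?case using P by auto
  qed (use ord in auto)
qed

text \<open>The code with bit 0 set comes first, since the code without it refers to it by placing
  the new item. Adding 1 restores the larger code, from which subtracting \<open>2 ^ (f + 1)\<close>
  leads to the next smaller pair.\<close>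

definition mask_body :: prog where
  "mask_body = seqs [process, Instr (Sub 13 13 1), process, Instr (Add 13 13 1), Instr (Sub 13 13 27)]"

text \<open>Levels run from \<open>f = K\<close> down to 1. The start value
  \<open>2 ^ (f + 1 + W) - 2 ^ (f + 1) + 2 ^ f - 1\<close> has all bits below
  \<open>f + 1 + W\<close> set except bit \<open>f\<close>; it is the largest member of the family
  and is assembled from stored powers of two.\<close>

definition dp :: prog where
  "dp = For 28 11 (seqs
     [Instr (Sub 12 11 28), Instr (Add 19 3 12), Instr (Load 20 19), Instr (Add 19 19 1),
      Instr (Load 27 19), Instr (Add 19 19 2), Instr (Load 13 19), Instr (Sub 13 13 27),
      Instr (Add 13 13 20), Instr (Sub 13 13 1), For 14 15 mask_body])"

definition kept :: "nat \<Rightarrow> nat \<Rightarrow> state \<Rightarrow> state \<Rightarrow> bool" where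
  "kept n W s s' \<longleftrightarrow> rreg s' 0 = 0 \<and> (\<forall>a. a < 5 * (n + W + 2) \<longrightarrow> nmem s' a = nmem s a) \<and>
     (\<forall>a. a < n * n \<longrightarrow> rmem s' a = rmem s a)"

lemma nreg_update_simps [simp]:
  "kept n W s (s'\<lparr>nreg := x\<rparr>) = kept n W s s'"
  "bell_state n W q ord K f c (s'\<lparr>nreg := x\<rparr>) = bell_state n W q ord K f c s'"
  "bells_done n W q ord K f b (s'\<lparr>nreg := x\<rparr>) = bells_done n W q ord K f b s'"
  by (simp_all add: kept_def bell_state_def bells_done_def)

lemma env_kept:
  assumes "env n W q s" "same X s s'" "X \<inter> ({0..9} \<union> {15, 16, 31}) = {}" "kept n W s s'"
  shows "env n W q s'"
  by (rule env_change[OF assms(1-3)]) (use assms(4) envD(15)[OF assms(1)] in \<open>auto simp: kept_def\<close>)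

lemma wp_mask_body:
  assumes e: "env n W q s" and K: "nreg s 11 = K" "K \<le> n"
    and ord: "\<And>r. r < K \<Longrightarrow> nmem s (3 * (n + W + 2) + r) = ord r" "\<And>r. r < K \<Longrightarrow> ord r < n"
    and f: "nreg s 12 = f" "1 \<le> f" "f \<le> K" and j: "j < 2 ^ W"
    and c: "nreg s 13 = 2 ^ f - 1 + 2 ^ (f + 1) * (2 ^ W - 1 - j)" "nreg s 27 = 2 ^ (f + 1)"
    and D: "bells_done n W q ord K f (2 ^ f - 2 + 2 ^ (f + 1) * (2 ^ W - j)) s"
    and T: "T = (n + W + 2) * 11 + K * (K * 11 + 32) + 30"
  shows "wp mask_body (\<lambda>t s'. t \<le> 2 * T + 3 \<and> same ({13} \<union> {17..26}) s s' \<and> kept n W s s' \<and>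
     nreg s' 13 = 2 ^ f + 2 ^ (f + 1) * (2 ^ W - 1 - j) - 1 - 2 ^ (f + 1) \<and>
     bells_done n W q ord K f (2 ^ f - 2 + 2 ^ (f + 1) * (2 ^ W - Suc j)) s') s"
proof -
  define C where "C = 2 ^ f - 2 + 2 ^ (f + 1) * (2 ^ W - Suc j)"
  have ge2: "2 \<le> (2::nat) ^ f"
    using f(2) by (cases f) auto
  have c1: "nreg s 13 = Suc C"
    using c(1) ge2 by (simp add: C_def)
  have "2 ^ W - Suc j < 2 ^ W" by simp
  then have code_family: "Suc C \<in> code_family f W" "C \<in> code_family f W"
    unfolding code_family_iff[OF f(2)] C_def
    by (intro exI[of _ "1::nat"] exI[of _ "0::nat"] exI[of _ "2 ^ W - Suc j"] conjI; simp)+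
  \<comment> \<open>No member lies strictly between \<open>Suc C\<close> and the pair treated before
    it, because a member above \<open>Suc C\<close> has a larger upper part
    \<open>m\<close>.\<close>
  have nxt: "2 ^ f - 2 + 2 ^ (f + 1) * (2 ^ W - j) \<le> c" if cf: "c \<in> code_family f W" and lt: "Suc C < c" for c
  proof -
    obtain b m where bm: "b < 2" "c = b + (2 ^ f - 2) + 2 ^ (f + 1) * m"
      using cf unfolding code_family_iff[OF f(2)] by blast
    have "2 ^ W - Suc j < m"
    proof (rule ccontr)
      assume "\<not> ?thesis"
      then have "2 ^ (f + 1) * m \<le> 2 ^ (f + 1) * (2 ^ W - Suc j)"
        by (intro mult_left_mono) auto
      then show False using bm lt unfolding C_def by linarith
    qed
    then have "2 ^ (f + 1) * (2 ^ W - j) \<le> 2 ^ (f + 1) * m"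
      by (intro mult_left_mono) auto
    then show ?thesis using bm by linarith
  qed
  have step1: "wp process (\<lambda>t s'. t \<le> T \<and> same {17..26} s s' \<and> kept n W s s' \<and>
     bells_done n W q ord K f (Suc C) s') s"
    by (rule wp_mono[OF wp_process_done[OF e refl K ord f c1 code_family(1) D nxt]])
      (auto simp: T kept_def)
  have step2: "wp process (\<lambda>t s'. t \<le> T \<and> same ({13} \<union> {17..26}) s s' \<and> nreg s' 13 = C \<and> kept n W s s' \<and>
     bells_done n W q ord K f C s') s1"
    if s1: "same ({13} \<union> {17..26}) s s1" "nreg s1 13 = C" "kept n W s s1" "bells_done n W q ord K f (Suc C) s1"
    for s1
  proof -
    have env1: "env n W q s1" by (rule env_kept[OF e s1(1) _ s1(3)]) auto
    have r: "nreg s1 x = nreg s x" if "x \<notin> {13} \<union> {17..26}" for x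
      using s1(1) that by (rule sameD)
    have o: "nmem s1 (3 * (n + W + 2) + r) = ord r" if "r < K" for r
      using ord(1)[OF that] s1(3) that K(2) by (simp add: kept_def)
    show ?thesis
      by (rule wp_mono[OF wp_process_done[OF env1 refl _ K(2) o ord(2) _ f(2,3) s1(2) code_family(2) s1(4)]])
        (use K f s1 in \<open>auto simp: r T kept_def same_def\<close>)
  qed
  show ?thesis
    unfolding mask_body_def
    apply simp
    apply (rule wp_mono[OF step1])
    apply (rule wp_mono[OF step2])
    apply (auto simp: same_def c1 kept_def bells_done_def bell_state_def envD[OF e] c(2) C_def)
    using ge2 by linarith
qed

lemma wp_dp:
  assumes e: "env n W q s" and K: "nreg s 11 = K" "K \<le> n"
    and ord: "\<And>r. r < K \<Longrightarrow> nmem s (3 * (n + W + 2) + r) = ord r" "\<And>r. r < K \<Longrightarrow> ord r < n"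
    and T: "T = (n + W + 2) * 11 + K * (K * 11 + 32) + 30"
  shows "wp dp (\<lambda>t s'. t \<le> K * (2 ^ W * (2 * T + 5) + 14) + 2 \<and> same ({12, 13, 14} \<union> {17..28}) s s' \<and>
     kept n W s s' \<and>
     (\<forall>f c. 1 \<le> f \<longrightarrow> f \<le> K \<longrightarrow> c \<in> code_family f W \<longrightarrow> bell_state n W q ord K f c s')) s"
proof -
  note E = envD[OF e]
  define I where "I = (\<lambda>j s'. same ({12, 13, 14} \<union> {17..28}) s s' \<and> kept n W s s' \<and>
     (\<forall>f c. K - j < f \<longrightarrow> f \<le> K \<longrightarrow> c \<in> code_family f W \<longrightarrow> bell_state n W q ord K f c s'))"
  show ?thesis
    unfolding dp_def
  proof (rule wp_For[where m = K and I = I and B = "2 ^ W * (2 * T + 5) + 12"], goal_cases)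
    case 5
    then show ?case using E by (auto simp: I_def same_def kept_def)
  next
    case (6 j s1)
    have i1: "same ({12, 13, 14} \<union> {17..28}) s s1" "kept n W s s1"
      "\<And>f c. K - j < f \<Longrightarrow> f \<le> K \<Longrightarrow> c \<in> code_family f W \<Longrightarrow> bell_state n W q ord K f c s1"
      using 6(5) unfolding I_def by auto
    have r1: "nreg s1 x = nreg s x" if "x \<notin> {12, 13, 14} \<union> {17..28}" for x
      using i1(1) that by (rule sameD)
    define f where "f = K - j"
    have f: "1 \<le> f" "f \<le> K" "f \<le> n" "nreg s 11 - j = f" using 6(1) K by (auto simp: f_def)
    have ge2: "2 \<le> (2::nat) ^ f" using f(1) by (cases f) auto
    have pw: "nmem s1 (n + W + 2 + i) = 2 ^ i" if "i < n + W + 2" for i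
      using E(16)[OF that] i1(2) that by (simp add: kept_def)
    have pws: "nmem s1 (n + W + 2 + f) = 2 ^ f" "nmem s1 (n + W + 2 + f + 1) = 2 ^ (f + 1)"
      "nmem s1 (n + W + 2 + f + 1 + W) = 2 ^ (f + 1 + W)"
      using pw[of f] pw[of "f + 1"] pw[of "f + 1 + W"] f(3) by (simp_all add: ac_simps)
    have top: "2 ^ (f + 1 + W) - 2 ^ (f + 1) + 2 ^ f - 1 = (2::nat) ^ f - 1 + 2 ^ (f + 1) * (2 ^ W - 1)"
      using ge2 by (simp add: power_add diff_mult_distrib2)
    have loop: "wp (For 14 15 mask_body) (\<lambda>t s'. t \<le> 2 ^ W * (2 * T + 5) + 2 \<and>
        same ({13, 14} \<union> {17..26}) s2 s' \<and> kept n W s s' \<and>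
        bells_done n W q ord K f (2 ^ f - 2) s') s2"
      if s2: "same ({12, 13, 14} \<union> {17..28}) s s2" "nreg s2 12 = f" "kept n W s s2"
        "nreg s2 27 = 2 ^ (f + 1)" "nreg s2 13 = 2 ^ f - 1 + 2 ^ (f + 1) * (2 ^ W - 1)"
        "\<And>f' c. f < f' \<Longrightarrow> f' \<le> K \<Longrightarrow> c \<in> code_family f' W \<Longrightarrow> bell_state n W q ord K f' c s2"
      for s2
    proof -
      have r2: "nreg s2 x = nreg s x" if "x \<notin> {12, 13, 14} \<union> {17..28}" for x
        using s2(1) that by (rule sameD)
      \<comment> \<open>The last subtraction is truncated at 0, so register 13 is specified only
        while rounds remain.\<close>
      define J where "J = (\<lambda>j s'. same ({13, 14} \<union> {17..26}) s2 s' \<and> kept n W s s' \<and>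
        (j < 2 ^ W \<longrightarrow> nreg s' 13 = 2 ^ f - 1 + 2 ^ (f + 1) * (2 ^ W - 1 - j)) \<and>
        bells_done n W q ord K f (2 ^ f - 2 + 2 ^ (f + 1) * (2 ^ W - j)) s')"
      show ?thesis
      proof (rule wp_For[where m = "2 ^ W" and I = J and B = "2 * T + 3"], goal_cases)
        case 5
        \<comment> \<open>The initial threshold exceeds every code of level \<open>f\<close>, so
          that only the higher levels have to be complete.\<close>
        have "c < 2 ^ (f + 1) * 2 ^ W" if "c \<in> code_family f W" for c
          using that by (simp add: code_family_def power_add)
        then have "bells_done n W q ord K f (2 ^ f - 2 + 2 ^ (f + 1) * 2 ^ W) s2"
          using s2(6) unfolding bells_done_def by (metis add_leE le_neq_implies_less not_le)
        then show ?case
          using s2 by (auto simp: J_def same_def kept_def bells_done_def bell_state_def)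
      next
        case (6 i s3)
        have i3: "same ({13, 14} \<union> {17..26}) s2 s3" "kept n W s s3"
          "nreg s3 13 = 2 ^ f - 1 + 2 ^ (f + 1) * (2 ^ W - 1 - i)"
          "bells_done n W q ord K f (2 ^ f - 2 + 2 ^ (f + 1) * (2 ^ W - i)) s3"
          using 6(1,5) unfolding J_def by auto
        have r3: "nreg s3 x = nreg s2 x" if "x \<notin> {13, 14} \<union> {17..26}" for x
          using i3(1) that by (rule sameD)
        have ss3: "same ({12, 13, 14} \<union> {17..28}) s s3"
          by (rule same_trans[OF s2(1) i3(1)]) auto
        have env3: "env n W q s3" by (rule env_kept[OF e ss3 _ i3(2)]) auto
        have o: "nmem s3 (3 * (n + W + 2) + r) = ord r" if "r < K" for r
          using ord(1)[OF that] i3(2) that K(2) by (simp add: kept_def)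
        have body: "wp mask_body (\<lambda>t s'. t \<le> 2 * T + 3 \<and> same ({13} \<union> {17..26}) s3 s' \<and> kept n W s3 s' \<and>
           nreg s' 13 = 2 ^ f + 2 ^ (f + 1) * (2 ^ W - 1 - i) - 1 - 2 ^ (f + 1) \<and>
           bells_done n W q ord K f (2 ^ f - 2 + 2 ^ (f + 1) * (2 ^ W - Suc i)) s') s3"
          by (rule wp_mask_body[OF env3 _ K(2) o ord(2) _ f(1,2) 6(1) i3(3) _ i3(4) T])
            (use r3 r2 K s2 in auto)
        have nxt: "2 ^ f + 2 ^ (f + 1) * (2 ^ W - 1 - i) - 1 - 2 ^ (f + 1) =
            (2::nat) ^ f - 1 + 2 ^ (f + 1) * (2 ^ W - 1 - Suc i)" if "Suc i < 2 ^ W"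
        proof -
          have "2 ^ W - 1 - i = Suc (2 ^ W - 1 - Suc i)" using that by simp
          then show ?thesis using ge2 by simp
        qed
        show ?case
          by (rule wp_mono[OF body])
            (use 6(2-4) i3(1,2) nxt in \<open>auto simp: J_def same_def kept_def bells_done_def bell_state_def\<close>)
      next
        case (7 t s')
        then show ?case by (auto simp: J_def algebra_simps)
      qed (use r2 E in auto)
    qed
    have top2: "2 * (2 ^ f * 2 ^ W) = 2 * 2 ^ f * (2 ^ W - Suc 0) + 2 * (2::nat) ^ f"
      by (simp add: diff_mult_distrib2)
    have fin_done: "bell_state n W q ord K f' c s'"
      if "bells_done n W q ord K f (2 ^ f - 2) s'" "K - Suc j < f'" "f' \<le> K" "c \<in> code_family f' W" for s' f' c
    proof -
      have "2 ^ f - 2 \<le> c" if "c \<in> code_family f W"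
        using that unfolding code_family_iff[OF f(1)] by auto
      moreover have "f \<le> f'" using that(2) f_def 6(1) by linarith
      ultimately show ?thesis
        using that unfolding bells_done_def by (cases "f = f'") auto
    qed
    show ?case
      apply (simp add: r1 E 6(2) f(4) pws[simplified])
      apply (rule wp_mono[OF loop])
      apply (simp_all add: same_def r1 E 6(2,3) K(1) i1(2) power_add)
        apply (use top2 ge2 in linarith)
       apply (use i1(3) in \<open>simp add: f_def\<close>)
      apply (auto simp: I_def same_def r1 fin_done)
      done
  next
    case (7 t s')
    then show ?case by (auto simp: I_def algebra_simps)
  qed (use E K in auto)
qed


section \<open>Optimality of the dynamic program\<close>

text \<open>The inner sum starts at \<open>a\<close> itself in order to match the diagonal terms of
  \<open>option_value\<close>; their total is the same for all orders.\<close>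

definition order_total :: "(nat \<Rightarrow> nat \<Rightarrow> real) \<Rightarrow> nat \<Rightarrow> (nat \<Rightarrow> nat) \<Rightarrow> real" where
  "order_total q K w = (\<Sum>a<K. \<Sum>b\<in>{a..<K}. q (w a) (w b))"

text \<open>Index 0, the new item, is exempt from the search. If all old items have been placed, the
  gap is \<open>K\<close>.\<close>

definition first_gap :: "nat set \<Rightarrow> nat" where
  "first_gap S = (LEAST f. 1 \<le> f \<and> f \<notin> S)"

lemma first_gap:
  assumes "S \<subseteq> {..<K}" "1 \<le> K"
  shows "1 \<le> first_gap S" "first_gap S \<notin> S" "first_gap S \<le> K" "{1..<first_gap S} \<subseteq> S"
proof -
  have K: "1 \<le> K \<and> K \<notin> S" using assms by auto
  have "1 \<le> first_gap S \<and> first_gap S \<notin> S"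
    unfolding first_gap_def using K by (rule LeastI)
  then show "1 \<le> first_gap S" "first_gap S \<notin> S" by blast+
  show "first_gap S \<le> K"
    unfolding first_gap_def using K by (rule Least_le)
  show "{1..<first_gap S} \<subseteq> S"
  proof
    fix i assume i: "i \<in> {1..<first_gap S}"
    then have "\<not> (1 \<le> i \<and> i \<notin> S)"
      unfolding first_gap_def by (intro not_less_Least) simp
    then show "i \<in> S" using i by simp
  qed
qed

lemma set_encode_less:
  assumes "S \<subseteq> {..<m}"
  shows "set_encode S < 2 ^ m"
proof -
  have "set_encode S \<le> set_encode {..<m}"
    using assms unfolding set_encode_def by (intro sum_mono2) auto
  also have "\<dots> < 2 ^ m"
    unfolding set_encode_def using sum_power2[of m] by (simp add: atLeast0LessThan)
  finally show ?thesis .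
qed

lemma set_encode_code_family:
  assumes "S \<subseteq> {..<K}" "1 \<le> K" "S \<subseteq> {..first_gap S + W}"
  shows "set_encode S \<in> code_family (first_gap S) W"
proof -
  have fin: "finite S" using assms(1) finite_subset by blast
  have "set_encode S < 2 ^ (first_gap S + 1 + W)"
    using assms(3) by (intro set_encode_less) auto
  then show ?thesis
    using first_gap[OF assms(1,2)] unfolding code_family_def by (auto simp: set_encode_inverse[OF fin])
qed

lemma set_encode_insert_add:
  "finite S \<Longrightarrow> u \<notin> S \<Longrightarrow> set_encode (insert u S) = set_encode S + 2 ^ u"
  by (simp add: set_encode_insert)

definition bellman_table where
  "bellman_table q ord K W V ch \<longleftrightarrow> (\<forall>S. S \<subseteq> {..<K} \<longrightarrow> S \<subseteq> {..first_gap S + W} \<longrightarrow>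
     bellman q ord K (first_gap S + W + 1) V ch (set_encode S))"

text \<open>Every prefix of an order that respects the window is a set represented in the table.
  Each placement of the order competes in the maximum at its prefix, and the resulting inequalities
  telescope.\<close>

lemma bellman_upper:
  assumes tab: "bellman_table q ord K W V ch" and K: "1 \<le> K" and v: "bij_betw v {..<K} {..<K}"
    and win: "\<And>a b. a < b \<Longrightarrow> b < K \<Longrightarrow> 1 \<le> v a \<Longrightarrow> 1 \<le> v b \<Longrightarrow> v a \<le> v b + W"
  shows "order_total q K (ord \<circ> v) \<le> V 0"
proof -
  define S where "S = (\<lambda>p. v ` {..<p})"
  have inj: "inj_on v {..<K}" and im: "v ` {..<K} = {..<K}"
    using v by (auto simp: bij_betw_def)
  have S: "S p \<subseteq> {..<K}" if "p \<le> K" for p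
    using image_mono[of "{..<p}" "{..<K}" v] that unfolding S_def im by simp
  have notin: "v b \<notin> S p" if "p \<le> b" "b < K" for p b
    using inj that unfolding S_def by (auto dest!: inj_onD)
  have ex: "\<exists>b. p \<le> b \<and> b < K \<and> u = v b" if "u < K" "u \<notin> S p" for u p
  proof -
    have "u \<in> v ` {..<K}" using im that(1) by simp
    then obtain b where "b < K" "u = v b" by auto
    moreover have "p \<le> b"
    proof (rule ccontr)
      assume "\<not> p \<le> b"
      then have "v b \<in> S p" by (simp add: S_def)
      then show False using \<open>u = v b\<close> that(2) by simp
    qed
    ultimately show ?thesis by blast
  qed
  \<comment> \<open>A first gap below \<open>K\<close> is the index of an item placed at
    \<open>p\<close> or later; the window condition for this item bounds every index placed up to
    \<open>p\<close>.\<close>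
  have bound: "v a \<le> first_gap (S p) + W" if "a \<le> p" "a < K" "p \<le> K" for a p
  proof -
    note l = first_gap[OF S[OF that(3)] K]
    have va: "v a < K" using im that(2) by blast
    show ?thesis
    proof (cases "first_gap (S p) < K \<and> 1 \<le> v a")
      case True
      then obtain b where b: "p \<le> b" "b < K" "first_gap (S p) = v b" using ex l(2) by blast
      then show ?thesis using win[of a b] l(1) True that by (cases "a = b") auto
    qed (use va in auto)
  qed
  have win': "S p \<subseteq> {..first_gap (S p) + W}" if "p \<le> K" for p
    using bound that unfolding S_def by auto
  have bel: "bellman q ord K (first_gap (S p) + W + 1) V ch (set_encode (S p))" if "p \<le> K" for p
    using tab S[OF that] win'[OF that] unfolding bellman_table_def by blast
  have dec: "set_decode (set_encode (S p)) = S p" for p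
    by (simp add: S_def set_encode_inverse)
  have step: "V (set_encode (S (Suc p))) + (\<Sum>b\<in>{p..<K}. q (ord (v p)) (ord (v b))) \<le> V (set_encode (S p))"
    if "p < K" for p
  proof -
    have c: "v p \<in> cands K (first_gap (S p) + W + 1) (S p)"
      using notin[of p p] bound[of p p] that im by (auto simp: cands_def)
    then have "option_value q ord K V (set_encode (S p)) (v p) \<le> V (set_encode (S p))"
      using bel[of p] that unfolding bellman_def dec by (auto split: if_splits)
    moreover have "S (Suc p) = insert (v p) (S p)"
      unfolding S_def by (simp add: lessThan_Suc)
    moreover have "{..<K} - S p = v ` {p..<K}"
    proof -
      have "v ` ({..<K} - {..<p}) = v ` {..<K} - v ` {..<p}"
        by (rule inj_on_image_set_diff[OF inj]) (use that in auto)
      moreover have "{..<K} - {..<p} = {p..<K}" by auto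
      ultimately show ?thesis unfolding im S_def by simp
    qed
    moreover have "inj_on v {p..<K}"
      using inj by (rule inj_on_subset) auto
    ultimately show ?thesis
      using notin[of p p] that unfolding option_value_def dec
      by (simp add: set_encode_insert_add sum.reindex S_def add.commute)
  qed
  have "V (set_encode (S p)) + (\<Sum>a<p. \<Sum>b\<in>{a..<K}. q (ord (v a)) (ord (v b))) \<le> V 0" if "p \<le> K" for p
    using that
  proof (induction p)
    case 0
    then show ?case by (simp add: S_def)
  next
    case (Suc p)
    then show ?case using step[of p] by simp
  qed
  from this[of K] have "V (set_encode (S K)) + order_total q K (ord \<circ> v) \<le> V 0"
    by (simp add: order_total_def)
  moreover have "V (set_encode (S K)) = 0"
    using bel[of K] im unfolding bellman_def dec by (auto simp: cands_def S_def)
  ultimately show ?thesis by simp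
qed

fun path_code :: "(nat \<Rightarrow> nat) \<Rightarrow> nat \<Rightarrow> nat" where
  "path_code ch 0 = 0"
| "path_code ch (Suc p) = path_code ch p + 2 ^ ch (path_code ch p)"

text \<open>Following the recorded choices never leaves the represented sets: a candidate lies
  within \<open>W\<close> of the first gap, and the gap only moves up. Every choice adds a new
  index, so \<open>K\<close> choices form a permutation.\<close>

lemma path_properties:
  assumes tab: "bellman_table q ord K W V ch" and K: "1 \<le> K"
  defines "v \<equiv> (\<lambda>p. ch (path_code ch p))"
  shows "bij_betw v {..<K} {..<K}" "order_total q K (ord \<circ> v) = V 0"
proof -
  define S where "S = (\<lambda>p. set_decode (path_code ch p))"
  have P: "S p \<subseteq> {..<K} \<and> card (S p) = p \<and> S p \<subseteq> {..first_gap (S p) + W} \<and> S p = v ` {..<p} \<and>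
      V 0 = V (path_code ch p) + (\<Sum>a<p. \<Sum>r\<in>{..<K} - S a. q (ord (v a)) (ord r)) \<and>
      (\<forall>a<p. v a < K \<and> v a \<notin> S a)" if "p \<le> K" for p
    using that
  proof (induction p)
    case 0
    then show ?case by (simp add: S_def)
  next
    case (Suc p)
    note * = Suc.IH[OF Suc_leD[OF Suc.prems]]
    have IH: "S p \<subseteq> {..<K}" "card (S p) = p" "S p \<subseteq> {..first_gap (S p) + W}" "S p = v ` {..<p}"
      "V 0 = V (path_code ch p) + (\<Sum>a<p. \<Sum>r\<in>{..<K} - S a. q (ord (v a)) (ord r))"
      "\<forall>a<p. v a < K \<and> v a \<notin> S a" using * by blast+
    note l = first_gap[OF IH(1) K]
    have enc: "set_encode (S p) = path_code ch p" by (simp add: S_def)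
    \<comment> \<open>The first gap is itself a candidate if it is below \<open>K\<close>. Otherwise
      only the new item can be missing, and it is missing because fewer than \<open>K\<close> items
      have been placed.\<close>
    have "cands K (first_gap (S p) + W + 1) (S p) \<noteq> {}"
    proof (cases "first_gap (S p) < K")
      case True
      then show ?thesis using l(2) by (auto simp: cands_def)
    next
      case False
      have "0 \<notin> S p"
      proof
        assume "0 \<in> S p"
        have "u \<in> S p" if "u < K" for u
        proof (cases "u = 0")
          case False
          then have "u \<in> {1..<first_gap (S p)}" using \<open>\<not> first_gap (S p) < K\<close> that by auto
          then show ?thesis using l(4) by blast
        qed (use \<open>0 \<in> S p\<close> in simp)
        then have "S p = {..<K}" using IH(1) by blast
        then have "card (S p) = K" by simp
        then show False using IH(2) Suc.prems by simp
      qed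
      then have "0 \<in> cands K (first_gap (S p) + W + 1) (S p)" using K by (simp add: cands_def)
      then show ?thesis by blast
    qed
    moreover have "bellman q ord K (first_gap (S p) + W + 1) V ch (set_encode (S p))"
      using tab IH unfolding bellman_table_def by blast
    ultimately have c: "v p \<in> cands K (first_gap (S p) + W + 1) (S p)"
      "V (path_code ch p) = option_value q ord K V (path_code ch p) (v p)"
      unfolding bellman_def enc S_def v_def by (auto split: if_splits)
    have vp: "v p < K" "v p \<notin> S p" "v p \<le> first_gap (S p) + W" using c(1) by (auto simp: cands_def)
    have ins: "S (Suc p) = insert (v p) (S p)"
      using vp(2) by (simp add: S_def v_def set_decode_plus)
    have sub: "S (Suc p) \<subseteq> {..<K}" using ins IH(1) vp(1) by auto
    have "first_gap (S p) \<le> first_gap (S (Suc p))"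
    proof -
      have "first_gap (S (Suc p)) \<notin> S p" "1 \<le> first_gap (S (Suc p))" using first_gap[OF sub K] ins by auto
      then have "first_gap (S (Suc p)) \<notin> {1..<first_gap (S p)}" using l(4) by blast
      then show ?thesis using \<open>1 \<le> first_gap (S (Suc p))\<close> by simp
    qed
    then have "S (Suc p) \<subseteq> {..first_gap (S (Suc p)) + W}"
      using ins IH(3) vp(3) by fastforce
    moreover have "card (S (Suc p)) = Suc p"
      using ins vp(2) IH(2) IH(1) finite_subset[OF IH(1)] by simp
    moreover have "S (Suc p) = v ` {..<Suc p}"
      using ins IH(4) by (simp add: lessThan_Suc)
    moreover have "V (path_code ch p) = V (path_code ch (Suc p)) + (\<Sum>r\<in>{..<K} - S p. q (ord (v p)) (ord r))"
      using c(2) by (simp add: option_value_def S_def v_def)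
    ultimately show ?case
      using sub IH(5,6) vp by (auto simp: less_Suc_eq)
  qed
  note PK = P[OF order_refl]
  have SK: "v ` {..<K} = {..<K}"
    using PK card_subset_eq[of "{..<K}" "S K"] by auto
  then have inj: "inj_on v {..<K}"
    by (intro eq_card_imp_inj_on) auto
  with SK show "bij_betw v {..<K} {..<K}" by (simp add: bij_betw_def)
  have rest: "{..<K} - S a = v ` {a..<K}" if "a < K" for a
  proof -
    have "S a = v ` {..<a}" using P[of a] that by simp
    moreover have "{..<K} - {..<a} = {a..<K}" by auto
    moreover have "v ` ({..<K} - {..<a}) = v ` {..<K} - v ` {..<a}"
      by (rule inj_on_image_set_diff[OF inj]) (use that in auto)
    ultimately show ?thesis unfolding SK by simp
  qed
  have "V (path_code ch K) = 0"
  proof -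
    have "bellman q ord K (first_gap (S K) + W + 1) V ch (set_encode (S K))"
      using tab PK unfolding bellman_table_def by blast
    moreover have "cands K (first_gap (S K) + W + 1) (S K) = {}"
      using PK SK by (auto simp: cands_def)
    ultimately show ?thesis unfolding bellman_def by (simp add: S_def)
  qed
  moreover have "(\<Sum>r\<in>{..<K} - S a. q (ord (v a)) (ord r)) = (\<Sum>b\<in>{a..<K}. q (ord (v a)) (ord (v b)))"
    if "a < K" for a
  proof -
    have "inj_on v {a..<K}" using inj by (rule inj_on_subset) auto
    then show ?thesis unfolding rest[OF that] by (simp add: sum.reindex)
  qed
  ultimately show "order_total q K (ord \<circ> v) = V 0"
    using PK unfolding order_total_def by simp
qed

text \<open>Here orders are functions from positions to items, inverse to the convention of \<open>score\<close>.\<close>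

definition window_order :: "nat \<Rightarrow> nat \<Rightarrow> (nat \<Rightarrow> nat) \<Rightarrow> (nat \<Rightarrow> nat) \<Rightarrow> bool" where
  "window_order W k x w \<longleftrightarrow>
     (\<forall>i j a b. i < k \<longrightarrow> j < k \<longrightarrow> a < b \<longrightarrow> b \<le> k \<longrightarrow> w a = x j \<longrightarrow> w b = x i \<longrightarrow> j \<le> i + W)"

text \<open>Only the comparison with window orders is recorded. It makes \<open>y\<close> optimal as
  soon as some optimal order is known to be a window order for \<open>x\<close>.\<close>

definition dp_step :: "(nat \<Rightarrow> nat \<Rightarrow> real) \<Rightarrow> nat \<Rightarrow> nat \<Rightarrow> (nat \<Rightarrow> nat) \<Rightarrow> (nat \<Rightarrow> nat) \<Rightarrow> bool" where
  "dp_step q W k x y \<longleftrightarrow> bij_betw y {..<Suc k} {..<Suc k} \<and>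
     (\<forall>w. bij_betw w {..<Suc k} {..<Suc k} \<longrightarrow> window_order W k x w \<longrightarrow> order_total q (Suc k) w \<le> order_total q (Suc k) y)"

lemma order_total_cong: "(\<And>a. a < K \<Longrightarrow> w a = w' a) \<Longrightarrow> order_total q K w = order_total q K w'"
  by (simp add: order_total_def)

lemma dp_step_path:
  assumes x: "bij_betw x {..<k} {..<k}"
    and ord: "ord = (\<lambda>u. if u = 0 then k else x (u - 1))"
    and tab: "bellman_table q ord (Suc k) W V ch"
  shows "dp_step q W k x (\<lambda>p. ord (ch (path_code ch p)))"
proof -
  have im: "x ` {..<k} = {..<k}" and inj: "inj_on x {..<k}" using x by (auto simp: bij_betw_def)
  have xlt: "x i < k" if "i < k" for i using im that by blast
  have io: "inj_on ord {..<Suc k}"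
  proof (rule inj_onI)
    fix a b assume ab: "a \<in> {..<Suc k}" "b \<in> {..<Suc k}" "ord a = ord b"
    then show "a = b"
      using xlt[of "a - 1"] xlt[of "b - 1"] inj_onD[OF inj, of "a - 1" "b - 1"]
      by (cases a; cases b) (auto simp: ord)
  qed
  moreover have "ord ` {..<Suc k} \<subseteq> {..<Suc k}"
  proof
    fix y assume "y \<in> ord ` {..<Suc k}"
    then obtain u where u: "u < Suc k" "y = ord u" by auto
    then show "y \<in> {..<Suc k}" using xlt[of "u - 1"] by (cases u) (auto simp: ord)
  qed
  ultimately have bo: "bij_betw ord {..<Suc k} {..<Suc k}"
    by (simp add: bij_betw_def endo_inj_surj)
  note path = path_properties[OF tab]
  have bij: "bij_betw (\<lambda>p. ord (ch (path_code ch p))) {..<Suc k} {..<Suc k}"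
    using bij_betw_trans[OF path(1) bo] by (simp add: comp_def)
  have opt: "order_total q (Suc k) w \<le> order_total q (Suc k) (\<lambda>p. ord (ch (path_code ch p)))"
    if w: "bij_betw w {..<Suc k} {..<Suc k}" "window_order W k x w" for w
  proof -
    \<comment> \<open>Passage from items to indices: the new item becomes 0 and the old item at
      position \<open>i\<close> becomes \<open>i + 1\<close>.\<close>
    define v where "v = inv_into {..<Suc k} ord \<circ> w"
    have bv: "bij_betw v {..<Suc k} {..<Suc k}"
      unfolding v_def using bij_betw_trans[OF w(1) bij_betw_inv_into[OF bo]] .
    have ov: "ord (v a) = w a" if "a < Suc k" for a
    proof -
      have "w a \<in> ord ` {..<Suc k}" using w(1) bo that by (auto simp: bij_betw_def)
      then show ?thesis unfolding v_def by (simp add: f_inv_into_f)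
    qed
    have vlt: "v a < Suc k" if "a < Suc k" for a
      using bv that by (auto simp: bij_betw_def)
    have "order_total q (Suc k) (ord \<circ> v) \<le> V 0"
    proof (rule bellman_upper[OF tab _ bv])
      fix a b assume *: "a < b" "b < Suc k" "1 \<le> v a" "1 \<le> v b"
      then have "w a = x (v a - 1)" "w b = x (v b - 1)"
        using ov[of a] ov[of b] by (auto simp: ord)
      moreover have "v a - 1 < k" "v b - 1 < k" using vlt[of a] vlt[of b] * by auto
      ultimately have "v a - 1 \<le> v b - 1 + W"
        using w(2) * unfolding window_order_def by (metis less_Suc_eq_le)
      then show "v a \<le> v b + W" using * by simp
    qed simp
    moreover have "order_total q (Suc k) (ord \<circ> v) = order_total q (Suc k) w"
      by (rule order_total_cong) (simp add: ov)
    moreover have "order_total q (Suc k) (\<lambda>p. ord (ch (path_code ch p))) = V 0"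
      using path(2) by (simp add: comp_def)
    ultimately show ?thesis by simp
  qed
  show ?thesis using bij opt by (simp add: dp_step_def)
qed


section \<open>Insertion of an item\<close>

text \<open>The new order is written to a table of its own, because the current order is still being
  consulted.\<close>

definition read_off :: prog where
  "read_off = Seq (Instr (Const 13 0)) (For 17 11 (seqs
     [Instr (Add 19 8 13), Instr (Load 18 19), Instr (Add 19 5 18), Instr (Load 20 19),
      Instr (Add 19 6 17), Instr (Store 19 20), Instr (Add 19 3 18), Instr (Load 20 19),
      Instr (Add 13 13 20)]))"

lemma wp_read_off:
  assumes e: "env n W q s" and B: "B = n + W + 2" and K: "nreg s 11 = K" "K \<le> n"
    and ord: "\<And>r. r < K \<Longrightarrow> nmem s (3 * B + r) = ord r"
    and ch: "ch = (\<lambda>c. nmem s (6 * B + c))" "\<And>p. p < K \<Longrightarrow> ch (path_code ch p) < K"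
  shows "wp read_off (\<lambda>t s'. t \<le> K * 11 + 3 \<and> same ({13} \<union> {17..20}) s s' \<and>
     rreg s' = rreg s \<and> rmem s' = rmem s \<and>
     (\<forall>a. a < 4 * B \<or> 5 * B \<le> a \<longrightarrow> nmem s' a = nmem s a) \<and>
     (\<forall>p<K. nmem s' (4 * B + p) = ord (ch (path_code ch p)))) s"
proof -
  note E = envD[OF e, folded B]
  define I where "I = (\<lambda>j s'. same ({13} \<union> {17..20}) s s' \<and> rreg s' = rreg s \<and> rmem s' = rmem s \<and>
     (\<forall>a. a < 4 * B \<or> 5 * B \<le> a \<longrightarrow> nmem s' a = nmem s a) \<and> nreg s' 13 = path_code ch j \<and>
     (\<forall>p<j. nmem s' (4 * B + p) = ord (ch (path_code ch p))))"
  show ?thesis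
    unfolding read_off_def wp_Seq wp_Instr
  proof (rule wp_For[where m = K and I = I and B = 9], goal_cases)
    case 5
    then show ?case by (auto simp: I_def same_def)
  next
    case (6 j s1)
    have i1: "nreg s1 13 = path_code ch j" "\<And>a. a < 4 * B \<or> 5 * B \<le> a \<Longrightarrow> nmem s1 a = nmem s a"
      using 6(5) unfolding I_def by auto
    have r1: "nreg s1 x = nreg s x" if "x \<notin> {13} \<union> {17..20}" for x
      using 6(5) that unfolding I_def by (auto dest: sameD)
    define u where "u = ch (path_code ch j)"
    have u: "u < K" "u < B" "j < B" using ch(2)[OF 6(1)] K(2) B 6(1) by (auto simp: u_def)
    have m1: "nmem s1 (6 * B + path_code ch j) = u"
      using i1(2)[of "6 * B + path_code ch j"] fun_cong[OF ch(1), of "path_code ch j"]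
      unfolding u_def by simp
    have m2: "nmem s1 (3 * B + u) = ord u" "nmem s1 (B + u) = 2 ^ u"
      using i1(2)[of "3 * B + u"] i1(2)[of "B + u"] ord[OF u(1)] E(16)[OF u(2)] u(2) by simp_all
    have pc: "path_code ch (Suc j) = path_code ch j + 2 ^ u"
      by (simp add: u_def)
    show ?case
      apply (simp add: r1 E i1(1) m1 m2 6(2) K(1) del: path_code.simps)
      using 6(5) u(2,3) unfolding I_def pc
      apply (clarsimp simp: same_def less_Suc_eq u_def[symmetric] simp del: path_code.simps)
      done
  next
    case (7 t s')
    then show ?case by (auto simp: I_def algebra_simps)
  qed (use E K in auto)
qed

text \<open>The shift by one cell keeps slot 0 free for the item inserted next.\<close>

definition copy :: prog where
  "copy = For 17 11 (seqs
     [Instr (Add 19 6 17), Instr (Load 20 19), Instr (Add 19 5 17), Instr (Add 19 19 1),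
      Instr (Store 19 20)])"

lemma wp_copy:
  assumes e: "env n W q s" and B: "B = n + W + 2" and K: "nreg s 11 = K" "K \<le> n"
    and y: "\<And>p. p < K \<Longrightarrow> nmem s (4 * B + p) = y p"
  shows "wp copy (\<lambda>t s'. t \<le> K * 7 + 2 \<and> same {17..20} s s' \<and>
     rreg s' = rreg s \<and> rmem s' = rmem s \<and>
     (\<forall>a. a < 3 * B \<or> 4 * B \<le> a \<longrightarrow> nmem s' a = nmem s a) \<and>
     (\<forall>p<K. nmem s' (3 * B + 1 + p) = y p)) s"
proof -
  note E = envD[OF e, folded B]
  define I where "I = (\<lambda>j s'. same {17..20} s s' \<and> rreg s' = rreg s \<and> rmem s' = rmem s \<and>
     (\<forall>a. a < 3 * B \<or> 4 * B \<le> a \<longrightarrow> nmem s' a = nmem s a) \<and>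
     (\<forall>p<j. nmem s' (3 * B + 1 + p) = y p))"
  show ?thesis
    unfolding copy_def
  proof (rule wp_For[where m = K and I = I and B = 5], goal_cases)
    case 5
    then show ?case by (auto simp: I_def same_def)
  next
    case (6 j s1)
    have r1: "nreg s1 x = nreg s x" if "x \<notin> {17..20}" for x
      using 6(5) that unfolding I_def by (auto dest: sameD)
    have m: "nmem s1 (4 * B + j) = y j"
      using y[OF 6(1)] 6(5) unfolding I_def by auto
    have "Suc (3 * B + j) < 4 * B" using 6(1) K(2) B by simp
    then show ?case
      using 6 by (auto simp: r1 E m I_def same_def less_Suc_eq)
  next
    case (7 t s')
    then show ?case by (auto simp: I_def algebra_simps)
  qed (use E K in auto)
qed

definition insert_item :: prog where
  "insert_item = seqs [Instr (Add 11 10 1), Instr (Store 5 10), dp, read_off, copy]"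

definition process_time :: "nat \<Rightarrow> nat \<Rightarrow> nat" where
  "process_time n W = (n + W + 2) * 11 + n * (n * 11 + 32) + 30"

definition insert_time :: "nat \<Rightarrow> nat \<Rightarrow> nat" where
  "insert_time n W = n * (2 ^ W * (2 * process_time n W + 5) + 14) + n * 18 + 9"

lemma bellman_table_from_families:
  assumes "\<forall>f c. 1 \<le> f \<longrightarrow> f \<le> K \<longrightarrow> c \<in> code_family f W \<longrightarrow> bellman q ord K (f + W + 1) V ch c" "1 \<le> K"
  shows "bellman_table q ord K W V ch"
  unfolding bellman_table_def
proof (intro allI impI)
  fix S assume S: "S \<subseteq> {..<K}" "S \<subseteq> {..first_gap S + W}"
  then show "bellman q ord K (first_gap S + W + 1) V ch (set_encode S)"
    using assms first_gap[OF S(1) assms(2)] set_encode_code_family[OF S(1) assms(2) S(2)] by simp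
qed

lemma wp_insert_item:
  assumes e: "env n W q s" and B: "B = n + W + 2" and k: "nreg s 10 = k" "k < n"
    and x: "bij_betw x {..<k} {..<k}" "\<And>p. p < k \<Longrightarrow> nmem s (3 * B + 1 + p) = x p"
  shows "wp insert_item (\<lambda>t s'. t \<le> insert_time n W \<and> same ({11..14} \<union> {17..28}) s s' \<and>
     env n W q s' \<and> (\<exists>y. dp_step q W k x y \<and> (\<forall>p<Suc k. nmem s' (3 * B + 1 + p) = y p))) s"
proof -
  note E = envD[OF e, folded B]
  define ord where "ord = (\<lambda>u. if u = 0 then k else x (u - 1))"
  define K where "K = Suc k"
  have K: "1 \<le> K" "K \<le> n" using k(2) by (auto simp: K_def)
  have ordn: "ord r < n" if "r < K" for r
  proof (cases r)
    case (Suc i)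
    then have "x i < k" using that x(1) by (auto simp: K_def bij_betw_def)
    then show ?thesis using Suc k(2) by (simp add: ord_def)
  qed (use k in \<open>simp add: ord_def\<close>)
  define T where "T = (n + W + 2) * 11 + K * (K * 11 + 32) + 30"
  define s1 where "s1 = s\<lparr>nreg := (nreg s)(11 := K), nmem := (nmem s)(3 * B := k)\<rparr>"
  have env1: "env n W q s1"
    by (rule env_change[OF e, where X = "{11}"]) (auto simp: s1_def same_def B)
  have o1: "nmem s1 (3 * B + r) = ord r" if "r < K" for r
    using that x(2)[of "r - 1"] by (cases r) (auto simp: s1_def ord_def K_def)
  have T: "T \<le> process_time n W"
    unfolding T_def process_time_def using K by (intro add_mono mult_mono) auto
  have time: "K * (2 ^ W * (2 * T + 5) + 14) + 2 + (K * 11 + 3) + (K * 7 + 2) + 2 \<le> insert_time n W"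
  proof -
    have "K * (2 ^ W * (2 * T + 5) + 14) \<le> n * (2 ^ W * (2 * process_time n W + 5) + 14)"
      using K(2) T by (intro mult_mono add_mono) auto
    then show ?thesis using K(2) unfolding insert_time_def by linarith
  qed
  have dp: "wp dp (\<lambda>t s2. t \<le> K * (2 ^ W * (2 * T + 5) + 14) + 2 \<and> same ({11..14} \<union> {17..28}) s s2 \<and>
     env n W q s2 \<and> nreg s2 11 = K \<and> (\<forall>r<K. nmem s2 (3 * B + r) = ord r) \<and>
     dp_step q W k x (\<lambda>p. ord (nmem s2 (6 * B + path_code (\<lambda>c. nmem s2 (6 * B + c)) p))) \<and>
     (\<forall>p<K. nmem s2 (6 * B + path_code (\<lambda>c. nmem s2 (6 * B + c)) p) < K)) s1"
  proof (rule wp_mono[OF wp_dp[OF env1 _ K(2) o1[unfolded B] ordn T_def]], goal_cases)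
    case 1
    then show ?case by (simp add: s1_def)
  next
    case (4 t s2)
    then have s2: "same ({12, 13, 14} \<union> {17..28}) s1 s2" "kept n W s1 s2"
      "\<forall>f c. 1 \<le> f \<longrightarrow> f \<le> K \<longrightarrow> c \<in> code_family f W \<longrightarrow> bell_state n W q ord K f c s2" by auto
    have env2: "env n W q s2" by (rule env_kept[OF env1 s2(1) _ s2(2)]) auto
    have tab: "bellman_table q ord K W (\<lambda>x. rmem s2 (n * n + x)) (\<lambda>c. nmem s2 (6 * B + c))"
      using s2(3) unfolding bell_state_def B by (intro bellman_table_from_families K(1)) auto
    have m: "nmem s2 (3 * B + r) = ord r" if "r < K" for r
      using o1[OF that] s2(2) that K(2) by (simp add: kept_def B)
    have bij: "bij_betw (\<lambda>p. nmem s2 (6 * B + path_code (\<lambda>c. nmem s2 (6 * B + c)) p)) {..<K} {..<K}"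
      using path_properties(1)[OF tab K(1)] .
    have sm: "same ({11..14} \<union> {17..28}) s s2"
      using s2(1) by (auto simp: same_def s1_def)
    have "nreg s2 11 = K" using s2(1) by (auto simp: same_def s1_def)
    then show ?case
      using 4 env2 m bij sm dp_step_path[OF x(1) ord_def tab[unfolded K_def]]
      by (auto simp: bij_betw_def)
  qed auto
  show ?thesis
    unfolding insert_item_def
    apply (simp add: E k(1) K_def[symmetric] s1_def[symmetric])
    apply (rule wp_mono[OF dp])
    apply (elim conjE)
    subgoal premises p for t2 s2
    proof -
      let ?ch = "\<lambda>c. nmem s2 (6 * B + c)"
      let ?y = "\<lambda>p. ord (?ch (path_code ?ch p))"
      have r2: "nreg s2 x = nreg s x" if "x \<notin> {11..14} \<union> {17..28}" for x
        using p(2) that by (rule sameD)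
      have ex: "wp read_off (\<lambda>t s3. t \<le> K * 11 + 3 \<and> same ({13} \<union> {17..20}) s2 s3 \<and> env n W q s3 \<and>
         (\<forall>p<K. nmem s3 (4 * B + p) = ?y p)) s2"
      proof (rule wp_mono[OF wp_read_off[OF p(3) B p(4) K(2), where ord = ord and ch = ?ch]], goal_cases)
        case (4 t s3)
        have "env n W q s3"
          by (rule env_change[OF p(3), where X = "{13} \<union> {17..20}"]) (use 4 in \<open>auto simp: B\<close>)
        then show ?case using 4 by auto
      qed (use p in auto)
      show ?thesis
        apply (rule wp_mono[OF ex])
        apply (elim conjE)
        subgoal premises p3 for t3 s3
        proof (rule wp_mono[OF wp_copy[OF p3(3) B _ K(2), where y = ?y]], goal_cases)
          case (3 t4 s4)
          have "env n W q s4"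
            by (rule env_change[OF p3(3), where X = "{17..20}"]) (use 3 in \<open>auto simp: B\<close>)
          moreover have "same ({11..14} \<union> {17..28}) s s4"
            using 3 p3(2) p(2) by (auto simp: same_def)
          ultimately show ?case
            using 3 time p(1) p3(1) p(6) by (auto simp: K_def intro!: exI[of _ ?y])
        qed (use p3 p(4) in \<open>auto simp: same_def\<close>)
        done
    qed
    done
qed


section \<open>The complete program\<close>

text \<open>For positive \<open>n\<close> this is the binary logarithm rounded up, which takes the
  place of log n because the machine can compute it exactly.\<close>

definition bits :: "nat \<Rightarrow> nat" where
  "bits n = (LEAST l. n \<le> 2 ^ l)"

lemma bits_le: "n \<le> 2 ^ l \<Longrightarrow> bits n \<le> l"
  unfolding bits_def by (rule Least_le)

lemma le_power_bits: "n \<le> 2 ^ bits n"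
  unfolding bits_def by (rule LeastI[of _ n]) (simp add: less_imp_le)

lemma bits_eqI: "n \<le> 2 ^ l \<Longrightarrow> l = 0 \<or> 2 ^ (l - 1) < n \<Longrightarrow> bits n = l"
proof (rule ccontr)
  assume *: "n \<le> 2 ^ l" "l = 0 \<or> 2 ^ (l - 1) < n" "bits n \<noteq> l"
  then have "bits n < l" using bits_le[of n l] by simp
  then have "(2::nat) ^ bits n \<le> 2 ^ (l - 1)" by (intro power_increasing) auto
  with le_power_bits[of n] have "n \<le> 2 ^ (l - 1)" by (rule order_trans)
  then show False using *(2) \<open>bits n < l\<close> by simp
qed

text \<open>Without multiplication, \<open>c * bits n\<close> is accumulated by adding
  \<open>c\<close> once for each doubling needed to reach \<open>n\<close>.\<close>

definition setup_window :: "nat \<Rightarrow> prog" where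
  "setup_window c = seqs [Instr (Const 1 1), Instr (Const 17 1), Instr (Const 18 c),
     While (NLess 17 0) (seqs [Instr (Add 17 17 17), Instr (Add 2 2 18)])]"

lemma wp_setup_window:
  assumes "nreg s 0 = n" "nreg s 2 = 0"
  shows "wp (setup_window c) (\<lambda>t s'. t \<le> n * 3 + 4 \<and> same {1, 2, 17, 18} s s' \<and> nreg s' 1 = 1 \<and>
     nreg s' 2 = c * bits n \<and> nmem s' = nmem s \<and> rmem s' = rmem s \<and> rreg s' = rreg s) s"
proof -
  define I where "I = (\<lambda>s'. same {1, 2, 17, 18} s s' \<and> nreg s' 1 = 1 \<and> nreg s' 18 = c \<and>
    (\<exists>l. nreg s' 17 = 2 ^ l \<and> nreg s' 2 = c * l \<and> (l = 0 \<or> 2 ^ (l - 1) < n)) \<and>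
    nmem s' = nmem s \<and> rmem s' = rmem s \<and> rreg s' = rreg s)"
  define s0 where "s0 = s\<lparr>nreg := (nreg s)(1 := 1, 17 := 1, 18 := c)\<rparr>"
  have "wp (While (NLess 17 0) (seqs [Instr (Add 17 17 17), Instr (Add 2 2 18)]))
     (\<lambda>t s'. t \<le> n * 3 + 1 \<and> same {1, 2, 17, 18} s s' \<and> nreg s' 1 = 1 \<and>
       nreg s' 2 = c * bits n \<and> nmem s' = nmem s \<and> rmem s' = rmem s \<and> rreg s' = rreg s) s0"
  proof (rule wp_While[where I = I and B = 2 and V = "\<lambda>s. n - nreg s 17"], goal_cases)
    case 1
    show ?case using assms by (auto simp: I_def same_def s0_def intro!: exI[of _ 0])
  next
    case (2 s1)
    then obtain l where l: "nreg s1 17 = 2 ^ l" "nreg s1 2 = c * l" and r: "nreg s1 0 = n" "nreg s1 18 = c"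
      using assms unfolding I_def same_def by auto
    have "2 ^ l < n" using 2(2) l r by simp
    then show ?case
      using 2(1) l r by (auto simp: I_def same_def intro!: exI[of _ "Suc l"] diff_less_mono2)
  next
    case (3 t s1)
    then obtain l where l: "nreg s1 17 = 2 ^ l" "nreg s1 2 = c * l" "l = 0 \<or> 2 ^ (l - 1) < n"
      and r: "nreg s1 0 = n"
      using assms unfolding I_def same_def by auto
    have "bits n = l" using 3(2) l r by (intro bits_eqI) auto
    then show ?case using 3 l by (auto simp: I_def s0_def)
  qed
  then show ?thesis
    unfolding setup_window_def by (auto simp: s0_def elim!: wp_mono)
qed

definition setup_tables :: prog where
  "setup_tables = seqs
     [Instr (Const 15 1), For 17 2 (Instr (Add 15 15 15)),
      Instr (Add 16 0 2), Instr (Add 16 16 1), Instr (Add 16 16 1), Instr (Add 3 16 31),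
      Instr (Add 4 3 16), Instr (Add 5 4 16), Instr (Add 6 5 16), Instr (Add 7 6 16),
      Instr (Add 8 7 16), Instr (Const 17 1), Instr (Add 18 3 31),
      For 19 16 (seqs [Instr (Store 18 17), Instr (Add 17 17 17), Instr (Add 18 18 1)]),
      Instr (Const 9 0), Instr (Add 18 4 31),
      For 19 0 (seqs [Instr (Store 18 9), Instr (Add 9 9 0), Instr (Add 18 18 1)])]"

lemma wp_setup_tables:
  assumes r: "nreg s 0 = n" "nreg s 1 = 1" "nreg s 2 = W" "nreg s 31 = 0" "rreg s 0 = 0"
    and q: "\<And>i. i < n * n \<Longrightarrow> rmem s i = q (i div n) (i mod n)"
  shows "wp setup_tables (\<lambda>t s'. t \<le> 3 * W + (n + W + 2) * 5 + n * 5 + 20 \<and> env n W q s') s"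
proof -
  define B where "B = n + W + 2"
  have r1: "nreg s (Suc 0) = 1" using r(2) by simp
  have power_loop: "wp (For 17 2 (Instr (Add 15 15 15))) (\<lambda>t s'. t \<le> 3 * W + 2 \<and>
      same {15, 17} s1 s' \<and> nreg s' 15 = 2 ^ W \<and> rreg s' = rreg s1 \<and> rmem s' = rmem s1) s1"
    if "nreg s1 15 = 1" "nreg s1 2 = W" "nreg s1 1 = 1" for s1
    by (rule wp_For[where m = W and B = 1 and
          I = "\<lambda>j s'. same {15, 17} s1 s' \<and> nreg s' 15 = 2 ^ j \<and> rreg s' = rreg s1 \<and> rmem s' = rmem s1"])
      (use that in \<open>auto simp: same_def\<close>)
  have pw_loop: "wp (For 19 16 (seqs [Instr (Store 18 17), Instr (Add 17 17 17), Instr (Add 18 18 1)]))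
      (\<lambda>t s'. t \<le> B * 5 + 2 \<and> same {17, 18, 19} s1 s' \<and> rreg s' = rreg s1 \<and> rmem s' = rmem s1 \<and>
         (\<forall>i<B. nmem s' (B + i) = 2 ^ i)) s1"
    if "nreg s1 16 = B" "nreg s1 17 = 1" "nreg s1 18 = B" "nreg s1 1 = 1" for s1
    by (rule wp_For[where m = B and B = 3 and
          I = "\<lambda>j s'. same {17, 18, 19} s1 s' \<and> nreg s' 17 = 2 ^ j \<and> nreg s' 18 = B + j \<and>
            rreg s' = rreg s1 \<and> rmem s' = rmem s1 \<and> (\<forall>i<j. nmem s' (B + i) = 2 ^ i)"])
      (use that in \<open>auto simp: same_def less_Suc_eq\<close>)
  have mul_loop: "wp (For 19 0 (seqs [Instr (Store 18 9), Instr (Add 9 9 0), Instr (Add 18 18 1)]))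
      (\<lambda>t s'. t \<le> n * 5 + 2 \<and> same {9, 18, 19} s1 s' \<and> rreg s' = rreg s1 \<and> rmem s' = rmem s1 \<and>
         nreg s' 9 = n * n \<and> (\<forall>i<B. nmem s' (B + i) = nmem s1 (B + i)) \<and>
         (\<forall>i<n. nmem s' (2 * B + i) = i * n)) s1"
    if "nreg s1 0 = n" "nreg s1 9 = 0" "nreg s1 18 = 2 * B" "nreg s1 1 = 1" for s1
    by (rule wp_For[where m = n and B = 3 and
          I = "\<lambda>j s'. same {9, 18, 19} s1 s' \<and> nreg s' 9 = j * n \<and> nreg s' 18 = 2 * B + j \<and>
            rreg s' = rreg s1 \<and> rmem s' = rmem s1 \<and> (\<forall>i<B. nmem s' (B + i) = nmem s1 (B + i)) \<and>
            (\<forall>i<j. nmem s' (2 * B + i) = i * n)"])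
      (use that in \<open>auto simp: same_def less_Suc_eq\<close>)
  show ?thesis
    unfolding setup_tables_def
    apply simp
    apply (rule wp_mono[OF power_loop[simplified]])
       apply (simp_all add: r r1 same_def B_def)
    apply (elim conjE)
    apply (rule wp_mono[OF pw_loop[simplified]])
       apply (simp_all add: r r1 same_def B_def)
    apply (elim conjE)
    apply (rule wp_mono[OF mul_loop[simplified]])
       apply (simp_all add: r r1 same_def B_def)
    apply (auto simp: env_def Let_def r r1 q)
    done
qed

text \<open>The order maps positions to items, whereas \<open>outcome\<close> expects the inverse.
  The cells written lie below \<open>n\<close>, outside the table that is being read.\<close>

definition write_result :: prog where
  "write_result = For 17 0 (seqs
     [Instr (Add 19 5 17), Instr (Add 19 19 1), Instr (Load 20 19), Instr (Store 20 17)])"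

lemma wp_write_result:
  assumes e: "env n W q s" and y: "bij_betw y {..<n} {..<n}"
    "\<And>p. p < n \<Longrightarrow> nmem s (3 * (n + W + 2) + 1 + p) = y p"
  shows "wp write_result (\<lambda>t s'. t \<le> n * 6 + 2 \<and> (\<forall>p<n. nmem s' (y p) = p)) s"
proof -
  note E = envD[OF e]
  have inj: "inj_on y {..<n}" and ylt: "\<And>p. p < n \<Longrightarrow> y p < n"
    using y(1) by (auto simp: bij_betw_def)
  define I where "I = (\<lambda>j s'. same {17, 19, 20} s s' \<and> (\<forall>a\<ge>n. nmem s' a = nmem s a) \<and>
    (\<forall>p<j. nmem s' (y p) = p))"
  show ?thesis
    unfolding write_result_def
  proof (rule wp_For[where m = n and I = I and B = 4], goal_cases)
    case 5
    then show ?case by (auto simp: I_def same_def)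
  next
    case (6 j s1)
    have r1: "nreg s1 x = nreg s x" if "x \<notin> {17, 19, 20}" for x
      using 6(5) that unfolding I_def by (auto dest: sameD)
    have m: "nmem s1 (Suc (3 * (n + W + 2) + j)) = y j"
    proof -
      have eq: "3 * (n + W + 2) + 1 + j = Suc (3 * (n + W + 2) + j)" by simp
      have "n \<le> Suc (3 * (n + W + 2) + j)" by simp
      then have "nmem s1 (Suc (3 * (n + W + 2) + j)) = nmem s (Suc (3 * (n + W + 2) + j))"
        using 6(5) unfolding I_def by blast
      then show ?thesis using y(2)[OF 6(1)] unfolding eq by simp
    qed
    have neq: "y p \<noteq> y j" if "p < j" for p
      using inj_onD[OF inj, of p j] that 6(1) by auto
    show ?case
      using 6(5) ylt[OF 6(1)] neq
      by (auto simp: r1 E 6(2) m[simplified] I_def same_def less_Suc_eq)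
  next
    case (7 t s')
    then show ?case by (auto simp: I_def)
  qed (use E in auto)
qed

definition main :: "nat \<Rightarrow> prog" where
  "main c = seqs [setup_window c, setup_tables, For 10 0 insert_item, write_result]"

definition main_time :: "nat \<Rightarrow> nat \<Rightarrow> nat" where
  "main_time n W = n * (insert_time n W + 2) + 8 * W + 20 * n + 50"

text \<open>Each order overwrites its predecessor in memory, yet optimality of the last one is
  derived along the whole sequence; the postcondition therefore keeps all of them as an existential
  witness.\<close>

lemma wp_main:
  "wp (main c) (\<lambda>t s. t \<le> main_time n (c * bits n) \<and>
     (\<exists>x. (\<forall>k<n. dp_step q (c * bits n) k (x k) (x (Suc k))) \<and> (\<forall>p<n. nmem s (x n p) = p)))
   (init n q \<omega>)"
proof -
  define W where "W = c * bits n"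
  define I where "I = (\<lambda>j s. env n W q s \<and> (\<exists>x. (\<forall>k<j. dp_step q W k (x k) (x (Suc k))) \<and>
     (\<forall>p<j. nmem s (3 * (n + W + 2) + 1 + p) = x j p)))"
  have bij: "bij_betw (x j) {..<j} {..<j}" if "\<forall>k<j. dp_step q W k (x k) (x (Suc k))" for x :: "nat \<Rightarrow> nat \<Rightarrow> nat" and j
    using that by (cases j) (auto simp: dp_step_def bij_betw_def)
  have loop: "wp (For 10 0 insert_item) (\<lambda>t s'. t \<le> n * (insert_time n W + 2) + 2 \<and> I n s') s"
    if e: "env n W q s" for s
  proof (rule wp_For[where m = n and I = I and B = "insert_time n W"], goal_cases)
    case 5
    have "env n W q (s\<lparr>nreg := (nreg s)(10 := 0)\<rparr>)"
      by (rule env_change[OF e, where X = "{10}"]) (auto simp: same_def)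
    then show ?case by (simp add: I_def)
  next
    case (6 j s1)
    then obtain x where x: "\<forall>k<j. dp_step q W k (x k) (x (Suc k))"
      "\<forall>p<j. nmem s1 (3 * (n + W + 2) + 1 + p) = x j p" and e1: "env n W q s1"
      unfolding I_def by auto
    show ?case
    proof (rule wp_mono[OF wp_insert_item[OF e1 refl 6(2,1) bij[OF x(1)]]], goal_cases)
      case (2 t s2)
      then obtain y where y: "dp_step q W j (x j) y"
        "\<forall>p<Suc j. nmem s2 (3 * (n + W + 2) + 1 + p) = y p" by blast
      have "env n W q (s2\<lparr>nreg := (nreg s2)(10 := Suc j)\<rparr>)"
        by (rule env_change[where s = s2 and X = "{10}"]) (use 2 in \<open>auto simp: same_def\<close>)
      moreover have "\<exists>x. (\<forall>k<Suc j. dp_step q W k (x k) (x (Suc k))) \<and>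
          (\<forall>p<Suc j. nmem s2 (3 * (n + W + 2) + 1 + p) = x (Suc j) p)"
        using x(1) y by (intro exI[of _ "x(Suc j := y)"]) (auto simp: less_Suc_eq)
      ultimately show ?case
        using 2 6(2-4) by (auto simp: I_def same_def)
    qed (use x in auto)
  next
    case (7 t s')
    then show ?case by simp
  qed (use envD[OF e] in auto)
  show ?thesis
    unfolding main_def W_def[symmetric]
    apply simp
    apply (rule wp_mono[OF wp_setup_window[where n = n]])
      apply (simp_all add: init_def W_def[symmetric])
    apply (elim conjE)
    apply (rule wp_mono[OF wp_setup_tables[where n = n and W = W and q = q]])
          apply (simp_all add: same_def)
    apply (elim conjE)
    apply (rule wp_mono[OF loop])
     apply assumption
    apply (elim conjE)
    subgoal for t s1 t1 s2 t2 s3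
      unfolding I_def
      apply (elim conjE exE)
      subgoal for x
        apply (rule wp_mono[OF wp_write_result[where y = "x n"]])
           apply assumption
          apply (rule bij)
          apply assumption
         apply simp
        apply (auto simp: main_time_def)
        done
      done
    done
qed


section \<open>Measurability of the outcome\<close>

text \<open>Coordinatewise measurability, which avoids putting a \<sigma>-algebra on states.\<close>

definition measurable_states :: "'a measure \<Rightarrow> ('a \<Rightarrow> state) \<Rightarrow> bool" where
  "measurable_states M f \<longleftrightarrow>
     (\<forall>i. (\<lambda>x. nreg (f x) i) \<in> measurable M (count_space UNIV) \<and>
          (\<lambda>x. nmem (f x) i) \<in> measurable M (count_space UNIV) \<and>
          (\<lambda>x. rreg (f x) i) \<in> borel_measurable M \<and>
          (\<lambda>x. rmem (f x) i) \<in> borel_measurable M \<and>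
          (\<lambda>x. coins (f x) i) \<in> measurable M (count_space UNIV))"

lemma measurable_statesD:
  assumes "measurable_states M f"
  shows "(\<lambda>x. nreg (f x) i) \<in> measurable M (count_space UNIV)"
    "(\<lambda>x. nmem (f x) i) \<in> measurable M (count_space UNIV)"
    "(\<lambda>x. rreg (f x) i) \<in> borel_measurable M"
    "(\<lambda>x. rmem (f x) i) \<in> borel_measurable M"
    "(\<lambda>x. coins (f x) i) \<in> measurable M (count_space UNIV)"
  using assms unfolding measurable_states_def by blast+

text \<open>Serves indirect addressing and loops: an address or a number of rounds is itself random,
  but takes only countably many values.\<close>

lemma measurable_nat_index:
  fixes g :: "nat \<Rightarrow> 'a \<Rightarrow> 'b"
  assumes "\<And>i. g i \<in> measurable M N" "h \<in> measurable M (count_space UNIV)"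
  shows "(\<lambda>x. g (h x) x) \<in> measurable M N"
  by (rule measurable_compose_countable[where f = g and g = h]) (use assms in auto)

lemma measurable_nat_binop:
  fixes f :: "nat \<Rightarrow> nat \<Rightarrow> 'b"
  assumes g: "g \<in> measurable M (count_space UNIV)" and h: "h \<in> measurable M (count_space UNIV)"
  shows "(\<lambda>x. f (g x) (h x)) \<in> measurable M (count_space UNIV)"
proof -
  have "(\<lambda>x. f i (h x)) \<in> measurable M (count_space UNIV)" for i
    using measurable_compose[OF h, of "f i" "count_space UNIV"] by simp
  then show ?thesis
    using g by (rule measurable_nat_index)
qed

lemma measurable_states_step:
  assumes f: "measurable_states M f"
  shows "measurable_states M (\<lambda>x. step i (f x))"
proof -
  note m = measurable_statesD[OF f]
  note op = measurable_nat_binop[OF m(1) m(1)]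
  have eq: "Measurable.pred M (\<lambda>x. j = nreg (f x) y)" for j y
    using measurable_nat_binop[where f = "\<lambda>a b. j = a", OF m(1) m(1)] .
  have nif: "(\<lambda>x. if j = nreg (f x) y then nreg (f x) z else nmem (f x) j)
      \<in> measurable M (count_space UNIV)" for j y z
    by (rule measurable_If) (use m eq in \<open>auto simp: pred_def\<close>)
  have rif: "(\<lambda>x. if j = nreg (f x) y then rreg (f x) z else rmem (f x) j)
      \<in> borel_measurable M" for j y z
    by (rule measurable_If) (use m eq in \<open>auto simp: pred_def\<close>)
  have flip: "(\<lambda>x. if coins (f x) 0 then 1 else 0::nat) \<in> measurable M (count_space UNIV)"
    by (rule measurable_If) (use m in \<open>auto simp: pred_def\<close>)
  note rules = m nif rif flip op[where f = "\<lambda>a b. a + b"] op[where f = "\<lambda>a b. a - b"]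
    measurable_nat_index[OF m(2) m(1)] measurable_nat_index[OF m(4) m(1)]
    borel_measurable_add[OF m(3) m(3)] borel_measurable_diff[OF m(3) m(3)]
  show ?thesis
    unfolding measurable_states_def
  proof (rule allI)
    fix j
    show "(\<lambda>x. nreg (step i (f x)) j) \<in> measurable M (count_space UNIV) \<and>
      (\<lambda>x. nmem (step i (f x)) j) \<in> measurable M (count_space UNIV) \<and>
      (\<lambda>x. rreg (step i (f x)) j) \<in> borel_measurable M \<and>
      (\<lambda>x. rmem (step i (f x)) j) \<in> borel_measurable M \<and>
      (\<lambda>x. coins (step i (f x)) j) \<in> measurable M (count_space UNIV)"
    proof (cases i)
      case (Const r c)
      then show ?thesis by (cases "j = r"; simp; intro conjI rules)
    next
      case (Add r y z)
      then show ?thesis by (cases "j = r"; simp; intro conjI rules)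
    next
      case (Sub r y z)
      then show ?thesis by (cases "j = r"; simp; intro conjI rules)
    next
      case (Load r y)
      then show ?thesis by (cases "j = r"; simp; intro conjI rules)
    next
      case (RAdd r v w)
      then show ?thesis by (cases "j = r"; simp; intro conjI rules)
    next
      case (RSub r v w)
      then show ?thesis by (cases "j = r"; simp; intro conjI rules)
    next
      case (RLoad r y)
      then show ?thesis by (cases "j = r"; simp; intro conjI rules)
    next
      case (Flip r)
      then show ?thesis by (cases "j = r"; simp; intro conjI rules)
    next
      case (Store y z)
      then show ?thesis by (simp add: fun_upd_def) (intro conjI rules)
    next
      case (RStore y u)
      then show ?thesis by (simp add: fun_upd_def) (intro conjI rules)
    qed
  qed
qed

lemma measurable_holds:
  assumes f: "measurable_states M f"
  shows "Measurable.pred M (\<lambda>x. holds b (f x))"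
proof (cases b)
  case (NLess i j)
  then show ?thesis
    using measurable_nat_binop[OF measurable_statesD(1)[OF f] measurable_statesD(1)[OF f]]
    by simp
next
  case (RLess i j)
  note measurable_statesD(3)[OF f, measurable]
  show ?thesis unfolding RLess by simp
qed

lemma measurable_states_If:
  assumes f: "measurable_states M f" and g: "measurable_states M g" and P: "Measurable.pred M P"
  shows "measurable_states M (\<lambda>x. if P x then f x else g x)"
  unfolding measurable_states_def if_distrib[of nreg] if_distrib[of nmem] if_distrib[of rreg]
    if_distrib[of rmem] if_distrib[of coins] if_distribR
  by (intro allI conjI measurable_If measurable_statesD[OF f] measurable_statesD[OF g])
    (use P in \<open>simp_all add: pred_def\<close>)

lemma measurable_states_countable:
  fixes h :: "'a \<Rightarrow> nat"
  assumes f: "\<And>i. measurable_states M (f i)" and h: "h \<in> measurable M (count_space UNIV)"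
  shows "measurable_states M (\<lambda>x. f (h x) x)"
  unfolding measurable_states_def
proof (rule allI)
  fix j
  note m = measurable_statesD[OF f]
  show "(\<lambda>x. nreg (f (h x) x) j) \<in> measurable M (count_space UNIV) \<and>
      (\<lambda>x. nmem (f (h x) x) j) \<in> measurable M (count_space UNIV) \<and>
      (\<lambda>x. rreg (f (h x) x) j) \<in> borel_measurable M \<and>
      (\<lambda>x. rmem (f (h x) x) j) \<in> borel_measurable M \<and>
      (\<lambda>x. coins (f (h x) x) j) \<in> measurable M (count_space UNIV)"
    by (intro conjI measurable_nat_index[of "\<lambda>i x. nreg (f i x) j", OF m(1) h]
        measurable_nat_index[of "\<lambda>i x. nmem (f i x) j", OF m(2) h]
        measurable_nat_index[of "\<lambda>i x. rreg (f i x) j", OF m(3) h]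
        measurable_nat_index[of "\<lambda>i x. rmem (f i x) j", OF m(4) h]
        measurable_nat_index[of "\<lambda>i x. coins (f i x) j", OF m(5) h])
qed

section \<open>Final states as a total function of initial states\<close>

definition halts :: "prog \<Rightarrow> state \<Rightarrow> bool" where
  "halts c s \<longleftrightarrow> (\<exists>t s'. exec c s t s')"

text \<open>A diverging run leaves the state unchanged by convention; measurability of this total
  function can be proved by induction on the program.\<close>

definition final :: "prog \<Rightarrow> state \<Rightarrow> state" where
  "final c s = (if halts c s then (THE s'. \<exists>t. exec c s t s') else s)"

lemma final_eqI:
  assumes "exec c s t s'"
  shows "final c s = s'"
proof -
  have "(THE s'. \<exists>t. exec c s t s') = s'"
  proof (rule the_equality)
    show "\<exists>t. exec c s t s'" using assms by (rule exI)
    show "u = s'" if "\<exists>t. exec c s t u" for u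
      using that exec_deterministic[OF assms] by blast
  qed
  moreover have "halts c s"
    unfolding halts_def using assms by (intro exI)
  ultimately show ?thesis
    by (simp add: final_def)
qed

lemma halts_Instr: "halts (Instr i) s" "final (Instr i) s = step i s"
proof -
  note e = exec.Instr[of i s]
  show "halts (Instr i) s" unfolding halts_def using e by (intro exI)
  show "final (Instr i) s = step i s" using e by (rule final_eqI)
qed

lemma halts_Seq: "halts (Seq c d) s \<longleftrightarrow> halts c s \<and> halts d (final c s)"
proof
  assume "halts (Seq c d) s"
  then obtain t s' where "exec (Seq c d) s t s'" unfolding halts_def by blast
  then show "halts c s \<and> halts d (final c s)"
    by cases (use final_eqI in \<open>auto simp: halts_def\<close>)
next
  assume *: "halts c s \<and> halts d (final c s)"
  then obtain t s' where 1: "exec c s t s'" unfolding halts_def by blast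
  with * obtain t' s'' where "exec d s' t' s''" using final_eqI unfolding halts_def by blast
  with 1 show "halts (Seq c d) s" unfolding halts_def by (blast intro: exec.Seq)
qed

lemma final_Seq: "final (Seq c d) s = (if halts (Seq c d) s then final d (final c s) else s)"
proof (cases "halts (Seq c d) s")
  case True
  then obtain t s' where e: "exec (Seq c d) s t s'" unfolding halts_def by blast
  then have "final (Seq c d) s = s'" by (rule final_eqI)
  moreover from e have "final d (final c s) = s'"
    by cases (use final_eqI in blast)
  ultimately show ?thesis using True by simp
qed (simp add: final_def)

lemma halts_If: "halts (If b c d) s \<longleftrightarrow> (if holds b s then halts c s else halts d s)"
proof
  assume "halts (If b c d) s"
  then obtain t s' where "exec (If b c d) s t s'" unfolding halts_def by blast
  then show "if holds b s then halts c s else halts d s"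
    by cases (auto simp: halts_def)
qed (auto simp: halts_def split: if_splits intro: exec.IfTrue exec.IfFalse)

lemma final_If: "final (If b c d) s = (if holds b s then final c s else final d s)"
proof (cases "halts (If b c d) s")
  case True
  then obtain t s' where e: "exec (If b c d) s t s'" unfolding halts_def by blast
  then have "final (If b c d) s = s'" by (rule final_eqI)
  moreover from e have "(if holds b s then final c s else final d s) = s'"
    by cases (simp_all add: final_eqI)
  ultimately show ?thesis by simp
next
  case False
  then have "final (If b c d) s = s" by (simp add: final_def)
  moreover from False have "(if holds b s then final c s else final d s) = s"
    by (auto simp: halts_If final_def)
  ultimately show ?thesis by simp
qed

text \<open>Expresses a terminating loop by its number of rounds, a natural number that can be
  selected measurably.\<close>

lemma exec_While_iterate:
  assumes "exec w s t s'" "w = While b c"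
  shows "\<exists>i. (\<forall>j<i. holds b ((final c ^^ j) s) \<and> halts c ((final c ^^ j) s)) \<and>
     \<not> holds b ((final c ^^ i) s) \<and> s' = (final c ^^ i) s"
  using assms
proof (induction rule: exec.induct)
  case (WhileFalse b' s c')
  then show ?case by (intro exI[of _ 0]) auto
next
  case (WhileTrue b' s c' t s' t' s'')
  then obtain i where i: "\<forall>j<i. holds b ((final c ^^ j) s') \<and> halts c ((final c ^^ j) s')"
    "\<not> holds b ((final c ^^ i) s')" "s'' = (final c ^^ i) s'"
    by blast
  have fs: "final c s = s'" and h: "holds b s" "halts c s"
    using WhileTrue by (auto intro: final_eqI simp: halts_def)
  have it: "(final c ^^ Suc j) s = (final c ^^ j) s'" for j
    using fs by (simp add: funpow_swap1)
  have "holds b ((final c ^^ j) s) \<and> halts c ((final c ^^ j) s)" if "j < Suc i" for j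
    using that i(1) h it by (cases j) auto
  then show ?case
    using i(2,3) it by (intro exI[of _ "Suc i"]) auto
qed auto

lemma iterate_exec_While:
  assumes "\<forall>j<i. holds b ((final c ^^ j) s) \<and> halts c ((final c ^^ j) s)"
    "\<not> holds b ((final c ^^ i) s)"
  shows "\<exists>t. exec (While b c) s t ((final c ^^ i) s)"
  using assms
proof (induction i arbitrary: s)
  case 0
  then show ?case using exec.WhileFalse by auto
next
  case (Suc i)
  have it: "(final c ^^ Suc j) s = (final c ^^ j) (final c s)" for j
    by (simp add: funpow_swap1)
  have h: "holds b s" "halts c s"
    using spec[OF Suc.prems(1), of 0] by auto
  obtain t where t: "exec c s t (final c s)"
    using h(2) final_eqI unfolding halts_def by blast
  have "holds b ((final c ^^ j) (final c s)) \<and> halts c ((final c ^^ j) (final c s))" if "j < i" for j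
    using spec[OF Suc.prems(1), of "Suc j"] that unfolding it by blast
  then obtain t' where "exec (While b c) (final c s) t' ((final c ^^ i) (final c s))"
    using Suc.IH[of "final c s"] Suc.prems(2) unfolding it by blast
  then show ?case
    using exec.WhileTrue[OF h(1) t] unfolding it by blast
qed

text \<open>Halting and the final state are treated together, since each enters the other for
  sequences and loops. A loop becomes a countable case distinction over the least number of rounds
  after which its test fails.\<close>

lemma measurable_final:
  "measurable_states M f \<Longrightarrow>
     Measurable.pred M (\<lambda>x. halts c (f x)) \<and> measurable_states M (\<lambda>x. final c (f x))"
proof (induction c arbitrary: f)
  case (Instr i)
  then show ?case by (simp add: halts_Instr measurable_states_step)
next
  case (Seq c d)
  note c = Seq.IH(1)[OF Seq.prems]
  note d = Seq.IH(2)[OF conjunct2[OF c]]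
  have h: "Measurable.pred M (\<lambda>x. halts (Seq c d) (f x))"
    unfolding halts_Seq by (intro pred_intros_logic conjunct1[OF c] conjunct1[OF d])
  show ?case
    unfolding final_Seq by (intro conjI h measurable_states_If conjunct2[OF d] Seq.prems)
next
  case (If b c d)
  note c = If.IH(1)[OF If.prems] and d = If.IH(2)[OF If.prems]
  note b = measurable_holds[OF If.prems, of b]
  have "Measurable.pred M (\<lambda>x. halts (If b c d) (f x))"
    unfolding halts_If if_bool_eq_conj
    by (intro pred_intros_logic b conjunct1[OF c] conjunct1[OF d])
  then show ?case
    unfolding final_If by (intro conjI measurable_states_If b conjunct2[OF c] conjunct2[OF d])
next
  case (While b c)
  let ?g = "\<lambda>j x. (final c ^^ j) (f x)"
  have g: "measurable_states M (?g j)" for j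
  proof (induction j)
    case 0
    then show ?case using While.prems by simp
  next
    case (Suc j)
    then show ?case using While.IH[of "?g j"] by simp
  qed
  note mh = measurable_holds[OF g, of b] conjunct1[OF While.IH[OF g]]
  let ?P = "\<lambda>x i. (\<forall>j\<in>{..<i}. holds b (?g j x) \<and> halts c (?g j x)) \<and> \<not> holds b (?g i x)"
  have P: "Measurable.pred M (\<lambda>x. ?P x i)" for i
    by (intro pred_intros_logic pred_intros_finite mh finite_lessThan)
  have hal: "halts (While b c) (f x) \<longleftrightarrow> (\<exists>i. ?P x i)" for x
  proof
    assume "halts (While b c) (f x)"
    then obtain t s' where "exec (While b c) (f x) t s'" unfolding halts_def by blast
    from exec_While_iterate[OF this refl] show "\<exists>i. ?P x i" by blast
  next
    assume "\<exists>i. ?P x i"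
    then obtain i where "?P x i" by blast
    then show "halts (While b c) (f x)"
      using iterate_exec_While[of i b c "f x"] unfolding halts_def by blast
  qed
  have fin: "final (While b c) (f x) =
      (if halts (While b c) (f x) then ?g (LEAST i. ?P x i) x else f x)" for x
  proof (cases "halts (While b c) (f x)")
    case True
    then have *: "?P x (LEAST i. ?P x i)"
      unfolding hal by (rule LeastI_ex)
    then obtain t where "exec (While b c) (f x) t (?g (LEAST i. ?P x i) x)"
      using iterate_exec_While[of "LEAST i. ?P x i" b c "f x"] by blast
    then show ?thesis
      using True final_eqI by simp
  qed (simp add: final_def)
  have 1: "Measurable.pred M (\<lambda>x. halts (While b c) (f x))"
    unfolding hal by (intro pred_intros_countable P)
  have 2: "(\<lambda>x. LEAST i. ?P x i) \<in> measurable M (count_space UNIV)"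
    by (intro measurable_Least P)
  show ?case
    unfolding fin
    by (rule conjI[OF 1 measurable_states_If[OF measurable_states_countable[where f = ?g, OF g 2] While.prems 1]])
qed


section \<open>Inversions of an optimal order\<close>

text \<open>Turns an injective key into a permutation of the first \<open>k\<close> items.
  Rearrangements of an optimal order are described by keys, and with \<pi> as key this is the true
  rank among these items.\<close>

definition rank :: "nat \<Rightarrow> (nat \<Rightarrow> nat) \<Rightarrow> nat \<Rightarrow> nat" where
  "rank k \<kappa> i = (if i < k then card {j. j < k \<and> \<kappa> j < \<kappa> i} else i)"

lemma rank_less_iff:
  assumes "i < k" "j < k"
  shows "rank k \<kappa> i < rank k \<kappa> j \<longleftrightarrow> \<kappa> i < \<kappa> j"
proof -
  have mono: "rank k \<kappa> a < rank k \<kappa> b" if "\<kappa> a < \<kappa> b" "a < k" "b < k" for a b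
    unfolding rank_def using that by (auto intro!: psubset_card_mono)
  have "rank k \<kappa> a = rank k \<kappa> b" if "\<kappa> a = \<kappa> b" "a < k" "b < k" for a b
    using that by (simp add: rank_def)
  with mono assms show ?thesis by (metis less_asym less_irrefl linorder_less_linear)
qed

lemma rank_permutes:
  assumes "inj_on \<kappa> {..<k}"
  shows "rank k \<kappa> permutes {..<k}"
proof (rule bij_imp_permutes)
  have "inj_on (rank k \<kappa>) {..<k}"
  proof (rule inj_onI)
    fix i j assume *: "i \<in> {..<k}" "j \<in> {..<k}" "rank k \<kappa> i = rank k \<kappa> j"
    then have "\<not> \<kappa> i < \<kappa> j" "\<not> \<kappa> j < \<kappa> i"
      using rank_less_iff[of i k j \<kappa>] rank_less_iff[of j k i \<kappa>] by auto
    then show "i = j" using inj_onD[OF assms, of i j] * by auto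
  qed
  moreover have "rank k \<kappa> i < k" if "i < k" for i
  proof -
    have "{j. j < k \<and> \<kappa> j < \<kappa> i} \<subset> {..<k}" using that by auto
    from psubset_card_mono[OF _ this] show ?thesis using that by (simp add: rank_def)
  qed
  ultimately show "bij_betw (rank k \<kappa>) {..<k} {..<k}"
    unfolding bij_betw_def by (intro conjI endo_inj_surj) auto
qed (simp add: rank_def)

definition antisymmetric_on :: "nat \<Rightarrow> (nat \<Rightarrow> nat \<Rightarrow> real) \<Rightarrow> bool" where
  "antisymmetric_on k q \<longleftrightarrow> (\<forall>i<k. \<forall>j<k. q j i = - q i j)"

text \<open>The order sorted by \<kappa> cannot beat \<sigma>. The two scores share the pairs
  ordered alike, and on the remaining pairs antisymmetry makes them negatives of each other; the
  difference is twice the displayed sum.\<close>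

lemma optimal_order_key:
  fixes \<kappa> :: "nat \<Rightarrow> nat"
  assumes opt: "optimal_order k q \<sigma>" and \<kappa>: "inj_on \<kappa> {..<k}" and q: "antisymmetric_on k q"
  shows "(\<Sum>(i, j) | i < k \<and> j < k \<and> \<kappa> i < \<kappa> j \<and> \<sigma> j < \<sigma> i. q i j) \<le> 0"
proof -
  have perm: "\<sigma> permutes {..<k}"
    using opt by (simp add: optimal_order_def is_arg_max_def)
  define C where "C = {(i, j). i < k \<and> j < k \<and> \<kappa> i < \<kappa> j \<and> \<sigma> i < \<sigma> j}"
  define F where "F = {(i, j). i < k \<and> j < k \<and> \<kappa> i < \<kappa> j \<and> \<sigma> j < \<sigma> i}"
  have fin: "finite {(i, j). i < k \<and> j < k \<and> P i j}" for P
    by (rule finite_subset[of _ "{..<k} \<times> {..<k}"]) auto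
  have "score k q (rank k \<kappa>) \<le> score k q \<sigma>"
    using opt rank_permutes[OF \<kappa>] unfolding optimal_order_def is_arg_max_def by (metis not_less)
  moreover have "score k q (rank k \<kappa>) = score k q \<kappa>"
    unfolding score_def by (rule sum.cong) (auto simp: rank_less_iff)
  moreover have "score k q \<kappa> = sum (case_prod q) C + sum (case_prod q) F"
  proof -
    have eq: "{(i, j). i < k \<and> j < k \<and> \<kappa> i < \<kappa> j} = C \<union> F"
    proof -
      have "\<sigma> i < \<sigma> j \<or> \<sigma> j < \<sigma> i" if "\<kappa> i < \<kappa> j" for i j
      proof -
        have "i \<noteq> j" using that by auto
        then have "\<sigma> i \<noteq> \<sigma> j" using injD[OF permutes_inj[OF perm]] by blast
        then show ?thesis by linarith
      qed
      then show ?thesis unfolding C_def F_def by blast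
    qed
    show ?thesis
      unfolding score_def eq by (rule sum.union_disjoint) (auto simp: C_def F_def fin)
  qed
  moreover have "score k q \<sigma> = sum (case_prod q) C + sum (case_prod q) (prod.swap ` F)"
  proof -
    have neq: "\<kappa> i \<noteq> \<kappa> j" if "i < k" "j < k" "\<sigma> i < \<sigma> j" for i j
      using inj_onD[OF \<kappa>, of i j] that by auto
    have eq: "{(i, j). i < k \<and> j < k \<and> \<sigma> i < \<sigma> j} = C \<union> prod.swap ` F"
    proof (intro set_eqI iffI)
      fix x assume "x \<in> {(i, j). i < k \<and> j < k \<and> \<sigma> i < \<sigma> j}"
      then obtain i j where x: "x = (i, j)" "i < k" "j < k" "\<sigma> i < \<sigma> j" by auto
      show "x \<in> C \<union> prod.swap ` F"
      proof (cases "\<kappa> i < \<kappa> j")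
        case False
        then have "(j, i) \<in> F" using neq[of i j] x by (auto simp: F_def)
        then have "prod.swap (j, i) \<in> prod.swap ` F" by (rule imageI)
        then show ?thesis using x by simp
      qed (use x in \<open>auto simp: C_def\<close>)
    qed (auto simp: C_def F_def)
    show ?thesis
      unfolding score_def eq by (rule sum.union_disjoint) (auto simp: C_def F_def fin)
  qed
  moreover have "sum (case_prod q) (prod.swap ` F) = - sum (case_prod q) F"
  proof -
    have "sum (case_prod q) (prod.swap ` F) = (\<Sum>p\<in>F. case_prod q (prod.swap p))"
      by (subst sum.reindex) (auto simp: inj_on_def)
    also have "\<dots> = (\<Sum>p\<in>F. - case_prod q p)"
      using q by (intro sum.cong) (auto simp: F_def antisymmetric_on_def)
    finally show ?thesis by (simp add: sum_negf)
  qed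
  ultimately show ?thesis by (simp add: F_def)
qed

definition inverted :: "(nat \<Rightarrow> nat) \<Rightarrow> nat list \<Rightarrow> (nat \<times> nat) set" where
  "inverted \<pi> xs = {(x, y). \<exists>a b. a < b \<and> b < length xs \<and> x = xs ! b \<and> y = xs ! a \<and> \<pi> x < \<pi> y}"

text \<open>For a fixed list the inverted pairs depend on \<pi> only, so that condition (a) applies
  to them and a union bound over lists is possible.\<close>

definition bad_window :: "nat \<Rightarrow> nat \<Rightarrow> nat \<Rightarrow> (nat \<Rightarrow> nat) \<Rightarrow> (nat \<Rightarrow> nat \<Rightarrow> real) \<Rightarrow> bool" where
  "bad_window n w m \<pi> q \<longleftrightarrow> (\<exists>xs. set xs \<subseteq> {..<n} \<and> length xs \<le> w \<and> distinct xs \<and>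
     m \<le> card (inverted \<pi> xs) \<and> (\<Sum>(x, y)\<in>inverted \<pi> xs. q x y) \<le> 0)"

text \<open>The competitor sorts the items of the window by \<pi> and leaves all others in place;
  the pairs that it changes are precisely the inversions counted here.\<close>

lemma window_inversions:
  assumes opt: "optimal_order k q \<sigma>" and q: "antisymmetric_on k q" and k: "k \<le> n"
    and \<pi>: "inj_on \<pi> {..<n}" "\<And>i. i < n \<Longrightarrow> \<pi> i < n" and good: "\<not> bad_window n w m \<pi> q"
  shows "card {(x, y). x < k \<and> y < k \<and> a \<le> \<sigma> y \<and> \<sigma> y < \<sigma> x \<and> \<sigma> x < a + w \<and> \<pi> x < \<pi> y} < m"
proof -
  have perm: "\<sigma> permutes {..<k}"
    using opt by (simp add: optimal_order_def is_arg_max_def)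
  have inj: "inj \<sigma>" and surj: "\<sigma> (inv \<sigma> p) = p" "inv \<sigma> (\<sigma> p) = p" for p
    using permutes_inj[OF perm] permutes_inverses[OF perm] by auto
  define b where "b = min (a + w) k"
  define xs where "xs = map (inv \<sigma>) [a..<b]"
  have nth: "xs ! p = inv \<sigma> (a + p)" if "p < length xs" for p
    using that by (simp add: xs_def)
  have inv_lt: "inv \<sigma> p < k" if "p < k" for p
    using permutes_in_image[OF permutes_inv[OF perm], of p] that by simp
  have \<sigma>lt: "\<sigma> i < k" if "i < k" for i
    using permutes_in_image[OF perm, of i] that by simp
  define F where "F = {(x, y). x < k \<and> y < k \<and> a \<le> \<sigma> y \<and> \<sigma> y < \<sigma> x \<and> \<sigma> x < a + w \<and> \<pi> x < \<pi> y}"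
  have inv: "inverted \<pi> xs = F"
  proof (intro set_eqI iffI)
    fix p assume "p \<in> inverted \<pi> xs"
    then obtain c d where cd: "c < d" "d < length xs" "p = (xs ! d, xs ! c)" "\<pi> (xs ! d) < \<pi> (xs ! c)"
      unfolding inverted_def by auto
    then have "a + d < k" "a + d < a + w" "c < length xs" by (auto simp: xs_def b_def)
    then show "p \<in> F"
      using cd by (auto simp: F_def nth surj intro!: inv_lt)
  next
    fix p assume "p \<in> F"
    then obtain x y where p: "p = (x, y)" "x < k" "y < k" "a \<le> \<sigma> y" "\<sigma> y < \<sigma> x" "\<sigma> x < a + w" "\<pi> x < \<pi> y"
      unfolding F_def by auto
    have len: "\<sigma> x - a < length xs" using p \<sigma>lt[of x] by (auto simp: xs_def b_def)
    have "xs ! (\<sigma> x - a) = x" "xs ! (\<sigma> y - a) = y"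
      using nth[of "\<sigma> x - a"] nth[of "\<sigma> y - a"] len p by (auto simp: surj)
    then show "p \<in> inverted \<pi> xs"
      unfolding inverted_def p(1) mem_Collect_eq prod.case
      by (intro exI[of _ "\<sigma> y - a"] exI[of _ "\<sigma> x - a"]) (use p len in auto)
  qed
  have "inj_on (inv \<sigma>) A" for A
    by (metis inj_onI surj(1))
  then have dist: "distinct xs"
    unfolding xs_def by (simp add: distinct_map)
  have set: "set xs \<subseteq> {..<n}" "length xs \<le> w"
    using inv_lt order.strict_trans2[OF _ k] by (auto simp: xs_def b_def)
  \<comment> \<open>Keys inside the window fill the range from \<open>a\<close> to
    \<open>a + n - 1\<close>, above all keys in front of it; the offset \<open>a + n\<close> lifts
    the keys behind it out of this range.\<close>
  define \<kappa> where "\<kappa> = (\<lambda>i. if \<sigma> i < a then \<sigma> i else if \<sigma> i < a + w then a + \<pi> i else a + n + \<sigma> i)"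
  have key: "inj_on \<kappa> {..<k}"
  proof (rule inj_onI)
    fix i j assume *: "i \<in> {..<k}" "j \<in> {..<k}" "\<kappa> i = \<kappa> j"
    then have "\<pi> i < n" "\<pi> j < n" using \<pi>(2)[of i] \<pi>(2)[of j] k by auto
    with * have "\<sigma> i = \<sigma> j \<or> \<pi> i = \<pi> j"
      unfolding \<kappa>_def by (auto split: if_splits)
    then show "i = j"
      using injD[OF inj, of i j] inj_onD[OF \<pi>(1), of i j] *(1,2) k by auto
  qed
  have eq: "{(i, j). i < k \<and> j < k \<and> \<kappa> i < \<kappa> j \<and> \<sigma> j < \<sigma> i} = F"
  proof -
    have "\<kappa> i < \<kappa> j \<and> \<sigma> j < \<sigma> i \<longleftrightarrow> a \<le> \<sigma> j \<and> \<sigma> j < \<sigma> i \<and> \<sigma> i < a + w \<and> \<pi> i < \<pi> j"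
      if "i < k" "j < k" for i j
    proof -
      have "\<pi> i < n" "\<pi> j < n" using that \<pi>(2) k by auto
      then show ?thesis unfolding \<kappa>_def by auto
    qed
    then show ?thesis unfolding F_def by auto
  qed
  have "(\<Sum>(x, y)\<in>F. q x y) \<le> 0"
    using optimal_order_key[OF opt key q] unfolding eq .
  then show ?thesis
    using good dist set inv unfolding bad_window_def F_def[symmetric] by (metis not_less)
qed

text \<open>\<open>L\<close> counts the items of a block that belong on its side of the cut,
  \<open>R\<close> the strays. At least \<open>h\<close> of the former allow at most
  \<open>e\<close> strays in the next block, and since \<open>e \<le> h\<close> this block again has
  at least \<open>h\<close> items that belong there. The second alternative covers the end of the
  positions, where blocks are not full.\<close>

lemma alternating_chain:
  fixes L R :: "nat \<Rightarrow> nat"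
  assumes "\<And>b. h \<le> L b \<Longrightarrow> R (Suc b) \<le> e" "\<And>b. R b + L b = 2 * h \<or> (\<forall>b'>b. R b' = 0)"
    "e \<le> h" "h \<le> L 0"
  shows "R (Suc b) \<le> e"
proof (induction b)
  case (Suc b)
  from assms(2)[of "Suc b"] show ?case
  proof
    assume "R (Suc b) + L (Suc b) = 2 * h"
    then have "h \<le> L (Suc b)" using Suc.IH assms(3) by linarith
    then show ?thesis by (rule assms(1))
  next
    assume "\<forall>b'>Suc b. R b' = 0"
    then have "R (Suc (Suc b)) = 0" by simp
    then show ?thesis by simp
  qed
next
  case 0
  show ?case using assms(4) by (rule assms(1))
qed

section \<open>Items that cross a given position\<close>

lemma card_block:
  assumes "\<sigma> permutes {..<k}" "b \<le> k"
  shows "card {i. i < k \<and> a \<le> \<sigma> i \<and> \<sigma> i < b} = b - a"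
proof -
  have "\<sigma> ` {i. i < k \<and> a \<le> \<sigma> i \<and> \<sigma> i < b} = {a..<b}"
  proof
    show "{a..<b} \<subseteq> \<sigma> ` {i. i < k \<and> a \<le> \<sigma> i \<and> \<sigma> i < b}"
    proof
      fix p assume p: "p \<in> {a..<b}"
      have "\<sigma> (inv \<sigma> p) = p" using permutes_inverses(1)[OF assms(1)] .
      moreover have "inv \<sigma> p < k"
        using permutes_in_image[OF permutes_inv[OF assms(1)], of p] p assms(2) by simp
      ultimately show "p \<in> \<sigma> ` {i. i < k \<and> a \<le> \<sigma> i \<and> \<sigma> i < b}"
        using p by (intro image_eqI[of _ _ "inv \<sigma> p"]) auto
    qed
  qed auto
  then show ?thesis
    using card_image[OF permutes_inj_on[OF assms(1)], of "{i. i < k \<and> a \<le> \<sigma> i \<and> \<sigma> i < b}"] by simp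
qed

text \<open>Exactly \<open>t\<close> items have position below \<open>t\<close> and exactly
  \<open>t\<close> have rank below \<open>t\<close>; the two counts arise by removing the items
  common to both sets.\<close>

lemma card_crossing_eq:
  fixes \<sigma> \<rho> :: "nat \<Rightarrow> nat"
  assumes "\<sigma> permutes {..<k}" "\<rho> permutes {..<k}" "t \<le> k"
  shows "card {i. i < k \<and> \<sigma> i < t \<and> t \<le> \<rho> i} = card {i. i < k \<and> t \<le> \<sigma> i \<and> \<rho> i < t}"
proof -
  let ?A = "{i. i < k \<and> \<sigma> i < t \<and> \<rho> i < t}"
  have "{i. i < k \<and> \<sigma> i < t \<and> t \<le> \<rho> i} \<union> ?A = {i. i < k \<and> 0 \<le> \<sigma> i \<and> \<sigma> i < t}"
    "{i. i < k \<and> t \<le> \<sigma> i \<and> \<rho> i < t} \<union> ?A = {i. i < k \<and> 0 \<le> \<rho> i \<and> \<rho> i < t}"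
    by auto
  then have "card ({i. i < k \<and> \<sigma> i < t \<and> t \<le> \<rho> i} \<union> ?A) = t"
    "card ({i. i < k \<and> t \<le> \<sigma> i \<and> \<rho> i < t} \<union> ?A) = t"
    using card_block[OF assms(1,3), of 0] card_block[OF assms(2,3), of 0] by simp_all
  moreover have "card ({i. i < k \<and> \<sigma> i < t \<and> t \<le> \<rho> i} \<union> ?A) = card {i. i < k \<and> \<sigma> i < t \<and> t \<le> \<rho> i} + card ?A"
    by (rule card_Un_disjoint) auto
  moreover have "card ({i. i < k \<and> t \<le> \<sigma> i \<and> \<rho> i < t} \<union> ?A) = card {i. i < k \<and> t \<le> \<sigma> i \<and> \<rho> i < t} + card ?A"
    by (rule card_Un_disjoint) auto
  ultimately show ?thesis by simp
qed

text \<open>Cut the positions on both sides of \<open>t\<close> into blocks of length \<open>2 * h\<close>.  Two neighbouring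
  blocks have few inversions, so that a block with many items of rank below \<open>t\<close> is preceded by a
  block with few items of rank at least \<open>t\<close>, and conversely.\<close>

lemma card_crossing_le:
  assumes \<sigma>: "\<sigma> permutes {..<k}" and \<rho>: "\<rho> permutes {..<k}" and t: "t \<le> k"
    and win: "\<And>a. card {(x, y). x < k \<and> y < k \<and> a \<le> \<sigma> y \<and> \<sigma> y < \<sigma> x \<and> \<sigma> x < a + 4 * h \<and> \<rho> x < \<rho> y}
      < h * (e + 1)"
    and e: "e \<le> h" and h: "1 \<le> h" and d: "\<And>i. i < k \<Longrightarrow> \<rho> i \<le> \<sigma> i + d \<and> \<sigma> i \<le> \<rho> i + d"
  shows "card {i. i < k \<and> \<sigma> i < t \<and> t \<le> \<rho> i} \<le> 2 * h + e * (d div (2 * h) + 1)"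
proof -
  define w where "w = 2 * h"
  define Rl where "Rl = (\<lambda>b. {i. i < k \<and> t \<le> \<rho> i \<and> \<sigma> i + b * w < t \<and> t \<le> \<sigma> i + (b + 1) * w})"
  define Ll where "Ll = (\<lambda>b. {i. i < k \<and> \<rho> i < t \<and> \<sigma> i + b * w < t \<and> t \<le> \<sigma> i + (b + 1) * w})"
  define Rr where "Rr = (\<lambda>b. {i. i < k \<and> t \<le> \<rho> i \<and> t + b * w \<le> \<sigma> i \<and> \<sigma> i < t + (b + 1) * w})"
  define Lr where "Lr = (\<lambda>b. {i. i < k \<and> \<rho> i < t \<and> t + b * w \<le> \<sigma> i \<and> \<sigma> i < t + (b + 1) * w})"
  \<comment> \<open>All pairs of \<open>L \<times> R\<close> are inversions within one window,
    because \<open>R\<close> precedes \<open>L\<close> in position but has the higher ranks.\<close>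
  have prod: "card R * card L < h * (e + 1)"
    if "\<And>y. y \<in> R \<Longrightarrow> y < k \<and> t \<le> \<rho> y \<and> a \<le> \<sigma> y" "\<And>x. x \<in> L \<Longrightarrow> x < k \<and> \<rho> x < t \<and> \<sigma> x < a + 4 * h"
      "\<And>x y. x \<in> L \<Longrightarrow> y \<in> R \<Longrightarrow> \<sigma> y < \<sigma> x" for R L a
  proof -
    let ?F = "{(x, y). x < k \<and> y < k \<and> a \<le> \<sigma> y \<and> \<sigma> y < \<sigma> x \<and> \<sigma> x < a + 4 * h \<and> \<rho> x < \<rho> y}"
    have "finite ?F" by (rule finite_subset[of _ "{..<k} \<times> {..<k}"]) auto
    moreover have "L \<times> R \<subseteq> ?F" using that by (fastforce intro: order.strict_trans2)
    ultimately have "card (L \<times> R) \<le> card ?F" by (rule card_mono)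
    then show ?thesis using win[of a] by (simp add: card_cartesian_product mult.commute)
  qed
  have few: "x \<le> e" if "x * y < h * (e + 1)" "h \<le> y" for x y
  proof (rule ccontr)
    assume "\<not> x \<le> e"
    then have "(e + 1) * h \<le> x * y" using that(2) by (intro mult_mono) auto
    then show False using that(1) by (simp add: mult.commute)
  qed
  have fin: "finite {i. i < k \<and> P i}" for P by simp
  have left_step: "card (Rl (Suc b)) \<le> e" if "h \<le> card (Ll b)" for b
    by (rule few[OF prod[of "Rl (Suc b)" "t - (b + 2) * w" "Ll b"] that])
      (auto simp: Rl_def Ll_def w_def algebra_simps)
  have left_full: "card (Rl b) + card (Ll b) = 2 * h \<or> (\<forall>b'>b. card (Rl b') = 0)" for b
  proof (cases "(b + 1) * w \<le> t")
    case True
    have "card (Rl b \<union> Ll b) = card (Rl b) + card (Ll b)"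
      by (rule card_Un_disjoint) (auto simp: Rl_def Ll_def)
    moreover have "Rl b \<union> Ll b = {i. i < k \<and> t - (b + 1) * w \<le> \<sigma> i \<and> \<sigma> i < t - b * w}"
      by (auto simp: Rl_def Ll_def)
    moreover have "(t - b * w) - (t - (b + 1) * w) = 2 * h"
      using True by (simp add: w_def algebra_simps)
    ultimately show ?thesis
      using card_block[OF \<sigma>, of "t - b * w" "t - (b + 1) * w"] t by simp
  next
    case False
    have "Rl b' = {}" if "b < b'" for b'
    proof -
      have "(b + 1) * w \<le> b' * w" using that by (intro mult_right_mono) auto
      then show ?thesis using False by (auto simp: Rl_def)
    qed
    then show ?thesis by simp
  qed
  have right_step: "card (Lr (Suc b)) \<le> e" if "h \<le> card (Rr b)" for b
  proof -
    have "card (Rr b) * card (Lr (Suc b)) < h * (e + 1)"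
      by (rule prod[of _ "t + b * w"]) (auto simp: Rr_def Lr_def w_def algebra_simps)
    then show ?thesis using few[of "card (Lr (Suc b))" "card (Rr b)"] that by (simp add: mult.commute)
  qed
  have right_full: "card (Lr b) + card (Rr b) = 2 * h \<or> (\<forall>b'>b. card (Lr b') = 0)" for b
  proof (cases "t + (b + 1) * w \<le> k")
    case True
    have "card (Lr b \<union> Rr b) = card (Lr b) + card (Rr b)"
      by (rule card_Un_disjoint) (auto simp: Rr_def Lr_def)
    moreover have "Lr b \<union> Rr b = {i. i < k \<and> t + b * w \<le> \<sigma> i \<and> \<sigma> i < t + (b + 1) * w}"
      by (auto simp: Rr_def Lr_def)
    ultimately show ?thesis
      using card_block[OF \<sigma> True, of "t + b * w"] by (simp add: w_def)
  next
    case False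
    have "Lr b' = {}" if "b < b'" for b'
    proof -
      have "(b + 1) * w \<le> b' * w" using that by (intro mult_right_mono) auto
      moreover have "\<sigma> i < k" if "i < k" for i using permutes_in_image[OF \<sigma>, of i] that by simp
      ultimately show ?thesis using False by (fastforce simp: Lr_def)
    qed
    then show ?thesis by simp
  qed
  have cover: "card A \<le> card (f 0) + e * (d div w)"
    if "A \<subseteq> (\<Union>b\<le>d div w. f b)" "\<And>b. card (f (Suc b)) \<le> e" "\<And>b. finite (f b)" for A :: "nat set" and f
  proof -
    have "card A \<le> card (\<Union>b\<le>d div w. f b)" using that by (intro card_mono) auto
    also have "\<dots> \<le> (\<Sum>b\<le>d div w. card (f b))" by (rule card_UN_le) simp
    also have "\<dots> = card (f 0) + (\<Sum>b<d div w. card (f (Suc b)))"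
      by (simp add: sum.atMost_shift)
    also have "\<dots> \<le> card (f 0) + (\<Sum>b<d div w. e)"
      using that(2) by (intro add_left_mono sum_mono)
    finally show ?thesis by (simp add: mult.commute)
  qed
  have wpos: "0 < w" using h by (simp add: w_def)
  have left_cover: "{i. i < k \<and> \<sigma> i < t \<and> t \<le> \<rho> i} \<subseteq> (\<Union>b\<le>d div w. Rl b)"
  proof
    fix i assume "i \<in> {i. i < k \<and> \<sigma> i < t \<and> t \<le> \<rho> i}"
    then have i: "i < k" "\<sigma> i < t" "t \<le> \<rho> i" by auto
    define b where "b = (t - 1 - \<sigma> i) div w"
    have "b \<le> d div w" unfolding b_def using d[OF i(1)] i by (intro div_le_mono) auto
    moreover have "b * w \<le> t - 1 - \<sigma> i" "t - 1 - \<sigma> i < (b + 1) * w"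
      unfolding b_def using dividend_less_div_times[OF wpos, of "t - 1 - \<sigma> i"]
      by (simp_all add: div_times_less_eq_dividend)
    then have "i \<in> Rl b" using i by (auto simp: Rl_def)
    ultimately show "i \<in> (\<Union>b\<le>d div w. Rl b)" by blast
  qed
  have right_cover: "{i. i < k \<and> t \<le> \<sigma> i \<and> \<rho> i < t} \<subseteq> (\<Union>b\<le>d div w. Lr b)"
  proof
    fix i assume "i \<in> {i. i < k \<and> t \<le> \<sigma> i \<and> \<rho> i < t}"
    then have i: "i < k" "t \<le> \<sigma> i" "\<rho> i < t" by auto
    define b where "b = (\<sigma> i - t) div w"
    have "b \<le> d div w" unfolding b_def using d[OF i(1)] i by (intro div_le_mono) auto
    moreover have "b * w \<le> \<sigma> i - t" "\<sigma> i - t < (b + 1) * w"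
      unfolding b_def using dividend_less_div_times[OF wpos, of "\<sigma> i - t"]
      by (simp_all add: div_times_less_eq_dividend)
    then have "i \<in> Lr b" using i by (auto simp: Lr_def)
    ultimately show "i \<in> (\<Union>b\<le>d div w. Lr b)" by blast
  qed
  have bound: "card (Rl 0) \<le> 2 * h"
  proof -
    have "card (Rl 0) \<le> card {i. i < k \<and> t - w \<le> \<sigma> i \<and> \<sigma> i < t}"
      by (rule card_mono) (auto simp: Rl_def)
    then show ?thesis using card_block[OF \<sigma> t, of "t - w"] by (simp add: w_def)
  qed
  show ?thesis
  \<comment> \<open>With at least \<open>h\<close> low items just left of \<open>t\<close>, the
    chain runs to the left. Otherwise that block, if full, has at least \<open>h\<close> high items;
    then the block just right of \<open>t\<close> has few low items, and the crossings of the
    opposite direction are counted on the right. An incomplete block means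
    \<open>t < 2 * h\<close>.\<close>
  proof (cases "h \<le> card (Ll 0)")
    case True
    have "card {i. i < k \<and> \<sigma> i < t \<and> t \<le> \<rho> i} \<le> card (Rl 0) + e * (d div w)"
      by (rule cover[OF left_cover alternating_chain[OF left_step left_full e True]]) (auto simp: Rl_def)
    then show ?thesis using bound by (simp add: w_def)
  next
    case False
    show ?thesis
    proof (cases "w \<le> t")
      case True
      have "card (Rl 0 \<union> Ll 0) = card (Rl 0) + card (Ll 0)"
        by (rule card_Un_disjoint) (auto simp: Rl_def Ll_def)
      moreover have "Rl 0 \<union> Ll 0 = {i. i < k \<and> t - w \<le> \<sigma> i \<and> \<sigma> i < t}"
        by (auto simp: Rl_def Ll_def)
      ultimately have "h \<le> card (Rl 0)"
        using card_block[OF \<sigma> t, of "t - w"] False True by (simp add: w_def)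
      moreover have "card (Rl 0) * card (Lr 0) < h * (e + 1)"
        by (rule prod[of _ "t - w"]) (auto simp: Rl_def Lr_def w_def)
      ultimately have L0: "card (Lr 0) \<le> e"
        using few[of "card (Lr 0)" "card (Rl 0)"] by (simp add: mult.commute)
      have "card (Lr (Suc b)) \<le> e" for b
      proof (cases "h \<le> card (Rr 0)")
        case True
        show ?thesis by (rule alternating_chain[OF right_step right_full e True])
      next
        case False
        then show ?thesis using right_full[of 0] L0 e by auto
      qed
      then have "card {i. i < k \<and> t \<le> \<sigma> i \<and> \<rho> i < t} \<le> card (Lr 0) + e * (d div w)"
        by (intro cover[OF right_cover]) (simp_all add: Lr_def)
      then show ?thesis
        using L0 card_crossing_eq[OF \<sigma> \<rho> t] by (simp add: w_def)
    next
      case False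
      have "card {i. i < k \<and> \<sigma> i < t \<and> t \<le> \<rho> i} \<le> card {i. i < k \<and> 0 \<le> \<sigma> i \<and> \<sigma> i < t}"
        by (rule card_mono) auto
      then show ?thesis using card_block[OF \<sigma> t, of 0] False by (simp add: w_def)
    qed
  qed
qed


section \<open>Displacement in an optimal order\<close>

text \<open>Each crossing count will be at most \<open>d\<close> divided by \<open>\<Delta>\<close>;
  the factor 4 stands for two cuts with two directions of crossing each.\<close>

definition near :: "nat set \<Rightarrow> nat set \<Rightarrow> nat \<Rightarrow> nat \<Rightarrow> nat set set" where
  "near I Z \<Delta> d = {(I - Y) \<union> (Y - I) |Y. Y \<subseteq> Z \<and> \<Delta> * card Y \<le> 4 * d}"

text \<open>Confines the exceptional items to about \<open>4 * d\<close> candidates, without which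
  there would be too many sets near an interval. An item positioned within \<open>d\<close> of rank
  \<open>\<rho> i\<close> and displaced by at most \<open>d\<close> has rank within
  \<open>2 * d\<close> of it.\<close>

definition zone :: "nat \<Rightarrow> (nat \<Rightarrow> nat) \<Rightarrow> nat \<Rightarrow> nat \<Rightarrow> nat set" where
  "zone k \<rho> i d = {j. j < k \<and> \<rho> i \<le> \<rho> j + 2 * d \<and> \<rho> j \<le> \<rho> i + 2 * d}"

definition above :: "nat \<Rightarrow> (nat \<Rightarrow> nat) \<Rightarrow> nat \<Rightarrow> nat \<Rightarrow> nat set" where
  "above k \<rho> i d = {j. j < k \<and> \<rho> i \<le> \<rho> j \<and> \<rho> j < \<rho> i + d}"

definition below :: "nat \<Rightarrow> (nat \<Rightarrow> nat) \<Rightarrow> nat \<Rightarrow> nat \<Rightarrow> nat set" where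
  "below k \<rho> i d = {j. j < k \<and> \<rho> i < \<rho> j + d \<and> \<rho> j \<le> \<rho> i}"

text \<open>Describes an item \<open>i\<close> placed \<open>d\<close> positions too late, with
  \<open>J\<close> the items it has jumped over. No optimal order occurs, and the admissible
  \<open>J\<close> are determined by \<pi>.\<close>

definition bad_up :: "(nat \<Rightarrow> nat) \<Rightarrow> (nat \<Rightarrow> nat \<Rightarrow> real) \<Rightarrow> nat \<Rightarrow> nat \<Rightarrow> nat \<Rightarrow> nat \<Rightarrow> nat set \<Rightarrow> bool" where
  "bad_up \<pi> q \<Delta> k i d J \<longleftrightarrow> J \<in> near (above k (rank k \<pi>) i d) (zone k (rank k \<pi>) i d) \<Delta> d \<and>
     J \<subseteq> {..<k} - {i} \<and> card J = d \<and> 2 * d \<le> 3 * card {j \<in> J. \<pi> i < \<pi> j} \<and> (\<Sum>j\<in>J. q i j) \<le> 0"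

definition bad_down :: "(nat \<Rightarrow> nat) \<Rightarrow> (nat \<Rightarrow> nat \<Rightarrow> real) \<Rightarrow> nat \<Rightarrow> nat \<Rightarrow> nat \<Rightarrow> nat \<Rightarrow> nat set \<Rightarrow> bool" where
  "bad_down \<pi> q \<Delta> k i d J \<longleftrightarrow> J \<in> near (below k (rank k \<pi>) i d) (zone k (rank k \<pi>) i d) \<Delta> d \<and>
     J \<subseteq> {..<k} - {i} \<and> card J = d \<and> 2 * d \<le> 3 * card {j \<in> J. \<pi> j < \<pi> i} \<and> (\<Sum>j\<in>J. q j i) \<le> 0"

definition bad_move :: "nat \<Rightarrow> nat \<Rightarrow> nat \<Rightarrow> (nat \<Rightarrow> nat) \<Rightarrow> (nat \<Rightarrow> nat \<Rightarrow> real) \<Rightarrow> bool" where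
  "bad_move n D \<Delta> \<pi> q \<longleftrightarrow> (\<exists>k\<le>n. \<exists>i<k. \<exists>d. D \<le> d \<and> d \<le> n \<and>
     (\<exists>J. bad_up \<pi> q \<Delta> k i d J \<or> bad_down \<pi> q \<Delta> k i d J))"

lemma nearI:
  assumes "Y = (I - J) \<union> (J - I)" "Y \<subseteq> Z" "\<Delta> * card Y \<le> 4 * d"
  shows "J \<in> near I Z \<Delta> d"
proof -
  have "J = (I - Y) \<union> (Y - I)" using assms(1) by blast
  then show ?thesis using assms(2,3) unfolding near_def by blast
qed

text \<open>The maximal displacement \<open>d\<close> is attained by some \<open>x\<close> and at
  the same time bounds the displacements that enter the crossing estimate. If
  \<open>d \<ge> D\<close>, the crossings are at most a fraction 1 / \<open>\<Delta>\<close> of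
  \<open>d\<close>, so the items jumped over by \<open>x\<close> form a set near a rank interval,
  and putting \<open>x\<close> back gives a bad move.\<close>

lemma displacement_less:
  assumes opt: "optimal_order k q \<sigma>" and q: "antisymmetric_on k q" and k: "k \<le> n"
    and \<pi>: "inj_on \<pi> {..<n}" "\<And>i. i < n \<Longrightarrow> \<pi> i < n"
    and good: "\<not> bad_window n (4 * h) (h * (e + 1)) \<pi> q" "\<not> bad_move n D \<Delta> \<pi> q"
    and e: "e \<le> h" and h: "1 \<le> h" and \<Delta>: "3 \<le> \<Delta>"
    and D: "\<And>d. D \<le> d \<Longrightarrow> \<Delta> * (2 * h + e * (d div (2 * h) + 1)) \<le> d"
    and i: "i < k"
  shows "\<sigma> i < rank k \<pi> i + D \<and> rank k \<pi> i < \<sigma> i + D"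
proof -
  define \<rho> where "\<rho> = rank k \<pi>"
  have inj\<pi>: "inj_on \<pi> {..<k}" using \<pi>(1) by (rule inj_on_subset) (use k in auto)
  have \<sigma>: "\<sigma> permutes {..<k}"
    using opt by (simp add: optimal_order_def is_arg_max_def)
  have \<rho>: "\<rho> permutes {..<k}" unfolding \<rho>_def by (rule rank_permutes[OF inj\<pi>])
  have less: "\<rho> i < \<rho> j \<longleftrightarrow> \<pi> i < \<pi> j" if "i < k" "j < k" for i j
    unfolding \<rho>_def by (rule rank_less_iff[OF that])
  have \<sigma>lt: "\<sigma> i < k" and \<rho>lt: "\<rho> i < k" if "i < k" for i
    using permutes_in_image[OF \<sigma>, of i] permutes_in_image[OF \<rho>, of i] that by auto
  have inj\<sigma>: "\<sigma> x = \<sigma> y \<longleftrightarrow> x = y" and inj\<rho>: "\<rho> x = \<rho> y \<longleftrightarrow> x = y" for x y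
    using permutes_inj[OF \<sigma>] permutes_inj[OF \<rho>] by (auto dest: injD)
  \<comment> \<open>The larger of the two truncated differences is the absolute difference.\<close>
  define disp where "disp = (\<lambda>i. max (\<sigma> i - \<rho> i) (\<rho> i - \<sigma> i))"
  define d where "d = Max (disp ` {..<k})"
  have fin: "finite (disp ` {..<k})" "disp ` {..<k} \<noteq> {}" using i by auto
  have le_d: "disp x \<le> d" if "x < k" for x
    unfolding d_def using fin that by (intro Max_ge) auto
  have near_d: "\<rho> x \<le> \<sigma> x + d \<and> \<sigma> x \<le> \<rho> x + d" if "x < k" for x
    using le_d[OF that] by (auto simp: disp_def)
  have "d < D"
  proof (rule ccontr)
    assume "\<not> d < D"
    then have dD: "D \<le> d" by simp
    have "d \<in> disp ` {..<k}" unfolding d_def by (rule Max_in[OF fin])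
    then obtain x where x: "x < k" "d = disp x" by auto
    have dn: "d \<le> n" using x \<sigma>lt[OF x(1)] \<rho>lt[OF x(1)] k by (auto simp: disp_def)
    define X where "X = 2 * h + e * (d div (2 * h) + 1)"
    have \<Delta>X: "\<Delta> * X \<le> d" using D[OF dD] by (simp add: X_def)
    have win: "card {(x, y). x < k \<and> y < k \<and> a \<le> \<sigma> y \<and> \<sigma> y < \<sigma> x \<and> \<sigma> x < a + 4 * h \<and> \<rho> x < \<rho> y}
        < h * (e + 1)" for a
    proof -
      have "{(x, y). x < k \<and> y < k \<and> a \<le> \<sigma> y \<and> \<sigma> y < \<sigma> x \<and> \<sigma> x < a + 4 * h \<and> \<rho> x < \<rho> y} =
        {(x, y). x < k \<and> y < k \<and> a \<le> \<sigma> y \<and> \<sigma> y < \<sigma> x \<and> \<sigma> x < a + 4 * h \<and> \<pi> x < \<pi> y}"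
        using less by auto
      then show ?thesis using window_inversions[OF opt q k \<pi> good(1), of a] by simp
    qed
    have cross: "card {j. j < k \<and> \<sigma> j < t \<and> t \<le> \<rho> j} \<le> X" "card {j. j < k \<and> t \<le> \<sigma> j \<and> \<rho> j < t} \<le> X"
      if "t \<le> k" for t
      using card_crossing_le[OF \<sigma> \<rho> that win e h near_d] card_crossing_eq[OF \<sigma> \<rho> that]
      by (simp_all add: X_def)
    have card4: "card Y \<le> 4 * X"
      if "Y \<subseteq> A \<union> B \<union> (C \<union> E)" "card A \<le> X" "card B \<le> X" "card C \<le> X" "card E \<le> X"
        "finite (A \<union> B \<union> (C \<union> E))" for Y A B C E :: "nat set"
    proof -
      have "card Y \<le> card (A \<union> B \<union> (C \<union> E))" using that by (intro card_mono) auto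
      also have "\<dots> \<le> (card A + card B) + (card C + card E)"
        by (intro order_trans[OF card_Un_le] add_mono card_Un_le)
      finally show ?thesis using that by simp
    qed
    have Y: "\<Delta> * card Y \<le> 4 * d" if "card Y \<le> 4 * X" for Y :: "nat set"
    proof -
      have "\<Delta> * card Y \<le> 4 * (\<Delta> * X)" using mult_left_mono[OF that, of \<Delta>] by (simp only: ac_simps)
      then show ?thesis using \<Delta>X by linarith
    qed
    \<comment> \<open>At most a third of the items jumped over may be ordered wrongly relative to
      \<open>x\<close>, as condition (a) requires.\<close>
    have X3: "3 * X \<le> d" using order_trans[OF mult_right_mono[OF \<Delta>, of X] \<Delta>X] by blast
    have majority: "2 * d \<le> 3 * card {j \<in> J. P j}"
      if "card J = d" "card {j \<in> J. \<not> P j} \<le> X" "finite J" for J and P :: "nat \<Rightarrow> bool"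
    proof -
      have "card J = card {j \<in> J. P j} + card {j \<in> J. \<not> P j}"
        using that(3) by (subst card_Un_disjoint[symmetric]) (auto intro: arg_cong[where f = card])
      then show ?thesis using that X3 by linarith
    qed
    show False
    proof (cases "\<rho> x \<le> \<sigma> x")
      case True
      then have s: "\<sigma> x = \<rho> x + d" using x by (auto simp: disp_def)
      define J where "J = {j. j < k \<and> \<rho> x \<le> \<sigma> j \<and> \<sigma> j < \<sigma> x}"
      define I where "I = above k \<rho> x d"
      have t: "\<rho> x \<le> k" "\<sigma> x \<le> k" using \<sigma>lt[OF x(1)] \<rho>lt[OF x(1)] by auto
      have J: "J \<subseteq> {..<k} - {x}" "finite J" by (auto simp: J_def)
      have cJ: "card J = d" unfolding J_def using card_block[OF \<sigma> t(2)] s by simp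
      have maj: "2 * d \<le> 3 * card {j \<in> J. \<pi> x < \<pi> j}"
      proof (rule majority[OF cJ _ J(2)])
        have "{j \<in> J. \<not> \<pi> x < \<pi> j} \<subseteq> {j. j < k \<and> \<rho> x \<le> \<sigma> j \<and> \<rho> j < \<rho> x}"
        proof
          fix j assume "j \<in> {j \<in> J. \<not> \<pi> x < \<pi> j}"
          then have j: "j < k" "\<rho> x \<le> \<sigma> j" "\<not> \<pi> x < \<pi> j" "j \<noteq> x" using J by (auto simp: J_def)
          then have "\<rho> j \<noteq> \<rho> x" "\<not> \<rho> x < \<rho> j" using inj\<rho>[of j x] less[OF x(1) j(1)] by simp_all
          then show "j \<in> {j. j < k \<and> \<rho> x \<le> \<sigma> j \<and> \<rho> j < \<rho> x}" using j by simp
        qed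
        then have "card {j \<in> J. \<not> \<pi> x < \<pi> j} \<le> card {j. j < k \<and> \<rho> x \<le> \<sigma> j \<and> \<rho> j < \<rho> x}"
          by (intro card_mono) auto
        then show "card {j \<in> J. \<not> \<pi> x < \<pi> j} \<le> X" using cross(2)[OF t(1)] by simp
      qed
      have near: "J \<in> near I (zone k \<rho> x d) \<Delta> d"
      proof (rule nearI[OF refl _ Y[OF card4]])
        show "(I - J) \<union> (J - I) \<subseteq> zone k \<rho> x d"
          using near_d s by (fastforce simp: I_def J_def above_def zone_def)
        \<comment> \<open>An item in exactly one of the two sets has its position and its rank on
          different sides of one of the cuts \<open>\<rho> x\<close> and
          \<open>\<sigma> x\<close>.\<close>
        show "(I - J) \<union> (J - I) \<subseteq>
          ({j. j < k \<and> \<sigma> j < \<rho> x \<and> \<rho> x \<le> \<rho> j} \<union> {j. j < k \<and> \<sigma> x \<le> \<sigma> j \<and> \<rho> j < \<sigma> x}) \<union>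
          ({j. j < k \<and> \<rho> x \<le> \<sigma> j \<and> \<rho> j < \<rho> x} \<union> {j. j < k \<and> \<sigma> j < \<sigma> x \<and> \<sigma> x \<le> \<rho> j})"
          using s by (auto simp: I_def J_def above_def)
      qed (use cross t in auto)
      \<comment> \<open>Doubling makes room: the new key of \<open>x\<close> is just below
        \<open>2 * \<rho> x + 1\<close>, the key of the item at position
        \<open>\<rho> x\<close>.\<close>
      define \<kappa> where "\<kappa> = (\<lambda>y. if y = x then 2 * \<rho> x else 2 * \<sigma> y + 1)"
      have key: "inj_on \<kappa> {..<k}"
      proof (rule inj_onI)
        fix a b assume "\<kappa> a = \<kappa> b"
        then show "a = b"
          unfolding \<kappa>_def using inj\<sigma>[of a b] by (cases "a = x"; cases "b = x") (simp_all, presburger+)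
      qed
      have "{(i, j). i < k \<and> j < k \<and> \<kappa> i < \<kappa> j \<and> \<sigma> j < \<sigma> i} = {x} \<times> J"
        using True x(1) by (auto simp: \<kappa>_def J_def split: if_splits)
      then have "(\<Sum>(i, j)\<in>{x} \<times> J. q i j) \<le> 0"
        using optimal_order_key[OF opt key q] by simp
      then have "(\<Sum>j\<in>J. q x j) \<le> 0"
        by (simp add: sum.cartesian_product[symmetric])
      then have "bad_up \<pi> q \<Delta> k x d J"
        using near J cJ maj unfolding bad_up_def I_def \<rho>_def by blast
      then show False
        using good(2) k x(1) dD dn unfolding bad_move_def by blast
    next
      case False
      then have s: "\<rho> x = \<sigma> x + d" using x by (auto simp: disp_def)
      \<comment> \<open>Here \<open>x\<close> stands in front of the items jumped over and must
        itself be excluded, so both cuts are shifted by one.\<close>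
      define J where "J = {j. j < k \<and> \<sigma> x + 1 \<le> \<sigma> j \<and> \<sigma> j < \<rho> x + 1}"
      define I where "I = below k \<rho> x d"
      have t: "\<rho> x + 1 \<le> k" "\<sigma> x + 1 \<le> k" using \<sigma>lt[OF x(1)] \<rho>lt[OF x(1)] by auto
      have J: "J \<subseteq> {..<k} - {x}" "finite J" by (auto simp: J_def)
      have cJ: "card J = d" unfolding J_def using card_block[OF \<sigma> t(1), of "\<sigma> x + 1"] s by simp
      have maj: "2 * d \<le> 3 * card {j \<in> J. \<pi> j < \<pi> x}"
      proof (rule majority[OF cJ _ J(2)])
        have "{j \<in> J. \<not> \<pi> j < \<pi> x} \<subseteq> {j. j < k \<and> \<sigma> j < \<rho> x + 1 \<and> \<rho> x + 1 \<le> \<rho> j}"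
        proof
          fix j assume "j \<in> {j \<in> J. \<not> \<pi> j < \<pi> x}"
          then have j: "j < k" "\<sigma> j < \<rho> x + 1" "\<not> \<pi> j < \<pi> x" "j \<noteq> x" using J by (auto simp: J_def)
          then have "\<rho> j \<noteq> \<rho> x" "\<not> \<rho> j < \<rho> x" using inj\<rho>[of j x] less[OF j(1) x(1)] by simp_all
          then show "j \<in> {j. j < k \<and> \<sigma> j < \<rho> x + 1 \<and> \<rho> x + 1 \<le> \<rho> j}" using j by simp
        qed
        then have "card {j \<in> J. \<not> \<pi> j < \<pi> x} \<le> card {j. j < k \<and> \<sigma> j < \<rho> x + 1 \<and> \<rho> x + 1 \<le> \<rho> j}"
          by (intro card_mono) auto
        then show "card {j \<in> J. \<not> \<pi> j < \<pi> x} \<le> X" using cross(1)[OF t(1)] by simp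
      qed
      have near: "J \<in> near I (zone k \<rho> x d) \<Delta> d"
      proof (rule nearI[OF refl _ Y[OF card4]])
        show "(I - J) \<union> (J - I) \<subseteq> zone k \<rho> x d"
          using near_d s by (fastforce simp: I_def J_def below_def zone_def)
        show "(I - J) \<union> (J - I) \<subseteq>
          ({j. j < k \<and> \<sigma> j < \<sigma> x + 1 \<and> \<sigma> x + 1 \<le> \<rho> j} \<union> {j. j < k \<and> \<rho> x + 1 \<le> \<sigma> j \<and> \<rho> j < \<rho> x + 1}) \<union>
          ({j. j < k \<and> \<sigma> x + 1 \<le> \<sigma> j \<and> \<rho> j < \<sigma> x + 1} \<union> {j. j < k \<and> \<sigma> j < \<rho> x + 1 \<and> \<rho> x + 1 \<le> \<rho> j})"
          using s by (auto simp: I_def J_def below_def)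
      qed (use cross t in auto)
      \<comment> \<open>Now \<open>x\<close> goes immediately behind the item at position
        \<open>\<rho> x\<close>.\<close>
      define \<kappa> where "\<kappa> = (\<lambda>y. if y = x then 2 * \<rho> x + 2 else 2 * \<sigma> y + 1)"
      have key: "inj_on \<kappa> {..<k}"
      proof (rule inj_onI)
        fix a b assume "\<kappa> a = \<kappa> b"
        then show "a = b"
          unfolding \<kappa>_def using inj\<sigma>[of a b] by (cases "a = x"; cases "b = x") (simp_all, presburger+)
      qed
      have "{(i, j). i < k \<and> j < k \<and> \<kappa> i < \<kappa> j \<and> \<sigma> j < \<sigma> i} = J \<times> {x}"
        using False x(1) by (auto simp: \<kappa>_def J_def split: if_splits)
      then have "(\<Sum>(i, j)\<in>J \<times> {x}. q i j) \<le> 0"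
        using optimal_order_key[OF opt key q] by simp
      then have "(\<Sum>j\<in>J. q j x) \<le> 0"
        by (simp add: sum.cartesian_product[symmetric])
      then have "bad_down \<pi> q \<Delta> k x d J"
        using near J cJ maj unfolding bad_down_def I_def \<rho>_def by blast
      then show False
        using good(2) k x(1) dD dn unfolding bad_move_def by blast
    qed
  qed
  then show ?thesis
    using near_d[OF i] unfolding \<rho>_def by linarith
qed


section \<open>Sums of log-likelihood ratios\<close>

locale noisy_signals =
  fixes n :: nat and M :: "'s measure" and D :: "nat \<Rightarrow> nat \<Rightarrow> 's \<Rightarrow> real" and \<pi> :: "nat \<Rightarrow> nat"
    and \<gamma> :: real and A :: nat
  assumes densities: "signal_densities n M D" and perm: "\<pi> permutes {..<n}"
    and biased: "strongly_biased A \<gamma> n M D \<pi>"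
begin

abbreviation P :: "(nat \<times> nat \<Rightarrow> 's) measure" where
  "P \<equiv> signal_measure n M D \<pi>"

lemma upair_in_upairs: "a < n \<Longrightarrow> b < n \<Longrightarrow> a \<noteq> b \<Longrightarrow> upair a b \<in> upairs n"
  by (auto simp: upair_def upairs_def min_def max_def)

lemma D_measurable: "a < n \<Longrightarrow> b < n \<Longrightarrow> a \<noteq> b \<Longrightarrow> D a b \<in> borel_measurable M"
  using densities by (simp add: signal_densities_def)

lemma D_zero_iff: "a < n \<Longrightarrow> b < n \<Longrightarrow> a \<noteq> b \<Longrightarrow> x \<in> space M \<Longrightarrow> D a b x = 0 \<longleftrightarrow> D b a x = 0"
  using densities by (simp add: signal_densities_def)

lemma D_nonneg: "a < n \<Longrightarrow> b < n \<Longrightarrow> a \<noteq> b \<Longrightarrow> x \<in> space M \<Longrightarrow> 0 \<le> D a b x"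
  using densities by (simp add: signal_densities_def)

lemma D_integral: "a < n \<Longrightarrow> b < n \<Longrightarrow> a \<noteq> b \<Longrightarrow> (\<integral>\<^sup>+x. ennreal (D a b x) \<partial>M) = 1"
  using densities by (simp add: signal_densities_def)

lemma prob_space_P: "prob_space P"
  unfolding signal_measure_def
proof (rule prob_space_PiM)
  fix p assume "p \<in> upairs n"
  then obtain a b where p: "p = (a, b)" "a < n" "b < n" "a \<noteq> b" by (auto simp: upairs_def)
  have "prob_space (density M (\<lambda>x. ennreal (if \<pi> a < \<pi> b then D a b x else D b a x)))"
  proof
    show "emeasure (density M (\<lambda>x. ennreal (if \<pi> a < \<pi> b then D a b x else D b a x)))
        (space (density M (\<lambda>x. ennreal (if \<pi> a < \<pi> b then D a b x else D b a x)))) = 1"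
      using p D_measurable[of a b] D_measurable[of b a] D_integral[of a b] D_integral[of b a]
      by (cases "\<pi> a < \<pi> b") (simp_all add: emeasure_density nn_integral_cong_AE
          cong: nn_integral_cong)
  qed
  then show "prob_space (case p of (a, b) \<Rightarrow> density M (\<lambda>x. ennreal (if \<pi> a < \<pi> b then D a b x else D b a x)))"
    by (simp add: p)
qed

sublocale prob_space P
  by (rule prob_space_P)

lemma signal_measurable: "p \<in> upairs n \<Longrightarrow> (\<lambda>s. s p) \<in> measurable P M"
proof -
  assume p: "p \<in> upairs n"
  have "(\<lambda>s. s p) \<in> measurable P ((\<lambda>(a, b). density M (\<lambda>x. ennreal (if \<pi> a < \<pi> b then D a b x else D b a x))) p)"
    unfolding signal_measure_def by (rule measurable_component_singleton[OF p])
  then show ?thesis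
    by (cases p) simp
qed

lemma llr_measurable [measurable]:
  assumes "a < n" "b < n"
  shows "(\<lambda>s. llr D s a b) \<in> borel_measurable P"
proof (cases "a = b")
  case True
  \<comment> \<open>No signal belongs to a diagonal pair, but the quotient of equal densities is 1,
    or 0 by the convention for division by 0, and \<open>ln\<close> is 0 at both.\<close>
  have "llr D s b b = 0" for s by (cases "D b b (s (upair b b)) = 0") (simp_all add: llr_def)
  then show ?thesis by (simp add: True)
next
  case False
  have u: "upair b a = upair a b" by (simp add: upair_def min.commute max.commute)
  note c = signal_measurable[OF upair_in_upairs[OF assms False]]
  have "(\<lambda>s. D a b (s (upair a b))) \<in> borel_measurable P" "(\<lambda>s. D b a (s (upair a b))) \<in> borel_measurable P"
    using measurable_compose[OF c D_measurable[OF assms False]]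
      measurable_compose[OF c D_measurable[OF assms(2,1)]] False by auto
  then show ?thesis unfolding llr_def by measurable
qed

lemma antisymmetric_llr:
  assumes s: "s \<in> space P"
  shows "antisymmetric_on n (llr D s)"
  unfolding antisymmetric_on_def
proof (intro allI impI)
  fix a b assume ab: "a < n" "b < n"
  have u: "upair b a = upair a b" by (simp add: upair_def min.commute max.commute)
  show "llr D s b a = - llr D s a b"
  proof (cases "a = b")
    case True
    then show ?thesis by (cases "D b b (s (upair b b)) = 0") (simp_all add: llr_def)
  next
    case False
    define x where "x = s (upair a b)"
    have x: "x \<in> space M"
      unfolding x_def by (rule measurable_space[OF signal_measurable[OF upair_in_upairs[OF ab False]] s])
    show ?thesis
    \<comment> \<open>If one density vanishes then so does the other, and both log-likelihood ratios
      are 0 by the conventions for division and \<open>ln\<close>.\<close>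
    proof (cases "D a b x = 0")
      case True
      then show ?thesis using D_zero_iff[OF ab False x] by (simp add: llr_def u x_def[symmetric])
    next
      case nz: False
      then have "0 < D a b x" "0 < D b a x"
        using D_zero_iff[OF ab False x] D_nonneg[OF ab False x] D_nonneg[OF ab(2,1) _ x] False
        by (auto simp: less_le)
      then show ?thesis by (simp add: llr_def u x_def[symmetric] ln_div)
    qed
  qed
qed

definition nonpos :: "(nat \<times> nat) set \<Rightarrow> (nat \<times> nat \<Rightarrow> 's) set" where
  "nonpos F = {s \<in> space P. (\<Sum>(x, y)\<in>F. llr D s x y) \<le> 0}"

lemma nonpos_measurable: "F \<subseteq> {..<n} \<times> {..<n} \<Longrightarrow> nonpos F \<in> sets P"
  unfolding nonpos_def by (measurable; auto intro!: llr_measurable)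

text \<open>Condition (a) for sets instead of sequences; injectivity of \<open>upair\<close> on the
  set expresses that the unordered pairs are distinct.\<close>

lemma prob_nonpos_less:
  assumes F: "finite F" "F \<subseteq> {..<n} \<times> {..<n}" "\<And>x y. (x, y) \<in> F \<Longrightarrow> x \<noteq> y"
    "inj_on (\<lambda>(x, y). upair x y) F"
    and m: "log 2 n / \<gamma> < card F" "card F \<le> n" "2 * card F \<le> 3 * card {(x, y) \<in> F. \<pi> x < \<pi> y}"
  shows "prob (nonpos F) < 2 powr (- \<gamma> * card F)"
proof -
  obtain h where h: "bij_betw h {..<card F} F"
    using ex_bij_betw_nat_finite[OF F(1)] by (auto simp: atLeast0LessThan)
  define a b where "a = fst \<circ> h" and "b = snd \<circ> h"
  have ab: "h k = (a k, b k)" for k by (simp add: a_def b_def)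
  have hF: "(a k, b k) \<in> F" if "k < card F" for k
    using h that ab unfolding bij_betw_def by (metis imageI lessThan_iff)
  have inj: "inj_on (\<lambda>k. upair (a k) (b k)) {..<card F}"
    using comp_inj_on[of h "{..<card F}" "\<lambda>(x, y). upair x y"] h F(4)
    by (simp add: bij_betw_def comp_def ab)
  have dp: "distinct_pairs n (card F) a b"
    unfolding distinct_pairs_def using inj hF F(2,3) by blast
  have "card {k. k < card F \<and> \<pi> (a k) < \<pi> (b k)} = card {(x, y) \<in> F. \<pi> x < \<pi> y}"
  proof (rule bij_betw_same_card[of h])
    show "bij_betw h {k. k < card F \<and> \<pi> (a k) < \<pi> (b k)} {(x, y) \<in> F. \<pi> x < \<pi> y}"
    proof (rule bij_betw_subset[OF h])
      show "h ` {k. k < card F \<and> \<pi> (a k) < \<pi> (b k)} = {(x, y) \<in> F. \<pi> x < \<pi> y}"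
      proof (intro set_eqI iffI)
        fix p assume "p \<in> h ` {k. k < card F \<and> \<pi> (a k) < \<pi> (b k)}"
        then show "p \<in> {(x, y) \<in> F. \<pi> x < \<pi> y}" using hF by (auto simp: ab)
      next
        fix p assume p: "p \<in> {(x, y) \<in> F. \<pi> x < \<pi> y}"
        then have "p \<in> h ` {..<card F}" using h by (auto simp: bij_betw_def)
        then obtain k where "k < card F" "p = h k" by auto
        then show "p \<in> h ` {k. k < card F \<and> \<pi> (a k) < \<pi> (b k)}" using p by (auto simp: ab)
      qed
    qed auto
  qed
  then have card: "2 / 3 * real (card F) \<le> real (card {k. k < card F \<and> \<pi> (a k) < \<pi> (b k)})"
    using m(3) by simp
  have sum: "(\<Sum>k<card F. llr D s (a k) (b k)) = (\<Sum>(x, y)\<in>F. llr D s x y)" for s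
    using sum.reindex_bij_betw[OF h, of "\<lambda>(x, y). llr D s x y"] by (simp add: ab)
  have "1 - 2 powr (- \<gamma> * card F) < prob {s \<in> space P. (\<Sum>(x, y)\<in>F. llr D s x y) > 0}"
    using biased m(1,2) dp card unfolding strongly_biased_def sum[symmetric] by blast
  also have "{s \<in> space P. (\<Sum>(x, y)\<in>F. llr D s x y) > 0} = space P - nonpos F"
    by (auto simp: nonpos_def)
  finally show ?thesis
    using prob_compl[OF nonpos_measurable[OF F(2)]] by simp
qed

definition correct_pairs :: "(nat \<times> nat) set" where
  "correct_pairs = {(x, y). x < n \<and> y < n \<and> \<pi> x < \<pi> y}"

lemma correct_pairs: "correct_pairs \<subseteq> {..<n} \<times> {..<n}" "finite correct_pairs"
  "inj_on (\<lambda>(x, y). upair x y) correct_pairs"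
proof -
  show 1: "correct_pairs \<subseteq> {..<n} \<times> {..<n}" by (auto simp: correct_pairs_def)
  show "finite correct_pairs" by (rule finite_subset[OF 1]) simp
  show "inj_on (\<lambda>(x, y). upair x y) correct_pairs"
    by (auto simp: inj_on_def correct_pairs_def upair_def min_def max_def split: if_splits)
qed

text \<open>Condition (a) only speaks about at most \<open>n\<close> pairs; larger sets are split.\<close>

lemma prob_nonpos_correct:
  assumes "F \<subseteq> correct_pairs" "m \<le> card F" "log 2 n / \<gamma> < m" "2 * m \<le> n" "1 \<le> m" "0 < \<gamma>"
  shows "prob (nonpos F) \<le> card F * 2 powr (- \<gamma> * m)"
  using assms(1,2)
proof (induction "card F" arbitrary: F rule: less_induct)
  case less
  have fin: "finite F" using less.prems(1) correct_pairs(2) finite_subset by blast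
  show ?case
  proof (cases "card F < 2 * m")
    case True
    have "{(x, y) \<in> F. \<pi> x < \<pi> y} = F"
      using less.prems(1) by (auto simp: correct_pairs_def)
    then have "prob (nonpos F) < 2 powr (- \<gamma> * card F)"
      using less.prems correct_pairs assms True
      by (intro prob_nonpos_less fin inj_on_subset[OF correct_pairs(3)])
        (auto simp: correct_pairs_def)
    also have "\<dots> \<le> 2 powr (- \<gamma> * m)"
      using less.prems(2) assms(6) by simp
    also have "\<dots> \<le> card F * 2 powr (- \<gamma> * m)"
      using less.prems(2) assms(5) by simp
    finally show ?thesis by simp
  next
    case False
    \<comment> \<open>A nonpositive total forces a nonpositive part. Since at least \<open>m\<close>
      pairs remain, the recursion ends with pieces of size at least \<open>m\<close> and below
      \<open>2 * m \<le> n\<close>, to which condition (a) applies.\<close>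
    obtain G where G: "G \<subseteq> F" "card G = m"
      using obtain_subset_with_card_n[OF less.prems(2)] by metis
    have cd: "card (F - G) = card F - m"
      using G fin by (simp add: card_Diff_subset finite_subset)
    have sub: "nonpos F \<subseteq> nonpos G \<union> nonpos (F - G)"
    proof
      fix s assume s: "s \<in> nonpos F"
      have "(\<Sum>(x, y)\<in>F. llr D s x y) = (\<Sum>(x, y)\<in>F - G. llr D s x y) + (\<Sum>(x, y)\<in>G. llr D s x y)"
        using sum.subset_diff[OF G(1) fin] .
      then show "s \<in> nonpos G \<union> nonpos (F - G)"
        using s unfolding nonpos_def by auto
    qed
    have meas: "nonpos G \<in> sets P" "nonpos (F - G) \<in> sets P"
      using G(1) less.prems(1) correct_pairs(1) by (auto intro!: nonpos_measurable)
    have "prob (nonpos F) \<le> prob (nonpos G \<union> nonpos (F - G))"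
      using sub meas by (intro finite_measure_mono) auto
    also have "\<dots> \<le> prob (nonpos G) + prob (nonpos (F - G))"
      by (rule measure_Un_le[OF meas])
    also have "\<dots> \<le> card G * 2 powr (- \<gamma> * m) + card (F - G) * 2 powr (- \<gamma> * m)"
    proof (intro add_mono less.hyps)
      show "card G < card F" "card (F - G) < card F" using G cd False assms(5) by auto
    qed (use G less.prems(1) cd False in auto)
    also have "\<dots> = card F * 2 powr (- \<gamma> * m)"
      using G cd False by (simp add: of_nat_diff algebra_simps)
    finally show ?thesis .
  qed
qed

end


section \<open>Union bounds\<close>

lemma sum_Pow_power_card:
  fixes y :: real
  assumes "finite Z"
  shows "(\<Sum>Y\<in>Pow Z. y ^ card Y) = (1 + y) ^ card Z"
  using prod_add[OF assms, of "\<lambda>_. y" "\<lambda>_. 1"] by (simp add: add.commute)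

text \<open>With weight \<open>y ^ card Y\<close>, every small subset weighs at least
  \<open>y powr c\<close>, whereas all subsets together weigh
  \<open>(1 + y) ^ card Z\<close>.\<close>

lemma card_small_subsets_le:
  fixes y c :: real
  assumes Z: "finite Z" and y: "0 < y" "y \<le> 1"
  shows "real (card {Y. Y \<subseteq> Z \<and> real (card Y) \<le> c}) \<le> y powr (- c) * (1 + y) ^ card Z"
proof -
  let ?S = "{Y. Y \<subseteq> Z \<and> real (card Y) \<le> c}"
  have "real (card ?S) * y powr c = (\<Sum>Y\<in>?S. y powr c)" by simp
  also have "\<dots> \<le> (\<Sum>Y\<in>?S. y ^ card Y)"
  proof (rule sum_mono)
    fix Y assume "Y \<in> ?S"
    then have "y powr c \<le> y powr real (card Y)" using y by (intro powr_mono') auto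
    then show "y powr c \<le> y ^ card Y" using y by (simp add: powr_realpow)
  qed
  also have "\<dots> \<le> (\<Sum>Y\<in>Pow Z. y ^ card Y)"
    using Z y by (intro sum_mono2) auto
  finally have "real (card ?S) * y powr c \<le> (1 + y) ^ card Z"
    by (simp add: sum_Pow_power_card[OF Z])
  then show ?thesis
    using y by (simp add: powr_minus field_simps)
qed

text \<open>The choice \<open>y = 1 / \<Delta>\<close> in the count of small subsets gives a factor
  exp (4 d ln \<Delta> / \<Delta>) from the size bound and a factor exp (5 d / \<Delta>) from the
  ground set.\<close>

lemma card_near_le:
  assumes Z: "finite Z" "card Z \<le> 5 * d" and \<Delta>: "1 \<le> \<Delta>"
  shows "finite (near I Z \<Delta> d)" "real (card (near I Z \<Delta> d)) \<le> exp (d * ((4 * ln \<Delta> + 5) / \<Delta>))"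
proof -
  let ?S = "{Y. Y \<subseteq> Z \<and> real (card Y) \<le> 4 * d / \<Delta>}"
  have fin: "finite ?S" using Z(1) by (rule_tac finite_subset[of _ "Pow Z"]) auto
  have sub: "near I Z \<Delta> d \<subseteq> (\<lambda>Y. (I - Y) \<union> (Y - I)) ` ?S"
  proof
    fix J assume "J \<in> near I Z \<Delta> d"
    then obtain Y where Y: "J = (I - Y) \<union> (Y - I)" "Y \<subseteq> Z" "\<Delta> * card Y \<le> 4 * d"
      unfolding near_def by blast
    have "real \<Delta> * real (card Y) \<le> 4 * real d" using Y(3) by (metis of_nat_le_iff of_nat_mult of_nat_numeral)
    then have "real (card Y) \<le> 4 * d / \<Delta>" using \<Delta> by (simp add: field_simps)
    then show "J \<in> (\<lambda>Y. (I - Y) \<union> (Y - I)) ` ?S" using Y by blast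
  qed
  then show "finite (near I Z \<Delta> d)" using fin finite_subset by blast
  have "card (near I Z \<Delta> d) \<le> card ?S"
    using surj_card_le[OF fin sub] .
  then have "real (card (near I Z \<Delta> d)) \<le> real (card ?S)" by simp
  also have "\<dots> \<le> (1 / \<Delta>) powr (- (4 * d / \<Delta>)) * (1 + 1 / \<Delta>) ^ card Z"
    using \<Delta> by (intro card_small_subsets_le Z) auto
  also have "\<dots> \<le> exp (4 * d / \<Delta> * ln \<Delta>) * exp (1 / \<Delta>) ^ (5 * d)"
  proof (intro mult_mono)
    show "(1 / \<Delta>) powr (- (4 * d / \<Delta>)) \<le> exp (4 * d / \<Delta> * ln \<Delta>)"
      using \<Delta> by (simp add: powr_def ln_div)
    have "(1 + 1 / \<Delta>) ^ card Z \<le> exp (1 / \<Delta>) ^ card Z"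
      by (intro power_mono exp_ge_add_one_self) auto
    also have "\<dots> \<le> exp (1 / \<Delta>) ^ (5 * d)"
      using Z(2) by (intro power_increasing) auto
    finally show "(1 + 1 / \<Delta>) ^ card Z \<le> exp (1 / \<Delta>) ^ (5 * d)" .
  qed auto
  also have "\<dots> = exp (d * ((4 * ln \<Delta> + 5) / \<Delta>))"
    by (simp add: exp_of_nat_mult[symmetric] exp_add[symmetric] field_simps add_divide_distrib)
  finally show "real (card (near I Z \<Delta> d)) \<le> exp (d * ((4 * ln \<Delta> + 5) / \<Delta>))" .
qed

lemma card_zone_le:
  assumes "\<rho> permutes {..<k}"
  shows "card (zone k \<rho> i d) \<le> 4 * d + 1"
proof -
  have "card (zone k \<rho> i d) = card (\<rho> ` zone k \<rho> i d)"
    using permutes_inj_on[OF assms] by (simp add: card_image)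
  also have "\<dots> \<le> card {\<rho> i - 2 * d..\<rho> i + 2 * d}"
    by (rule card_mono) (auto simp: zone_def)
  finally show ?thesis by simp
qed

lemma sum_powers_le:
  assumes "2 \<le> (n::nat)"
  shows "(\<Sum>i\<le>w. n ^ i) \<le> n ^ (w + 1)"
proof (induction w)
  case (Suc w)
  have "(\<Sum>i\<le>Suc w. n ^ i) \<le> n ^ (w + 1) + n ^ (w + 1)" using Suc by simp
  also have "\<dots> = 2 * n ^ (w + 1)" by simp
  also have "\<dots> \<le> n * n ^ (w + 1)" using assms by (rule mult_right_mono) simp
  finally show ?case by simp
qed (use assms in simp)

context noisy_signals
begin

lemma inverted_subset: "set xs \<subseteq> {..<n} \<Longrightarrow> inverted \<pi> xs \<subseteq> correct_pairs"
  unfolding inverted_def correct_pairs_def by (force simp: subset_iff)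

lemma card_correct_pairs_le: "F \<subseteq> correct_pairs \<Longrightarrow> card F \<le> n ^ 2"
  using card_mono[of "{..<n} \<times> {..<n}" F] correct_pairs(1)
  by (auto simp: power2_eq_square card_cartesian_product)

text \<open>There are at most \<open>n ^ (w + 1)\<close> lists, and splitting the inverted pairs of
  one list into pieces of size at least \<open>m0\<close> costs a further factor of at most
  \<open>n ^ 2\<close>.\<close>

lemma prob_bad_window:
  assumes n: "2 \<le> n" and m: "m0 \<le> m" "log 2 n / \<gamma> < m0" "2 * m0 \<le> n" "1 \<le> m0" "0 < \<gamma>"
  shows "\<exists>E\<in>sets P. prob E \<le> n ^ (w + 3) * 2 powr (- \<gamma> * m0) \<and>
    (\<forall>s\<in>space P - E. \<not> bad_window n w m \<pi> (llr D s))"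
proof -
  define L where "L = {xs. set xs \<subseteq> {..<n} \<and> length xs \<le> w}"
  define L' where "L' = {xs \<in> L. m \<le> card (inverted \<pi> xs)}"
  have finL: "finite L" unfolding L_def by (rule finite_lists_length_le) simp
  have "card L = (\<Sum>i\<le>w. n ^ i)"
    unfolding L_def using card_lists_length_le[of "{..<n}" w] by simp
  then have cardL: "card L \<le> n ^ (w + 1)" using sum_powers_le[OF n] by simp
  define E where "E = (\<Union>xs\<in>L'. nonpos (inverted \<pi> xs))"
  have fin: "finite L'" using finL by (simp add: L'_def)
  have sub: "inverted \<pi> xs \<subseteq> correct_pairs" if "xs \<in> L'" for xs
    using that inverted_subset by (simp add: L'_def L_def)
  have meas: "nonpos (inverted \<pi> xs) \<in> sets P" if "xs \<in> L'" for xs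
    using sub[OF that] correct_pairs(1) by (intro nonpos_measurable) auto
  have each: "prob (nonpos (inverted \<pi> xs)) \<le> real (n ^ 2) * 2 powr (- \<gamma> * m0)" if xs: "xs \<in> L'" for xs
  proof -
    have "prob (nonpos (inverted \<pi> xs)) \<le> card (inverted \<pi> xs) * 2 powr (- \<gamma> * m0)"
      using xs m by (intro prob_nonpos_correct sub) (auto simp: L'_def)
    also have "\<dots> \<le> real (n ^ 2) * 2 powr (- \<gamma> * m0)"
      using card_correct_pairs_le[OF sub[OF xs]] by (intro mult_right_mono) (simp_all only: of_nat_le_iff powr_ge_zero)
    finally show ?thesis .
  qed
  have "prob E \<le> (\<Sum>xs\<in>L'. prob (nonpos (inverted \<pi> xs)))"
    unfolding E_def using fin meas by (intro finite_measure_subadditive_finite) auto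
  also have "\<dots> \<le> (\<Sum>xs\<in>L'. real (n ^ 2) * 2 powr (- \<gamma> * m0))"
    by (rule sum_mono[OF each])
  also have "\<dots> = real (card L') * (real (n ^ 2) * 2 powr (- \<gamma> * m0))" by simp
  also have "\<dots> \<le> real (n ^ (w + 1)) * (real (n ^ 2) * 2 powr (- \<gamma> * m0))"
  proof (intro mult_right_mono)
    have "card L' \<le> card L" using finL by (intro card_mono) (auto simp: L'_def)
    then show "real (card L') \<le> real (n ^ (w + 1))" using cardL by (simp only: of_nat_le_iff)
  qed simp
  also have "\<dots> = n ^ (w + 3) * 2 powr (- \<gamma> * m0)"
    by (simp add: power_add power2_eq_square power3_eq_cube)
  finally have "prob E \<le> n ^ (w + 3) * 2 powr (- \<gamma> * m0)" .
  moreover have "E \<in> sets P" unfolding E_def using fin meas by auto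
  moreover have "\<not> bad_window n w m \<pi> (llr D s)" if "s \<in> space P - E" for s
  proof
    assume "bad_window n w m \<pi> (llr D s)"
    then obtain xs where "set xs \<subseteq> {..<n}" "length xs \<le> w" "m \<le> card (inverted \<pi> xs)"
      "(\<Sum>(x, y)\<in>inverted \<pi> xs. llr D s x y) \<le> 0" unfolding bad_window_def by blast
    then have "xs \<in> L'" "s \<in> nonpos (inverted \<pi> xs)"
      using that by (auto simp: L'_def L_def nonpos_def)
    then show False using that by (auto simp: E_def)
  qed
  ultimately show ?thesis by blast
qed

lemma inj_on_\<pi>: "inj_on \<pi> {..<n}"
  using permutes_inj_on[OF perm] .

lemma \<pi>_less: "i < n \<Longrightarrow> \<pi> i < n"
  using permutes_in_image[OF perm, of i] by simp

text \<open>All pairs share the item \<open>i\<close>, so there are only \<open>d \<le> n\<close> of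
  them and condition (a) applies without splitting.\<close>

lemma prob_star_le:
  assumes k: "k \<le> n" "i < k" "d \<le> n" "log 2 n / \<gamma> < d" and J: "J \<subseteq> {..<k} - {i}" "card J = d"
  shows "2 * d \<le> 3 * card {j \<in> J. \<pi> i < \<pi> j} \<Longrightarrow> prob (nonpos ({i} \<times> J)) \<le> 2 powr (- \<gamma> * d)"
    "2 * d \<le> 3 * card {j \<in> J. \<pi> j < \<pi> i} \<Longrightarrow> prob (nonpos (J \<times> {i})) \<le> 2 powr (- \<gamma> * d)"
    "nonpos ({i} \<times> J) \<in> sets P" "nonpos (J \<times> {i}) \<in> sets P"
proof -
  have fin: "finite J" using J(1) finite_subset by blast
  have sub: "{i} \<times> J \<subseteq> {..<n} \<times> {..<n}" "J \<times> {i} \<subseteq> {..<n} \<times> {..<n}"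
    using J(1) k by auto
  show "nonpos ({i} \<times> J) \<in> sets P" "nonpos (J \<times> {i}) \<in> sets P"
    using sub nonpos_measurable by blast+
  have inj: "inj_on (\<lambda>(x, y). upair x y) ({i} \<times> J)" "inj_on (\<lambda>(x, y). upair x y) (J \<times> {i})"
    using J(1) by (auto simp: inj_on_def upair_def min_def max_def split: if_splits)
  have c: "card ({i} \<times> J) = d" "card (J \<times> {i}) = d" using J(2) by (simp_all add: card_cartesian_product)
  {
    assume m: "2 * d \<le> 3 * card {j \<in> J. \<pi> i < \<pi> j}"
    have "{(x, y) \<in> {i} \<times> J. \<pi> x < \<pi> y} = {i} \<times> {j \<in> J. \<pi> i < \<pi> j}" by auto
    then have "2 * card ({i} \<times> J) \<le> 3 * card {(x, y) \<in> {i} \<times> J. \<pi> x < \<pi> y}"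
      using m J(2) by (simp add: card_cartesian_product)
    then have "prob (nonpos ({i} \<times> J)) < 2 powr (- \<gamma> * card ({i} \<times> J))"
    proof (rule prob_nonpos_less[rotated -1])
      show "finite ({i} \<times> J)" using fin by simp
      show "log 2 n / \<gamma> < card ({i} \<times> J)" "card ({i} \<times> J) \<le> n" using k(3,4) unfolding c by simp_all
      show "x \<noteq> y" if "(x, y) \<in> {i} \<times> J" for x y using that J(1) by auto
    qed (use sub inj in simp_all)
    then show "prob (nonpos ({i} \<times> J)) \<le> 2 powr (- \<gamma> * d)" by (simp add: c)
  }
  {
    assume m: "2 * d \<le> 3 * card {j \<in> J. \<pi> j < \<pi> i}"
    have "{(x, y) \<in> J \<times> {i}. \<pi> x < \<pi> y} = {j \<in> J. \<pi> j < \<pi> i} \<times> {i}" by auto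
    then have "2 * card (J \<times> {i}) \<le> 3 * card {(x, y) \<in> J \<times> {i}. \<pi> x < \<pi> y}"
      using m J(2) by (simp add: card_cartesian_product)
    then have "prob (nonpos (J \<times> {i})) < 2 powr (- \<gamma> * card (J \<times> {i}))"
    proof (rule prob_nonpos_less[rotated -1])
      show "finite (J \<times> {i})" using fin by simp
      show "log 2 n / \<gamma> < card (J \<times> {i})" "card (J \<times> {i}) \<le> n" using k(3,4) unfolding c by simp_all
      show "x \<noteq> y" if "(x, y) \<in> J \<times> {i}" for x y using that J(1) by auto
    qed (use sub inj in simp_all)
    then show "prob (nonpos (J \<times> {i})) \<le> 2 powr (- \<gamma> * d)" by (simp add: c)
  }
qed

text \<open>For fixed \<open>k\<close>, \<open>i\<close> and \<open>d\<close>, the condition on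
  \<open>\<Delta>\<close> admits at most 2 to the power \<gamma> d / 2 sets in each direction. This
  uses up half the exponent of condition (a); the other half pays for the at most
  \<open>(n + 1) ^ 3\<close> triples.\<close>

lemma prob_bad_move:
  assumes D0: "1 \<le> D0" "log 2 n / \<gamma> < D0" and \<gamma>: "0 < \<gamma>" and \<Delta>: "1 \<le> \<Delta>" "(4 * ln \<Delta> + 5) / \<Delta> \<le> \<gamma> * ln 2 / 2"
  shows "\<exists>E\<in>sets P. prob E \<le> 2 * (n + 1) ^ 3 * 2 powr (- \<gamma> * D0 / 2) \<and>
    (\<forall>s\<in>space P - E. \<not> bad_move n D0 \<Delta> \<pi> (llr D s))"
proof -
  define T where "T = {(k, i, d). k \<le> n \<and> i < k \<and> D0 \<le> d \<and> d \<le> n}"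
  have Tsub: "T \<subseteq> {..n} \<times> {..n} \<times> {..n}" by (auto simp: T_def)
  have finT: "finite T" by (rule finite_subset[OF Tsub]) simp
  have cardT: "card T \<le> (n + 1) ^ 3"
  proof -
    have "card T \<le> card ({..n} \<times> {..n} \<times> {..n})" by (rule card_mono[OF _ Tsub]) simp
    also have "\<dots> = (n + 1) ^ 3"
      unfolding card_cartesian_product card_atMost power3_eq_cube by (simp only: Suc_eq_plus1 mult.assoc)
    finally show ?thesis .
  qed
  define U where "U = (\<lambda>(k, i, d). {J \<in> near (above k (rank k \<pi>) i d) (zone k (rank k \<pi>) i d) \<Delta> d.
    J \<subseteq> {..<k} - {i} \<and> card J = d \<and> 2 * d \<le> 3 * card {j \<in> J. \<pi> i < \<pi> j}})"
  define V where "V = (\<lambda>(k, i, d). {J \<in> near (below k (rank k \<pi>) i d) (zone k (rank k \<pi>) i d) \<Delta> d.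
    J \<subseteq> {..<k} - {i} \<and> card J = d \<and> 2 * d \<le> 3 * card {j \<in> J. \<pi> j < \<pi> i}})"
  define E where "E = (\<lambda>t. (\<Union>J\<in>U t. nonpos ({fst (snd t)} \<times> J)) \<union> (\<Union>J\<in>V t. nonpos (J \<times> {fst (snd t)})))"
  have Et: "E t \<in> sets P \<and> prob (E t) \<le> 2 * 2 powr (- \<gamma> * D0 / 2)" if t_in: "t \<in> T" for t
  proof -
    obtain k i d where t: "t = (k, i, d)" "k \<le> n" "i < k" "D0 \<le> d" "d \<le> n" using t_in by (cases t) (auto simp: T_def)
    have logd: "log 2 n / \<gamma> < d" using D0(2) t(4) by linarith
    note star = prob_star_le[OF t(2,3,5) logd]
    have "inj_on \<pi> {..<k}" using inj_on_\<pi> by (rule inj_on_subset) (use t in auto)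
    then have cz: "card (zone k (rank k \<pi>) i d) \<le> 5 * d"
      using card_zone_le[OF rank_permutes, of \<pi> k i d] D0(1) t(4) by simp
    have fz: "finite (zone k (rank k \<pi>) i d)" by (simp add: zone_def)
    have cn: "finite (near I (zone k (rank k \<pi>) i d) \<Delta> d)"
      "real (card (near I (zone k (rank k \<pi>) i d) \<Delta> d)) \<le> 2 powr (\<gamma> * d / 2)" for I
    proof -
      show "finite (near I (zone k (rank k \<pi>) i d) \<Delta> d)" by (rule card_near_le(1)[OF fz cz \<Delta>(1)])
      have "real (card (near I (zone k (rank k \<pi>) i d) \<Delta> d)) \<le> exp (d * ((4 * ln \<Delta> + 5) / \<Delta>))"
        by (rule card_near_le(2)[OF fz cz \<Delta>(1)])
      also have "\<dots> \<le> exp (d * (\<gamma> * ln 2 / 2))"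
        unfolding exp_le_cancel_iff by (rule mult_left_mono[OF \<Delta>(2)]) simp
      also have "\<dots> = 2 powr (\<gamma> * d / 2)" by (simp add: powr_def mult_ac)
      finally show "real (card (near I (zone k (rank k \<pi>) i d) \<Delta> d)) \<le> 2 powr (\<gamma> * d / 2)" .
    qed
    have cU: "finite (U t)" "real (card (U t)) \<le> 2 powr (\<gamma> * d / 2)"
      and cV: "finite (V t)" "real (card (V t)) \<le> 2 powr (\<gamma> * d / 2)"
    proof -
      let ?a = "near (above k (rank k \<pi>) i d) (zone k (rank k \<pi>) i d) \<Delta> d"
      let ?b = "near (below k (rank k \<pi>) i d) (zone k (rank k \<pi>) i d) \<Delta> d"
      have sub: "U t \<subseteq> ?a" "V t \<subseteq> ?b" unfolding U_def V_def t(1) by auto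
      show "finite (U t)" "finite (V t)" using sub cn(1) finite_subset by blast+
      have "card (U t) \<le> card ?a" "card (V t) \<le> card ?b" using card_mono[OF cn(1)] sub by blast+
      then show "real (card (U t)) \<le> 2 powr (\<gamma> * d / 2)" "real (card (V t)) \<le> 2 powr (\<gamma> * d / 2)"
        using cn(2) by (meson of_nat_mono order_trans)+
    qed
    have fs: "fst (snd t) = i" by (simp add: t)
    have half: "2 powr (\<gamma> * d / 2) * 2 powr (- \<gamma> * d) \<le> 2 powr (- \<gamma> * D0 / 2)"
    proof -
      have "\<gamma> * D0 \<le> \<gamma> * d" using t(4) \<gamma> by simp
      then show ?thesis by (simp add: powr_add[symmetric])
    qed
    have mU: "nonpos ({i} \<times> J) \<in> sets P" "prob (nonpos ({i} \<times> J)) \<le> 2 powr (- \<gamma> * d)" if "J \<in> U t" for J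
      using that star(1,3)[of J] unfolding U_def t(1) by auto
    have mV: "nonpos (J \<times> {i}) \<in> sets P" "prob (nonpos (J \<times> {i})) \<le> 2 powr (- \<gamma> * d)" if "J \<in> V t" for J
      using that star(2,4)[of J] unfolding V_def t(1) by auto
    have "prob (\<Union>J\<in>U t. nonpos ({i} \<times> J)) \<le> (\<Sum>J\<in>U t. prob (nonpos ({i} \<times> J)))"
      using cU(1) mU by (intro finite_measure_subadditive_finite) auto
    also have "\<dots> \<le> (\<Sum>J\<in>U t. 2 powr (- \<gamma> * d))" by (rule sum_mono[OF mU(2)])
    also have "\<dots> \<le> 2 powr (\<gamma> * d / 2) * 2 powr (- \<gamma> * d)" using cU(2) by simp
    finally have pU: "prob (\<Union>J\<in>U t. nonpos ({i} \<times> J)) \<le> 2 powr (- \<gamma> * D0 / 2)" using half by linarith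
    have "prob (\<Union>J\<in>V t. nonpos (J \<times> {i})) \<le> (\<Sum>J\<in>V t. prob (nonpos (J \<times> {i})))"
      using cV(1) mV by (intro finite_measure_subadditive_finite) auto
    also have "\<dots> \<le> (\<Sum>J\<in>V t. 2 powr (- \<gamma> * d))" by (rule sum_mono[OF mV(2)])
    also have "\<dots> \<le> 2 powr (\<gamma> * d / 2) * 2 powr (- \<gamma> * d)" using cV(2) by simp
    finally have pV: "prob (\<Union>J\<in>V t. nonpos (J \<times> {i})) \<le> 2 powr (- \<gamma> * D0 / 2)" using half by linarith
    have meas: "(\<Union>J\<in>U t. nonpos ({i} \<times> J)) \<in> sets P" "(\<Union>J\<in>V t. nonpos (J \<times> {i})) \<in> sets P"
      using cU(1) cV(1) mU(1) mV(1) by auto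
    then show ?thesis
      using measure_Un_le[OF meas] pU pV unfolding E_def fs by auto
  qed
  have "prob (\<Union>t\<in>T. E t) \<le> (\<Sum>t\<in>T. prob (E t))"
    using finT Et by (intro finite_measure_subadditive_finite) auto
  also have "\<dots> \<le> (\<Sum>t\<in>T. 2 * 2 powr (- \<gamma> * D0 / 2))" using Et by (intro sum_mono) blast
  also have "\<dots> = card T * (2 * 2 powr (- \<gamma> * D0 / 2))" by simp
  also have "\<dots> \<le> real ((n + 1) ^ 3) * (2 * 2 powr (- \<gamma> * D0 / 2))"
    using cardT by (intro mult_right_mono) (simp_all only: of_nat_le_iff, simp)
  finally have "prob (\<Union>t\<in>T. E t) \<le> 2 * (n + 1) ^ 3 * 2 powr (- \<gamma> * D0 / 2)" by (simp add: mult_ac)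
  moreover have "(\<Union>t\<in>T. E t) \<in> sets P" using finT Et by auto
  moreover have "\<not> bad_move n D0 \<Delta> \<pi> (llr D s)" if s: "s \<in> space P - (\<Union>t\<in>T. E t)" for s
  proof
    assume "bad_move n D0 \<Delta> \<pi> (llr D s)"
    then obtain k i d J where b: "k \<le> n" "i < k" "D0 \<le> d" "d \<le> n"
      "bad_up \<pi> (llr D s) \<Delta> k i d J \<or> bad_down \<pi> (llr D s) \<Delta> k i d J"
      unfolding bad_move_def by blast
    have t: "(k, i, d) \<in> T" using b by (simp add: T_def)
    from b(5) have "s \<in> E (k, i, d)"
    proof
      assume u: "bad_up \<pi> (llr D s) \<Delta> k i d J"
      then have "J \<in> U (k, i, d)" by (simp add: bad_up_def U_def)
      moreover have "s \<in> nonpos ({i} \<times> J)"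
        using u s by (simp add: nonpos_def bad_up_def sum.cartesian_product[symmetric])
      ultimately show ?thesis unfolding E_def by auto
    next
      assume u: "bad_down \<pi> (llr D s) \<Delta> k i d J"
      then have "J \<in> V (k, i, d)" by (simp add: bad_down_def V_def)
      moreover have "s \<in> nonpos (J \<times> {i})"
        using u s by (simp add: nonpos_def bad_down_def sum.cartesian_product[symmetric])
      ultimately show ?thesis unfolding E_def by auto
    qed
    then show False using s t by blast
  qed
  ultimately show ?thesis by blast
qed

end


section \<open>Successive insertion yields an optimal order\<close>

text \<open>The inverse of an order, extended by the identity: the dynamic program works with items
  indexed by positions, \<open>score\<close> with positions indexed by items.\<close>

definition position :: "nat \<Rightarrow> (nat \<Rightarrow> nat) \<Rightarrow> nat \<Rightarrow> nat" where
  "position K w i = (if i < K then inv_into {..<K} w i else i)"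

lemma position:
  assumes "bij_betw w {..<K} {..<K}"
  shows "position K w permutes {..<K}" "\<And>p. p < K \<Longrightarrow> position K w (w p) = p"
    "\<And>i. i < K \<Longrightarrow> w (position K w i) = i" "\<And>i. i < K \<Longrightarrow> position K w i < K"
proof -
  have "bij_betw (position K w) {..<K} {..<K}"
    using bij_betw_inv_into[OF assms] by (rule bij_betw_cong[THEN iffD1, rotated]) (simp add: position_def)
  then show p: "position K w permutes {..<K}"
    by (rule bij_imp_permutes) (simp add: position_def)
  show "position K w (w p) = p" if "p < K" for p
    using assms that bij_betwE[OF assms] by (simp add: position_def bij_betw_def inv_into_f_f)
  show "w (position K w i) = i" if "i < K" for i
    using assms that by (simp add: position_def bij_betw_def f_inv_into_f)
  show "position K w i < K" if "i < K" for i
    using permutes_in_image[OF p, of i] that by simp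
qed

lemma order_total_eq_score:
  assumes w: "bij_betw w {..<K} {..<K}"
  shows "order_total q K w = score K q (position K w) + (\<Sum>i<K. q i i)"
proof -
  have inj: "inj_on w {..<K}" and im: "w ` {..<K} = {..<K}" using w by (auto simp: bij_betw_def)
  have split: "{a..<K} = insert a {a<..<K}" if "a < K" for a using that by auto
  have "order_total q K w = (\<Sum>a<K. q (w a) (w a) + (\<Sum>b\<in>{a<..<K}. q (w a) (w b)))"
    unfolding order_total_def by (rule sum.cong) (simp_all add: split)
  also have "\<dots> = (\<Sum>a<K. q (w a) (w a)) + (\<Sum>a<K. \<Sum>b\<in>{a<..<K}. q (w a) (w b))"
    by (rule sum.distrib)
  also have "(\<Sum>a<K. q (w a) (w a)) = (\<Sum>i<K. q i i)"
    using sum.reindex_bij_betw[OF w, of "\<lambda>i. q i i"] by simp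
  also have "(\<Sum>a<K. \<Sum>b\<in>{a<..<K}. q (w a) (w b)) = (\<Sum>(a, b)\<in>Sigma {..<K} (\<lambda>a. {a<..<K}). q (w a) (w b))"
    by (rule sum.Sigma) auto
  also have "\<dots> = score K q (position K w)"
    unfolding score_def
  proof (rule sum.reindex_bij_witness[where i = "\<lambda>(i, j). (position K w i, position K w j)"
        and j = "\<lambda>(a, b). (w a, w b)"], goal_cases)
    case (2 p)
    then show ?case using im by (auto simp: position(2)[OF w])
  qed (auto simp: position(2-4)[OF w])
  finally show ?thesis by simp
qed

lemma optimal_order_exists: "\<exists>\<sigma>. optimal_order k q \<sigma>"
proof -
  let ?S = "{\<tau>. \<tau> permutes {..<k}}"
  have fin: "finite (score k q ` ?S)" by (simp add: finite_permutations)
  moreover have "score k q ` ?S \<noteq> {}" using permutes_id by blast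
  ultimately have "Max (score k q ` ?S) \<in> score k q ` ?S" by (rule Max_in)
  then obtain \<sigma> where "\<sigma> permutes {..<k}" "score k q \<sigma> = Max (score k q ` ?S)" by auto
  moreover have "score k q \<tau> \<le> Max (score k q ` ?S)" if "\<tau> permutes {..<k}" for \<tau>
    using fin that by (intro Max_ge) auto
  ultimately show ?thesis
    unfolding optimal_order_def is_arg_max_def by (metis not_less)
qed

lemma rank_Suc: "i < k \<Longrightarrow> rank (Suc k) \<pi> i = rank k \<pi> i + (if \<pi> k < \<pi> i then 1 else 0)"
proof -
  assume i: "i < k"
  have "{j. j < Suc k \<and> \<pi> j < \<pi> i} = (if \<pi> k < \<pi> i then insert k else id) {j. j < k \<and> \<pi> j < \<pi> i}"
    by (auto simp: less_Suc_eq)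
  then show ?thesis using i by (simp add: rank_def)
qed

text \<open>If all optimal orders are close to the true one, then passing from an optimal order of the
  first \<open>k\<close> items to one of the first \<open>k + 1\<close> never interchanges two items that were far apart.\<close>

lemma dp_chain_optimal:
  assumes disp: "\<And>k \<sigma> i. k \<le> n \<Longrightarrow> optimal_order k q \<sigma> \<Longrightarrow> i < k \<Longrightarrow>
      \<sigma> i < rank k \<pi> i + D \<and> rank k \<pi> i < \<sigma> i + D"
    and W: "4 * D \<le> W" and chain: "\<And>k. k < n \<Longrightarrow> dp_step q W k (x k) (x (Suc k))"
    and j: "j \<le> n"
  shows "bij_betw (x j) {..<j} {..<j} \<and> optimal_order j q (position j (x j))"
  using j
proof (induction j)
  case 0
  have "\<tau> = id" if "\<tau> permutes {..<0}" for \<tau> :: "nat \<Rightarrow> nat" using that by simp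
  moreover have "position 0 (x 0) = id" by (auto simp: position_def)
  moreover have "id permutes {..<0::nat}" by (rule permutes_id)
  ultimately show ?case
    unfolding optimal_order_def is_arg_max_def bij_betw_def by (auto simp del: permutes_empty)
next
  case (Suc k)
  then have kn: "k < n" and IH: "bij_betw (x k) {..<k} {..<k}" "optimal_order k q (position k (x k))" by auto
  note step = chain[OF kn, unfolded dp_step_def]
  obtain \<sigma> where \<sigma>: "optimal_order (Suc k) q \<sigma>" using optimal_order_exists by blast
  then have perm: "\<sigma> permutes {..<Suc k}" by (simp add: optimal_order_def is_arg_max_def)
  define w where "w = inv \<sigma>"
  have w: "bij_betw w {..<Suc k} {..<Suc k}"
    unfolding w_def by (rule permutes_imp_bij[OF permutes_inv[OF perm]])
  have w\<sigma>: "\<sigma> (w p) = p" "w (\<sigma> p) = p" for p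
    unfolding w_def using permutes_inverses[OF perm] by auto
  have wo: "window_order W k (x k) w"
    unfolding window_order_def
  proof (intro allI impI, rule ccontr)
    fix i j a b
    assume *: "i < k" "j < k" "a < b" "b \<le> k" "w a = x k j" "w b = x k i" "\<not> j \<le> i + W"
    have lt: "w a < k" "w b < k" using * bij_betwE[OF IH(1)] by auto
    have pos: "position k (x k) (w a) = j" "position k (x k) (w b) = i"
      using * position(2)[OF IH(1)] by auto
    note d = disp[of k, OF _ IH(2)] disp[of "Suc k", OF _ \<sigma>]
    have 1: "j < rank k \<pi> (w a) + D" "rank k \<pi> (w b) < i + D"
      using d(1)[of "w a"] d(1)[of "w b"] kn lt pos by auto
    have 2: "rank (Suc k) \<pi> (w a) < a + D" "b < rank (Suc k) \<pi> (w b) + D"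
      using d(2)[of "w a"] d(2)[of "w b"] kn lt w\<sigma>(1) by auto
    \<comment> \<open>More than \<open>4 * D\<close> positions apart in \<open>x k\<close>, the two
      items have ranks more than \<open>2 * D\<close> apart in the same direction. The inserted item
      cannot shrink this difference, as it shifts the higher rank whenever it shifts the lower one.
      But \<open>a < b\<close> allows a difference below \<open>2 * D\<close> only.\<close>
    have "rank k \<pi> (w b) < rank k \<pi> (w a)" using 1 *(7) W by linarith
    then have "\<pi> (w b) < \<pi> (w a)" using rank_less_iff[OF lt(2,1)] by blast
    then have "rank k \<pi> (w a) + rank (Suc k) \<pi> (w b) \<le> rank (Suc k) \<pi> (w a) + rank k \<pi> (w b)"
      using rank_Suc[OF lt(1)] rank_Suc[OF lt(2)] by simp
    then show False using 1 2 *(3,7) W by linarith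
  qed
  have bij: "bij_betw (x (Suc k)) {..<Suc k} {..<Suc k}" using step by blast
  have "position (Suc k) w = \<sigma>"
  proof
    fix i
    show "position (Suc k) w i = \<sigma> i"
    proof (cases "i < Suc k")
      case True
      then have "\<sigma> i < Suc k" using permutes_in_image[OF perm, of i] by simp
      then have "position (Suc k) w (w (\<sigma> i)) = \<sigma> i" by (rule position(2)[OF w])
      then show ?thesis by (simp add: w\<sigma>)
    next
      case False
      then show ?thesis using permutes_not_in[OF perm, of i] by (simp add: position_def)
    qed
  qed
  then have "score (Suc k) q \<sigma> \<le> score (Suc k) q (position (Suc k) (x (Suc k)))"
    using step w wo order_total_eq_score[OF w, of q] order_total_eq_score[OF bij, of q] by auto
  then have "optimal_order (Suc k) q (position (Suc k) (x (Suc k)))"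
    using \<sigma> position(1)[OF bij] unfolding optimal_order_def is_arg_max_def by (meson leD leI order.trans)
  with bij show ?case by blast
qed


section \<open>Displacement with high probability\<close>

lemma bits_bounds:
  assumes "2 \<le> n"
  shows "1 \<le> bits n" "2 ^ (bits n - 1) < n"
proof -
  show 1: "1 \<le> bits n"
    using le_power_bits[of n] assms by (cases "bits n") auto
  show "2 ^ (bits n - 1) < n"
  proof (rule ccontr)
    assume "\<not> 2 ^ (bits n - 1) < n"
    then have "bits n \<le> bits n - 1" by (intro bits_le) simp
    then show False using 1 by simp
  qed
qed

text \<open>The square takes about half of the exponent, so for large \<open>l\<close> the rest of
  \<open>2 ^ (l - 1)\<close> absorbs a constant factor.\<close>

lemma square_le_power:
  assumes "20 \<le> l"
  shows "(l::nat)\<^sup>2 \<le> 2 ^ (l div 2 + 4)"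
proof -
  define u where "u = l div 4"
  have "u < 2 ^ u" by (rule less_exp)
  moreover have "l \<le> 4 * u + 3" unfolding u_def by linarith
  ultimately have "l \<le> 4 * 2 ^ u" by linarith
  then have "l\<^sup>2 \<le> (4 * 2 ^ u)\<^sup>2" by (rule power_mono) simp
  also have "\<dots> = 2 ^ (2 * u + 4)" by (simp add: power_mult_distrib power_add power_even_eq)
  also have "\<dots> \<le> 2 ^ (l div 2 + 4)" unfolding u_def by (intro power_increasing) auto
  finally show ?thesis .
qed

context noisy_signals
begin

text \<open>With \<open>l = bits n\<close> the scales are \<open>h = H * l\<close>,
  \<open>e = C * l\<close> and \<open>d = K * l\<close>. Here \<open>C\<close> lets the inversions
  of a window outweigh the number of lists, the factor \<open>\<Delta>\<close> in \<open>H\<close>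
  makes \<open>e\<close> at most a fraction 1 / \<open>\<Delta>\<close> of \<open>h\<close>, and
  \<open>a\<close> absorbs \<alpha>. The factor \<open>R\<close> in \<open>K\<close> ensures that
  \<open>n > d\<close> leaves enough pairs for condition (a).\<close>

lemma displacement_whp:
  fixes \<Delta> C a b :: nat and \<alpha> :: real
  assumes n: "2 \<le> n" and \<gamma>: "0 < \<gamma>" and \<alpha>: "0 < \<alpha>"
    and \<Delta>: "256 \<le> \<gamma> * \<Delta>" "(4 * ln \<Delta> + 5) / \<Delta> \<le> \<gamma> * ln 2 / 2" "3 \<le> \<Delta>"
    and C: "8 \<le> \<gamma> * C" and a: "\<alpha> + 5 \<le> a"
    and H: "H = C * \<Delta> * a" and b: "17 * C * H \<le> 2 ^ b"
    and R: "R = 2 * b + 20" and K: "K = 6 * \<Delta> * H * R"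
  shows "\<exists>G\<in>sets P. 1 - n powr (- \<alpha>) \<le> prob G \<and>
    (\<forall>s\<in>G. \<forall>k \<sigma> i. k \<le> n \<longrightarrow> optimal_order k (llr D s) \<sigma> \<longrightarrow> i < k \<longrightarrow>
       \<sigma> i < rank k \<pi> i + K * bits n \<and> rank k \<pi> i < \<sigma> i + K * bits n)"
proof (cases "n \<le> K * bits n")
  \<comment> \<open>Displacements are below \<open>k \<le> n\<close>, hence the claim is trivial
    here. In the other case \<open>n > d\<close> is available.\<close>
  case True
  have "\<sigma> i < rank k \<pi> i + K * bits n \<and> rank k \<pi> i < \<sigma> i + K * bits n"
    if "k \<le> n" "optimal_order k q \<sigma>" "i < k" for k q \<sigma> i
  proof -
    have "\<sigma> permutes {..<k}" using that by (simp add: optimal_order_def is_arg_max_def)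
    then have "\<sigma> i < k" using permutes_in_image[of \<sigma> "{..<k}" i] that by simp
    moreover have "inj_on \<pi> {..<k}" using inj_on_\<pi> by (rule inj_on_subset) (use that in auto)
    then have "rank k \<pi> i < k" using permutes_in_image[OF rank_permutes, of \<pi> k i] that by simp
    ultimately show ?thesis using True that by linarith
  qed
  then show ?thesis
    by (intro bexI[of _ "space P"]) (auto simp: prob_space)
next
  case False
  define l where "l = bits n"
  define h where "h = H * l"
  define e where "e = C * l"
  define d where "d = K * l"
  define m where "m = h * (e + 1)"
  \<comment> \<open>Condition (a) speaks of at most \<open>n\<close> pairs; splitting a larger set
    of inversions requires \<open>2 * m0 \<le> n\<close>.\<close>
  define m0 where "m0 = min m (n div 2)"
  have l: "1 \<le> l" "2 ^ (l - 1) < n" "n \<le> 2 ^ l"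
    using bits_bounds[OF n] le_power_bits[of n] by (simp_all add: l_def)
  have dn: "d < n" using False by (simp add: d_def l_def)
  have pos: "1 \<le> C" "1 \<le> \<Delta>" "5 \<le> a"
  proof -
    show "1 \<le> C" using C by (cases C) auto
    show "1 \<le> \<Delta>" using \<Delta>(3) by simp
    show "5 \<le> a" using a \<alpha> by linarith
  qed
  have Ha: "a \<le> H" using pos mult_le_mono[of 1 "C * \<Delta>" a a] by (simp add: H)
  have H1: "1 \<le> H" using Ha pos by linarith
  have hH: "H \<le> h" "h \<le> h * l" using l(1) mult_le_mono2[of 1 l H] mult_le_mono2[of 1 l h] by (simp_all add: h_def)
  have h\<alpha>: "\<alpha> + 5 \<le> h" using a Ha hH by linarith
  have \<Delta>e: "\<Delta> * e \<le> h"
  proof -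
    have "C * \<Delta> * 1 * l \<le> C * \<Delta> * a * l" using pos by (intro mult_le_mono) auto
    then show ?thesis by (simp add: e_def h_def H mult_ac)
  qed
  have eh: "e \<le> h" using \<Delta>e pos(2) mult_le_mono1[of 1 \<Delta> e] by linarith
  have R1: "20 \<le> R" by (simp add: R)
  have big: "6 * \<Delta> * h \<le> d"
  proof -
    have "6 * \<Delta> * H * 1 * l \<le> 6 * \<Delta> * H * R * l" using R1 by (intro mult_le_mono) auto
    then show ?thesis by (simp add: d_def K h_def mult_ac)
  qed
  \<comment> \<open>Because of \<open>\<Delta> * e \<le> h\<close>, the term with the quotient is at
    most half of \<open>x\<close>. The rest is at most \<open>3 * \<Delta> * h\<close>, which is at
    most half of \<open>d\<close>; this is the origin of the 6 in \<open>K\<close>.\<close>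
  have thr: "\<Delta> * (2 * h + e * (x div (2 * h) + 1)) \<le> x" if "d \<le> x" for x
  proof -
    define y where "y = x div (2 * h)"
    have 1: "\<Delta> * e * y \<le> h * y" using \<Delta>e by (rule mult_le_mono1)
    have 2: "2 * (h * y) \<le> x"
      using times_div_less_eq_dividend[of "2 * h" x] by (simp add: y_def mult_ac)
    have "h \<le> \<Delta> * h" using mult_le_mono1[OF pos(2), of h] by (simp only: mult_1)
    moreover have "2 * (p + 2 * r) \<le> x" if "h \<le> r" "p \<le> h" "6 * r \<le> d" for p r
      using that \<open>d \<le> x\<close> by arith
    ultimately have 3: "2 * (\<Delta> * e + 2 * (\<Delta> * h)) \<le> x"
      using \<Delta>e big by (simp only: mult.assoc)
    have "\<Delta> * (2 * h + e * (y + 1)) = \<Delta> * e * y + (\<Delta> * e + 2 * (\<Delta> * h))"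
      by (simp add: algebra_simps)
    moreover have "u + v \<le> x" if "u \<le> w" "2 * w \<le> x" "2 * v \<le> x" for u v w
      using that by arith
    ultimately show ?thesis using 1 2 3 unfolding y_def[symmetric] by presburger
  qed
  \<comment> \<open>The exponent needed for windows: \<open>n ^ (4 * h + 3)\<close> costs
    \<open>(4 * h + 3) * l\<close>, and the remaining \<alpha> l + 1 leaves half of
    \<open>n powr (- \<alpha>)\<close>.\<close>
  have target: "(4 * h + 3 + \<alpha>) * l + 1 \<le> 8 * real h * l"
  proof -
    have "(\<alpha> + 4) * l + 1 * 1 \<le> (\<alpha> + 4) * l + 1 * l" using l(1) by simp
    also have "\<dots> \<le> h * l" using h\<alpha> mult_right_mono[of "\<alpha> + 5" h "real l"] by (simp add: algebra_simps)
    finally have 1: "(\<alpha> + 4) * l + 1 \<le> real h * l" by simp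
    have 2: "(4 * h + 3 + \<alpha>) * l = 4 * (real h * l) + (\<alpha> + 4) * l - l" by (simp add: algebra_simps)
    have "0 \<le> real h * l" by simp
    then show ?thesis using 1 2 by linarith
  qed
  have m1: "8 * real h * l \<le> \<gamma> * m"
  proof -
    have "8 * (real h * l) \<le> \<gamma> * C * (real h * l)" using C by (intro mult_right_mono) auto
    also have "\<dots> \<le> \<gamma> * m" using \<gamma> by (simp add: m_def e_def algebra_simps)
    finally show ?thesis by simp
  qed
  \<comment> \<open>Here \<open>n\<close> has to exceed a multiple of \<open>l\<close> squared. If
    \<open>l \<le> R\<close>, then \<open>n > d\<close> suffices because \<open>d\<close> contains
    the product \<open>R * l\<close>; otherwise \<open>n > 2 ^ (l - 1)\<close> suffices because
    \<open>17 * C * H \<le> 2 ^ b\<close>.\<close>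
  have m2: "8 * real h * l \<le> \<gamma> * (n div 2)"
  proof -
    have "17 * C * H * l\<^sup>2 \<le> n - 1 \<or> 6 * \<Delta> * H * l\<^sup>2 \<le> n - 1"
    proof (cases "l \<le> R")
      case True
      have "6 * \<Delta> * H * (l * l) \<le> 6 * \<Delta> * H * (R * l)" using True by (intro mult_le_mono) auto
      also have "\<dots> = d" by (simp add: d_def K mult_ac)
      finally have "6 * \<Delta> * H * l\<^sup>2 \<le> n - 1" using dn unfolding power2_eq_square by linarith
      then show ?thesis ..
    next
      case False
      then have lb: "2 * b + 20 < l" by (simp add: R)
      have "17 * C * H * l\<^sup>2 \<le> 2 ^ b * 2 ^ (l div 2 + 4)"
        using b square_le_power[of l] lb by (intro mult_le_mono) auto
      also have "\<dots> \<le> 2 ^ (l - 1)"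
        unfolding power_add[symmetric] using lb by (intro power_increasing) linarith+
      finally have "17 * C * H * l\<^sup>2 \<le> n - 1" using l(2) by linarith
      then show ?thesis ..
    qed
    moreover have "16 * (H * (real l)\<^sup>2) \<le> 17 * real C * H * (real l)\<^sup>2 * \<gamma>"
      and "16 * (H * (real l)\<^sup>2) \<le> 6 * real \<Delta> * H * (real l)\<^sup>2 * \<gamma>"
    proof -
      define z where "z = H * (real l)\<^sup>2"
      have z: "0 \<le> z" by (simp add: z_def)
      have "8 * z \<le> \<gamma> * C * z" "256 * z \<le> \<gamma> * \<Delta> * z"
        using mult_right_mono[OF C z] mult_right_mono[OF \<Delta>(1) z] by simp_all
      moreover have "17 * real C * H * (real l)\<^sup>2 * \<gamma> = 17 * (\<gamma> * C * z)"
        "6 * real \<Delta> * H * (real l)\<^sup>2 * \<gamma> = 6 * (\<gamma> * \<Delta> * z)"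
        by (simp_all add: z_def mult_ac)
      ultimately show "16 * (H * (real l)\<^sup>2) \<le> 17 * real C * H * (real l)\<^sup>2 * \<gamma>"
        "16 * (H * (real l)\<^sup>2) \<le> 6 * real \<Delta> * H * (real l)\<^sup>2 * \<gamma>"
        using z unfolding z_def[symmetric] by linarith+
    qed
    ultimately have "16 * (H * (real l)\<^sup>2) \<le> \<gamma> * (n - 1)"
    proof (elim disjE)
      assume *: "17 * C * H * l\<^sup>2 \<le> n - 1" "16 * (H * (real l)\<^sup>2) \<le> 17 * real C * H * (real l)\<^sup>2 * \<gamma>"
      have "16 * (H * (real l)\<^sup>2) \<le> real (17 * C * H * l\<^sup>2) * \<gamma>" using *(2) by simp
      also have "\<dots> \<le> real (n - 1) * \<gamma>"
        using of_nat_mono[OF *(1)] \<gamma> by (rule mult_right_mono[OF _ less_imp_le])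
      finally show ?thesis by (metis mult.commute)
    next
      assume *: "6 * \<Delta> * H * l\<^sup>2 \<le> n - 1" "16 * (H * (real l)\<^sup>2) \<le> 6 * real \<Delta> * H * (real l)\<^sup>2 * \<gamma>"
      have "16 * (H * (real l)\<^sup>2) \<le> real (6 * \<Delta> * H * l\<^sup>2) * \<gamma>" using *(2) by simp
      also have "\<dots> \<le> real (n - 1) * \<gamma>"
        using of_nat_mono[OF *(1)] \<gamma> by (rule mult_right_mono[OF _ less_imp_le])
      finally show ?thesis by (metis mult.commute)
    qed
    moreover have "real (n - 1) \<le> 2 * real (n div 2)" by linarith
    then have "\<gamma> * (n - 1) \<le> \<gamma> * (2 * real (n div 2))" using \<gamma> by (intro mult_left_mono) auto
    moreover have "8 * real h * l = 8 * (H * (real l)\<^sup>2)" by (simp add: h_def power2_eq_square)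
    ultimately show ?thesis by linarith
  qed
  have key: "(4 * h + 3 + \<alpha>) * l + 1 \<le> \<gamma> * m0"
    using target m1 m2 by (simp add: m0_def min_def)
  have nl: "real n \<le> 2 ^ l" using of_nat_mono[OF l(3), where 'a = real] by simp
  have logn: "log 2 n \<le> l"
  proof -
    have "log 2 n \<le> log 2 (2 powr l)"
      using nl n by (subst log_le_cancel_iff) (auto simp: powr_realpow)
    then show ?thesis by simp
  qed
  have l4: "real l \<le> (4 * h + 3 + \<alpha>) * l"
    using mult_right_mono[of 1 "4 * h + 3 + \<alpha>" "real l"] \<alpha> by simp
  have m0: "m0 \<le> m" "log 2 n / \<gamma> < m0" "2 * m0 \<le> n" "1 \<le> m0"
  proof -
    show "m0 \<le> m" "2 * m0 \<le> n" by (auto simp: m0_def)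
    have "log 2 n < \<gamma> * m0" using logn key l4 by linarith
    then show "log 2 n / \<gamma> < m0" using \<gamma> by (simp add: field_simps)
    have "0 < \<gamma> * m0" using key l4 l(1) by linarith
    then show "1 \<le> m0" using \<gamma> by (cases m0) auto
  qed
  \<comment> \<open>The \<open>2 * (n + 1) ^ 3\<close> bad moves cost at most
    \<open>4 + 3 * l\<close> in the exponent; as \<open>l \<ge> 1\<close>, the surplus leaves at
    least \<alpha> l + 1.\<close>
  have keyd: "(\<alpha> + 8) * l \<le> \<gamma> * d / 2"
  proof -
    have "\<alpha> + 8 \<le> 2 * real H" using a Ha \<alpha> by linarith
    then have "(\<alpha> + 8) * l \<le> 2 * (real H * l)"
      using mult_right_mono[of "\<alpha> + 8" "2 * H" "real l"] by simp
    also have "\<dots> \<le> 256 * (3 * real H * R * l)"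
    proof -
      have "real H * l * 1 \<le> real H * l * R" using R1 by (intro mult_left_mono) auto
      moreover have "0 \<le> real H * l" by simp
      ultimately have "2 * (real H * l) \<le> 768 * (real H * l * R)" by linarith
      then show ?thesis by (simp add: mult_ac)
    qed
    also have "\<dots> \<le> \<gamma> * \<Delta> * (3 * real H * R * l)" using \<Delta>(1) by (intro mult_right_mono) auto
    also have "\<dots> = \<gamma> * d / 2" by (simp add: d_def K)
    finally show ?thesis .
  qed
  have d1: "1 \<le> d" "log 2 n / \<gamma> < d"
  proof -
    have "(\<alpha> + 8) * l * 2 = 2 * (\<alpha> * l) + 16 * l" "0 \<le> \<alpha> * l"
      using \<alpha> by (simp_all add: algebra_simps)
    then have "real l < (\<alpha> + 8) * l * 2" using l(1) by linarith
    then have "log 2 n < \<gamma> * d" using logn keyd by linarith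
    then show "log 2 n / \<gamma> < d" using \<gamma> by (simp add: field_simps)
    have "0 < 6 * \<Delta> * h" using pos H1 l(1) by (simp add: h_def)
    then show "1 \<le> d" using big by linarith
  qed
  obtain E1 where E1: "E1 \<in> sets P" "prob E1 \<le> n ^ (4 * h + 3) * 2 powr (- \<gamma> * m0)"
    "\<forall>s\<in>space P - E1. \<not> bad_window n (4 * h) m \<pi> (llr D s)"
    using prob_bad_window[OF n m0 \<gamma>, of "4 * h"] by blast
  obtain E2 where E2: "E2 \<in> sets P" "prob E2 \<le> 2 * (n + 1) ^ 3 * 2 powr (- \<gamma> * d / 2)"
    "\<forall>s\<in>space P - E2. \<not> bad_move n d \<Delta> \<pi> (llr D s)"
    using prob_bad_move[OF d1 \<gamma> pos(2) \<Delta>(2)] by blast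
  have n2: "real n \<le> 2 powr l" using nl by (simp add: powr_realpow)
  have n\<alpha>: "2 powr (- (\<alpha> * l)) \<le> n powr (- \<alpha>)"
  proof -
    have "n powr \<alpha> \<le> (2 powr l) powr \<alpha>" using n2 \<alpha> by (intro powr_mono2) auto
    then show ?thesis using n by (simp add: powr_powr powr_minus field_simps mult.commute)
  qed
  have half: "2 powr (- (\<alpha> * l) - 1) = 2 powr (- (\<alpha> * l)) / 2" by (simp add: powr_diff)
  have p1: "prob E1 \<le> n powr (- \<alpha>) / 2"
  proof -
    have "real n ^ (4 * h + 3) \<le> (2 powr l) ^ (4 * h + 3)" using n2 by (intro power_mono) auto
    also have "\<dots> = 2 powr (l * (4 * h + 3))" by (simp add: powr_powr[symmetric] powr_realpow[symmetric])
    finally have "n ^ (4 * h + 3) * 2 powr (- \<gamma> * m0) \<le> 2 powr (l * (4 * h + 3)) * 2 powr (- \<gamma> * m0)"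
      by (intro mult_right_mono) simp_all
    also have "\<dots> = 2 powr (l * (4 * h + 3) - \<gamma> * m0)" by (simp add: powr_add[symmetric])
    also have "\<dots> \<le> 2 powr (- (\<alpha> * l) - 1)" using key by (intro powr_mono) (simp_all add: algebra_simps)
    finally show ?thesis using E1(2) n\<alpha> half by linarith
  qed
  have p2: "prob E2 \<le> n powr (- \<alpha>) / 2"
  proof -
    have "real (2 * (n + 1) ^ 3) \<le> 2 * (2 * 2 powr l) ^ 3"
    proof -
      have "real (n + 1) \<le> 2 * 2 powr l" using n2 n by simp
      then have "real (n + 1) ^ 3 \<le> (2 * 2 powr l) ^ 3" by (rule power_mono) simp
      then show ?thesis by simp
    qed
    also have "\<dots> = 2 powr (4 + 3 * l)"
    proof -
      have "(2 powr real l) ^ 3 = 2 powr (3 * l)" by (simp add: powr_power mult.commute)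
      then show ?thesis by (simp add: power_mult_distrib powr_add)
    qed
    finally have "real (2 * (n + 1) ^ 3) * 2 powr (- \<gamma> * d / 2) \<le> 2 powr (4 + 3 * l) * 2 powr (- \<gamma> * d / 2)"
      by (rule mult_right_mono) simp
    also have "\<dots> = 2 powr (4 + 3 * l - \<gamma> * d / 2)" by (simp add: powr_add[symmetric])
    also have "\<dots> \<le> 2 powr (- (\<alpha> * l) - 1)"
    proof (intro powr_mono)
      have "(\<alpha> + 8) * l = \<alpha> * l + 8 * l" by (simp add: algebra_simps)
      then show "4 + 3 * l - \<gamma> * d / 2 \<le> - (\<alpha> * l) - 1" using keyd l(1) by linarith
    qed simp
    finally show ?thesis using E2(2) n\<alpha> half by linarith
  qed
  define G where "G = space P - (E1 \<union> E2)"
  have "prob (E1 \<union> E2) \<le> n powr (- \<alpha>)"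
    using measure_Un_le[OF E1(1) E2(1)] p1 p2 by linarith
  then have "1 - n powr (- \<alpha>) \<le> prob G"
    unfolding G_def using prob_compl[of "E1 \<union> E2"] E1(1) E2(1) by auto
  moreover have "G \<in> sets P" unfolding G_def using E1(1) E2(1) by auto
  moreover have "\<sigma> i < rank k \<pi> i + d \<and> rank k \<pi> i < \<sigma> i + d"
    if s: "s \<in> G" and k: "k \<le> n" "optimal_order k (llr D s) \<sigma>" "i < k" for s k \<sigma> i
  proof (rule displacement_less[OF k(2) _ k(1) inj_on_\<pi> \<pi>_less _ _ eh _ \<Delta>(3) thr k(3)])
    show "antisymmetric_on k (llr D s)"
    proof -
      have "s \<in> space P" using s by (simp add: G_def)
      from antisymmetric_llr[OF this] show ?thesis
        using order.strict_trans2[OF _ k(1)] unfolding antisymmetric_on_def by blast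
    qed
    show "\<not> bad_window n (4 * h) (h * (e + 1)) \<pi> (llr D s)" using E1(3) s by (simp add: G_def m_def)
    show "\<not> bad_move n d \<Delta> \<pi> (llr D s)" using E2(3) s by (simp add: G_def)
    show "1 \<le> h" using H1 hH by linarith
  qed auto
  ultimately show ?thesis unfolding d_def l_def by blast
qed

end


section \<open>Parameters, running time and success probability\<close>

text \<open>The bound on \<open>(4 * ln \<Delta> + 5) / \<Delta>\<close> forces a factor
  \<open>1 + ln (1 / \<gamma>)\<close> into \<open>\<Delta>\<close>. As \<open>\<Delta>\<close>
  enters \<open>K\<close> both directly and through \<open>H\<close>, and \<open>C\<close> once
  more, the third power of 1 / \<gamma> and two logarithms arise; \<open>R\<close> supplies the
  third logarithm.\<close>

lemma parameters_exist:
  fixes \<gamma> \<alpha> :: real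
  assumes \<gamma>: "0 < \<gamma>" "\<gamma> \<le> 1" and \<alpha>: "0 < \<alpha>"
  obtains \<Delta> C a b H R K :: nat
  where "256 \<le> \<gamma> * \<Delta>" "(4 * ln \<Delta> + 5) / \<Delta> \<le> \<gamma> * ln 2 / 2" "3 \<le> \<Delta>" "8 \<le> \<gamma> * C" "\<alpha> + 5 \<le> a"
    "H = C * \<Delta> * a" "17 * C * H \<le> 2 ^ b" "R = 2 * b + 20" "K = 6 * \<Delta> * H * R"
    "4 + 16 * K \<le> soft_O (10 ^ 11) 3 ((\<alpha> + 1) * (1 / \<gamma> ^ 3))"
proof -
  define g where "g = 1 / \<gamma>"
  define t where "t = 1 + ln g"
  define x where "x = (\<alpha> + 1) * g ^ 3"
  define u where "u = 1 + ln x"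
  have g: "1 \<le> g" "\<gamma> * g = 1" using \<gamma> by (auto simp: g_def)
  have t: "1 \<le> t" using g(1) by (simp add: t_def)
  have gx: "g \<le> x"
  proof -
    have "g ^ 1 \<le> g ^ 3" using g(1) by (intro power_increasing) auto
    moreover have "1 * g ^ 3 \<le> (\<alpha> + 1) * g ^ 3" using \<alpha> g(1) by (intro mult_right_mono) auto
    ultimately show ?thesis by (simp add: x_def)
  qed
  have x1: "1 \<le> x" using gx g(1) by linarith
  have tu: "t \<le> u" using gx g(1) by (simp add: t_def u_def)
  have u1: "1 \<le> u" using t tu by linarith
  have ux: "u \<le> x" using ln_le_minus_one[of x] x1 by (simp add: u_def)
  define \<Delta> where "\<Delta> = nat \<lceil>256 * (g * t)\<rceil>"
  define C where "C = nat \<lceil>8 * g\<rceil>"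
  define a where "a = nat \<lceil>\<alpha> + 5\<rceil>"
  define H where "H = C * \<Delta> * a"
  define b where "b = bits (17 * C * H)"
  define R where "R = 2 * b + 20"
  define K where "K = 6 * \<Delta> * H * R"
  have gt: "1 \<le> g * t" using mult_mono[of 1 g 1 t] g(1) t by simp
  have \<Delta>: "256 * (g * t) \<le> \<Delta>" "\<Delta> \<le> 257 * (g * t)" using gt unfolding \<Delta>_def by linarith+
  have C: "8 * g \<le> C" "C \<le> 9 * g" using g(1) unfolding C_def by linarith+
  have a: "\<alpha> + 5 \<le> a" "a \<le> 6 * (\<alpha> + 1)"
  proof -
    have "real a = \<lceil>\<alpha> + 5\<rceil>" using \<alpha> by (simp add: a_def)
    then show "\<alpha> + 5 \<le> a" "a \<le> 6 * (\<alpha> + 1)" using \<alpha> ceiling_correct[of "\<alpha> + 5"]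
      unfolding distrib_left by linarith+
  qed
  have \<Delta>0: "0 < real \<Delta>" using \<Delta>(1) gt by linarith
  have c1: "256 \<le> \<gamma> * \<Delta>"
  proof -
    have "256 * t = \<gamma> * (256 * (g * t))" using g(2) by (simp add: mult.assoc[symmetric] mult.commute)
    also have "\<dots> \<le> \<gamma> * \<Delta>" using \<Delta>(1) \<gamma>(1) by (intro mult_left_mono) auto
    finally show ?thesis using t by linarith
  qed
  have ln2: "1 / 2 \<le> ln (2::real)" "ln (2::real) \<le> 1"
    using ln_le_minus_one[of "1 / 2 :: real"] ln_le_minus_one[of "2 :: real"] by (simp_all add: ln_div)
  have lnp: "ln (y::real) \<le> real m" if "0 < y" "y \<le> 2 ^ m" for y m
  proof -
    have "ln y \<le> ln (2 ^ m)" using that by simp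
    also have "\<dots> = m * ln 2" by (simp add: ln_realpow)
    also have "\<dots> \<le> real m * 1" using ln2(2) by (intro mult_left_mono) auto
    finally show ?thesis by simp
  qed
  have c2: "(4 * ln \<Delta> + 5) / \<Delta> \<le> \<gamma> * ln 2 / 2"
  proof -
    have "ln \<Delta> \<le> ln (257 * (g * t))" using \<Delta>(2) \<Delta>0 by simp
    also have "\<dots> = ln 257 + ln g + ln t" using g(1) t by (simp add: ln_mult)
    also have "\<dots> \<le> 9 + ln g + ln g"
      using lnp[of 257 9] ln_le_minus_one[of t] t by (simp add: t_def)
    finally have "ln \<Delta> \<le> 9 + ln g + ln g" .
    moreover have "0 \<le> ln g" using g(1) by simp
    ultimately have "4 * ln \<Delta> + 5 \<le> 41 + 41 * ln g" by linarith
    also have "\<dots> = 41 * t" by (simp add: t_def)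
    also have "41 * t \<le> 64 * t" using t by simp
    also have "\<dots> = \<gamma> * (256 * (g * t)) / 4"
    proof -
      have "\<gamma> * (256 * (g * t)) = 256 * (\<gamma> * g * t)" by simp
      then show ?thesis unfolding g(2) by simp
    qed
    also have "\<dots> \<le> \<gamma> * \<Delta> / 4" using mult_left_mono[OF \<Delta>(1), of \<gamma>] \<gamma>(1) by simp
    also have "\<dots> = \<gamma> * \<Delta> / 2 * (1 / 2)" by simp
    also have "\<dots> \<le> \<gamma> * \<Delta> / 2 * ln 2"
      by (rule mult_left_mono[OF ln2(1)]) (use \<gamma>(1) in simp)
    finally show ?thesis unfolding pos_divide_le_eq[OF \<Delta>0] by (simp add: mult_ac)
  qed
  have c3: "3 \<le> \<Delta>" using \<Delta>(1) gt by linarith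
  have c4: "8 \<le> \<gamma> * C"
  proof -
    have "\<gamma> * (8 * g) \<le> \<gamma> * C" using C(1) \<gamma>(1) by (intro mult_left_mono) auto
    moreover have "\<gamma> * (8 * g) = 8 * (\<gamma> * g)" by simp
    ultimately show ?thesis unfolding g(2) by simp
  qed
  have Hb: "H \<le> 13878 * ((\<alpha> + 1) * g ^ 2 * t)"
  proof -
    have "real H \<le> 9 * g * (257 * (g * t)) * (6 * (\<alpha> + 1))"
      unfolding H_def of_nat_mult using C(2) \<Delta>(2) a(2) g(1) gt by (intro mult_mono) auto
    also have "\<dots> = 13878 * ((\<alpha> + 1) * g ^ 2 * t)"
      by (simp add: power2_eq_square algebra_simps)
    finally show ?thesis .
  qed
  have N: "real (17 * C * H) \<le> 2123334 * x ^ 2"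
  proof -
    have "real (17 * C * H) \<le> 17 * (9 * g) * (13878 * ((\<alpha> + 1) * g ^ 2 * t))"
      unfolding of_nat_mult using C(2) Hb g(1) by (intro mult_mono) auto
    also have "\<dots> = 2123334 * (x * t)" by (simp add: x_def power2_eq_square power3_eq_cube algebra_simps)
    also have "\<dots> \<le> 2123334 * (x * x)"
      using tu ux x1 by (intro mult_left_mono) auto
    finally show ?thesis by (simp add: power2_eq_square)
  qed
  have pos: "2 \<le> 17 * C * H"
  proof -
    have "1 \<le> C" "1 \<le> \<Delta>" "1 \<le> a" using C(1) g(1) c3 a(1) \<alpha> by linarith+
    then have "1 \<le> C * H" unfolding H_def by (metis less_one mult_eq_0_iff not_less)
    then have "17 * 1 \<le> 17 * (C * H)" by (rule mult_le_mono2)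
    then show ?thesis unfolding mult.assoc by (rule order_trans[rotated]) simp
  qed
  have b: "b \<le> 45 * u"
  proof -
    have "2 ^ (b - 1) < 17 * C * H" unfolding b_def by (rule bits_bounds(2)[OF pos])
    then have "real (2 ^ (b - 1)) < real (17 * C * H)" by (simp only: of_nat_less_iff)
    then have "real (2 ^ (b - 1)) \<le> 2123334 * x ^ 2" using N by linarith
    then have "2 ^ (b - 1) \<le> 2123334 * x ^ 2" by simp
    then have "ln (2 ^ (b - 1)) \<le> ln (2123334 * x ^ 2)"
      by (subst ln_le_cancel_iff) (use x1 in auto)
    also have "\<dots> = ln 2123334 + 2 * ln x" using x1 by (simp add: ln_mult ln_realpow)
    also have "\<dots> \<le> 22 + 2 * ln x" using lnp[of 2123334 22] by simp
    finally have 1: "(b - 1) * ln 2 \<le> 22 + 2 * ln x" by (simp add: ln_realpow)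
    have "real (b - 1) * (1 / 2) \<le> (b - 1) * ln 2" using ln2(1) by (rule mult_left_mono) simp
    then have "real (b - 1) \<le> 44 + 4 * ln x" using 1 by linarith
    moreover have "0 \<le> ln x" using x1 by simp
    ultimately show ?thesis unfolding u_def distrib_left by linarith
  qed
  have R: "R \<le> 110 * u"
  proof -
    have "real R = 2 * real b + 20" by (simp add: R_def)
    then show ?thesis using b u1 by linarith
  qed
  have Kb: "K \<le> 2353986360 * (x * u ^ 3)"
  proof -
    have "real K \<le> 6 * (257 * (g * t)) * (13878 * ((\<alpha> + 1) * g ^ 2 * t)) * (110 * u)"
      unfolding K_def of_nat_mult using \<Delta>(2) Hb R g(1) gt \<alpha> t by (intro mult_mono) auto
    also have "\<dots> = 2353986360 * (x * (t * t * u))"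
      by (simp add: x_def power2_eq_square power3_eq_cube algebra_simps)
    also have "\<dots> \<le> 2353986360 * (x * (u * u * u))"
      using tu t u1 x1 by (intro mult_left_mono mult_mono) auto
    finally show ?thesis by (simp add: power3_eq_cube)
  qed
  \<comment> \<open>This absorbs the summand 4; the constant \<open>16 * 2353986360 + 4\<close> is
    below \<open>10 ^ 11\<close>.\<close>
  have "1 \<le> x * u ^ 3" using x1 u1 mult_mono[of 1 x 1 "u ^ 3"] by simp
  then have "4 + 16 * real K \<le> 100000000000 * (x * u ^ 3)" using Kb by linarith
  then have K11: "4 + 16 * real K \<le> 10 ^ 11 * (x * u ^ 3)" by simp
  have fin: "4 + 16 * real K \<le> soft_O (10 ^ 11) 3 ((\<alpha> + 1) * (1 / \<gamma> ^ 3))"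
  proof -
    have "(\<alpha> + 1) * (1 / \<gamma> ^ 3) = x" by (simp add: x_def g_def power_one_over)
    then show ?thesis using K11 unfolding soft_O_def u_def by (simp only: mult.assoc)
  qed
  have c6: "17 * C * H \<le> 2 ^ b" unfolding b_def by (rule le_power_bits)
  have "real (4 + 16 * K) \<le> soft_O (10 ^ 11) 3 ((\<alpha> + 1) * (1 / \<gamma> ^ 3))"
    using fin by simp
  note fin = this
  show ?thesis
    by (rule that[OF c1 c2 c3 c4 a(1) H_def c6 R_def K_def fin])
qed

text \<open>Insertions, levels and the scan for one code contribute \<open>n\<close>,
  \<open>n\<close> and \<open>n ^ 2\<close>. One factor \<open>2 ^ W\<close> is the number of rounds
  per level, a second one comes from the crude bound \<open>W \<le> 2 ^ W\<close>. Finally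
  \<open>2 ^ bits n \<le> n ^ 2\<close> turns the square of \<open>2 ^ W\<close> into
  \<open>n ^ (16 * K)\<close>.\<close>

lemma main_time_le:
  assumes "1 \<le> n"
  shows "main_time n (4 * K * bits n) \<le> 400 * n ^ (4 + 16 * K)"
proof -
  define W where "W = 4 * K * bits n"
  define X where "X = (2::nat) ^ W"
  have WX: "W \<le> X" "1 \<le> X" unfolding X_def by (simp_all add: less_imp_le)
  have sq: "n \<le> n * n" "1 \<le> n * n" using assms by simp_all
  have "W \<le> n * n * X" "n \<le> n * n * X" "1 \<le> n * n * X" "n * n \<le> n * n * X"
    using mult_le_mono[OF sq(2) WX(1)] mult_le_mono[OF sq(1) WX(2)] mult_le_mono[OF sq(2) WX(2)]
      mult_le_mono[OF le_refl[of "n * n"] WX(2)] by simp_all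
  moreover have "process_time n W = 43 * n + 11 * W + 11 * (n * n) + 52"
    unfolding process_time_def by (simp add: algebra_simps)
  ultimately have P: "process_time n W \<le> 120 * (n * n * X)" by arith
  have I: "insert_time n W \<le> 300 * (n * n * n * X * X)"
  proof -
    define Y where "Y = n * n * X"
    have "X * (2 * process_time n W + 5) + 14 \<le> X * (2 * (120 * Y) + 5) + 14"
      using P unfolding Y_def by (intro add_mono mult_mono) auto
    also have "\<dots> \<le> 260 * (Y * X)"
    proof -
      have "1 \<le> Y" unfolding Y_def using \<open>1 \<le> n * n * X\<close> .
      then have "X \<le> Y * X" "1 \<le> Y * X" using WX(2) mult_le_mono[of 1 Y 1 X] by simp_all
      moreover have "X * (2 * (120 * Y) + 5) + 14 = 240 * (Y * X) + 5 * X + 14"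
        by (simp add: algebra_simps)
      ultimately show ?thesis by arith
    qed
    finally have "n * (X * (2 * process_time n W + 5) + 14) \<le> n * (260 * (Y * X))" by (rule mult_le_mono2)
    moreover have "n \<le> n * (Y * X)" "1 \<le> n * (Y * X)"
    proof -
      have "1 \<le> Y * X" using mult_le_mono[OF \<open>1 \<le> n * n * X\<close> WX(2)] by (simp add: Y_def)
      then show "n \<le> n * (Y * X)" "1 \<le> n * (Y * X)" using assms by simp_all
    qed
    ultimately have "insert_time n W \<le> 300 * (n * (Y * X))"
      unfolding insert_time_def X_def[symmetric] by linarith
    then show ?thesis by (simp add: Y_def mult_ac)
  qed
  have M: "main_time n W \<le> 400 * (n ^ 4 * X ^ 2)"
  proof -
    define Z where "Z = n * n * n * X * X"
    have Z: "1 \<le> Z" unfolding Z_def using assms WX(2) by simp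
    have WZ: "W \<le> n * Z" 
    proof -
      have "1 * W \<le> (n * (n * n * n * X)) * X" using assms WX by (intro mult_le_mono) auto
      then show ?thesis by (simp add: Z_def mult_ac)
    qed
    have nZ: "n \<le> n * Z" "1 \<le> n * Z" using Z assms by simp_all
    have "n * (insert_time n W + 2) \<le> n * (302 * Z)"
      using I Z unfolding Z_def[symmetric] by (intro mult_le_mono2) linarith
    then have "main_time n W \<le> 400 * (n * Z)"
      unfolding main_time_def using WZ nZ by linarith
    then show ?thesis by (simp add: Z_def power2_eq_square eval_nat_numeral mult_ac)
  qed
  have "2 ^ bits n \<le> n ^ 2"
  proof (cases "n = 1")
    case True
    have "bits 1 \<le> 0" by (rule bits_le) simp
    then show ?thesis using True by simp
  next
    case False
    then have n: "2 \<le> n" using assms by simp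
    have "(2::nat) ^ bits n = 2 * 2 ^ (bits n - 1)"
      using bits_bounds(1)[OF n] by (cases "bits n") auto
    also have "\<dots> \<le> n * n" using bits_bounds(2)[OF n] n by (intro mult_le_mono) auto
    finally show ?thesis by (simp add: power2_eq_square)
  qed
  then have "(2 ^ bits n) ^ (8 * K) \<le> (n ^ 2) ^ (8 * K)" by (rule power_mono) simp
  then have "X ^ 2 \<le> n ^ (16 * K)"
    unfolding X_def W_def by (simp add: power_mult[symmetric] mult_ac)
  then have "n ^ 4 * X ^ 2 \<le> n ^ 4 * n ^ (16 * K)" by (rule mult_le_mono2)
  then show ?thesis using M unfolding W_def power_add by linarith
qed

text \<open>Lowering \<gamma> raises the threshold for \<open>m\<close> and weakens the probability
  bound. Hence \<gamma> may be replaced by its minimum with 1, as the choice of parameters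
  presupposes.\<close>

lemma strongly_biased_mono:
  assumes "strongly_biased A \<gamma> n M D \<pi>" "0 < \<gamma>'" "\<gamma>' \<le> \<gamma>" "1 \<le> n"
  shows "strongly_biased A \<gamma>' n M D \<pi>"
proof -
  have "log 2 (real n) / \<gamma> < real m" if "log 2 (real n) / \<gamma>' < real m" for m
  proof -
    have "log 2 (real n) / \<gamma> \<le> log 2 (real n) / \<gamma>'"
      using assms(2-4) by (intro divide_left_mono) auto
    then show ?thesis using that by linarith
  qed
  moreover have "1 - 2 powr (- \<gamma>' * real m) < p" if "1 - 2 powr (- \<gamma> * real m) < p" for m p
  proof -
    have "- \<gamma> * real m \<le> - \<gamma>' * real m" using assms(3) by (simp add: mult_right_mono)
    then have "2 powr (- \<gamma> * real m) \<le> 2 powr (- \<gamma>' * real m)" by simp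
    then show ?thesis using that by linarith
  qed
  ultimately show ?thesis
    using assms(1) unfolding strongly_biased_def by blast
qed

section \<open>Measurability and probability of the success event\<close>

lemma measurable_states_init:
  assumes "\<And>i j. i < n \<Longrightarrow> j < n \<Longrightarrow> (\<lambda>z. q z i j) \<in> borel_measurable N"
    "\<And>i. (\<lambda>z. c z i) \<in> measurable N (count_space UNIV)"
  shows "measurable_states N (\<lambda>z. init n (q z) (c z))"
proof -
  have "(\<lambda>z. if i < n * n then q z (i div n) (i mod n) else 0) \<in> borel_measurable N" for i
  proof (cases "i < n * n")
    case True
    then have "0 < n" by (cases n) auto
    then have "i div n < n" "i mod n < n" using True by (simp_all add: less_mult_imp_div_less)
    then show ?thesis using assms(1) True by simp
  qed simp
  then show ?thesis
    using assms(2) unfolding measurable_states_def init_def by simp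
qed

text \<open>The outcome can be optimal only as one of finitely many permutations, and for each of
  them agreement with the memory and maximality of the score are measurable conditions.\<close>

lemma measurable_optimal_outcome:
  assumes s: "measurable_states N s" and halt: "\<And>z. halts c (s z)"
    and q: "\<And>i j. i < n \<Longrightarrow> j < n \<Longrightarrow> (\<lambda>z. q z i j) \<in> borel_measurable N"
  shows "{z \<in> space N. optimal_order n (q z) (outcome n (final c (s z)))} \<in> sets N"
proof -
  let ?S = "{\<tau>. \<tau> permutes {..<n}}"
  have fin: "finite ?S" by (simp add: finite_permutations)
  have f: "measurable_states N (\<lambda>z. final c (s z))" using measurable_final[OF s] by blast
  have score: "(\<lambda>z. score n (q z) \<tau>) \<in> borel_measurable N" for \<tau>
    unfolding score_def by (rule borel_measurable_sum) (auto intro: q)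
  have out: "Measurable.pred N (\<lambda>z. \<forall>i\<in>{..<n}. nmem (final c (s z)) i = \<tau> i)" for \<tau>
  proof (intro pred_intros_finite finite_lessThan)
    fix i
    show "Measurable.pred N (\<lambda>z. nmem (final c (s z)) i = \<tau> i)"
      using measurable_nat_binop[where f = "\<lambda>a b. a = \<tau> i", OF measurable_statesD(2)[OF f] measurable_statesD(2)[OF f]] .
  qed
  have opt: "Measurable.pred N (\<lambda>z. \<forall>\<tau>'\<in>?S. score n (q z) \<tau>' \<le> score n (q z) \<tau>)" for \<tau>
  proof (intro pred_intros_finite fin)
    fix \<tau>'
    show "Measurable.pred N (\<lambda>z. score n (q z) \<tau>' \<le> score n (q z) \<tau>)"
      using borel_measurable_le[OF score score] by (simp add: pred_def)
  qed
  have eq: "optimal_order n (q z) (outcome n (final c (s z))) \<longleftrightarrow>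
    (\<exists>\<tau>\<in>?S. (\<forall>i\<in>{..<n}. nmem (final c (s z)) i = \<tau> i) \<and> (\<forall>\<tau>'\<in>?S. score n (q z) \<tau>' \<le> score n (q z) \<tau>))" for z
  proof
    assume "optimal_order n (q z) (outcome n (final c (s z)))"
    then show "\<exists>\<tau>\<in>?S. (\<forall>i\<in>{..<n}. nmem (final c (s z)) i = \<tau> i) \<and> (\<forall>\<tau>'\<in>?S. score n (q z) \<tau>' \<le> score n (q z) \<tau>)"
      unfolding optimal_order_def is_arg_max_def
      by (intro bexI[of _ "outcome n (final c (s z))"]) (auto simp: outcome_def not_less)
  next
    assume "\<exists>\<tau>\<in>?S. (\<forall>i\<in>{..<n}. nmem (final c (s z)) i = \<tau> i) \<and> (\<forall>\<tau>'\<in>?S. score n (q z) \<tau>' \<le> score n (q z) \<tau>)"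
    then obtain \<tau> where \<tau>: "\<tau> permutes {..<n}" "\<forall>i<n. nmem (final c (s z)) i = \<tau> i"
      "\<forall>\<tau>'\<in>?S. score n (q z) \<tau>' \<le> score n (q z) \<tau>" by auto
    have "outcome n (final c (s z)) = \<tau>"
      using \<tau>(2) permutes_not_in[OF \<tau>(1)] by (auto simp: outcome_def)
    then show "optimal_order n (q z) (outcome n (final c (s z)))"
      using \<tau> by (auto simp: optimal_order_def is_arg_max_def not_less)
  qed
  have "Measurable.pred N (\<lambda>z. optimal_order n (q z) (outcome n (final c (s z))))"
    unfolding eq by (intro pred_intros_finite fin pred_intros_logic out opt)
  then show ?thesis by (simp add: pred_def)
qed

lemma halts_main: "halts (main c) (init n q \<omega>)"
proof -
  obtain t s where "exec (main c) (init n q \<omega>) t s"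
    using wp_main[of c n q \<omega>] unfolding wp_def by blast
  then show ?thesis unfolding halts_def by (intro exI)
qed

lemma outcome_main:
  "\<exists>x. (\<forall>k<n. dp_step q (c * bits n) k (x k) (x (Suc k))) \<and>
     (\<forall>p<n. nmem (final (main c) (init n q \<omega>)) (x n p) = p)"
proof -
  obtain t s where "exec (main c) (init n q \<omega>) t s"
    "\<exists>x. (\<forall>k<n. dp_step q (c * bits n) k (x k) (x (Suc k))) \<and> (\<forall>p<n. nmem s (x n p) = p)"
    using wp_main[of c n q \<omega>] unfolding wp_def by blast
  then show ?thesis using final_eqI by simp
qed

lemma outcome_main_optimal:
  assumes disp: "\<And>k \<sigma> i. k \<le> n \<Longrightarrow> optimal_order k q \<sigma> \<Longrightarrow> i < k \<Longrightarrow>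
      \<sigma> i < rank k \<pi> i + K * bits n \<and> rank k \<pi> i < \<sigma> i + K * bits n"
  shows "optimal_order n q (outcome n (final (main (4 * K)) (init n q \<omega>)))"
proof -
  obtain x where x: "\<And>k. k < n \<Longrightarrow> dp_step q (4 * K * bits n) k (x k) (x (Suc k))"
    "\<And>p. p < n \<Longrightarrow> nmem (final (main (4 * K)) (init n q \<omega>)) (x n p) = p"
    using outcome_main[of n q "4 * K" \<omega>] by blast
  have "bij_betw (x n) {..<n} {..<n} \<and> optimal_order n q (position n (x n))"
  proof (rule dp_chain_optimal[where n = n and q = q and \<pi> = \<pi> and D = "K * bits n"
        and W = "4 * K * bits n" and x = x])
    show "\<sigma> i < rank k \<pi> i + K * bits n \<and> rank k \<pi> i < \<sigma> i + K * bits n"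
      if "k \<le> n" "optimal_order k q \<sigma>" "i < k" for k \<sigma> i
      using disp that by blast
  qed (use x(1) in auto)
  then have opt: "bij_betw (x n) {..<n} {..<n}" "optimal_order n q (position n (x n))" by auto
  have "outcome n (final (main (4 * K)) (init n q \<omega>)) i = position n (x n) i" for i
  proof (cases "i < n")
    case True
    from x(2)[OF position(4)[OF opt(1) True]] show ?thesis
      unfolding position(3)[OF opt(1) True] using True by (simp add: outcome_def)
  qed (simp add: outcome_def position_def)
  then have "outcome n (final (main (4 * K)) (init n q \<omega>)) = position n (x n)" by blast
  then show ?thesis using opt(2) by simp
qed

lemma coin_measurable: "(\<lambda>\<omega>. \<omega> i) \<in> measurable coin_measure (count_space UNIV)"
proof -
  have "(\<lambda>\<omega>. \<omega> i) \<in> measurable coin_measure (measure_pmf (bernoulli_pmf (1 / 2)))"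
    unfolding coin_measure_def by (rule measurable_component_singleton) simp
  then show ?thesis by simp
qed

lemma prob_space_coin_measure: "prob_space coin_measure"
  unfolding coin_measure_def by (intro prob_space_PiM prob_space_measure_pmf)

context noisy_signals
begin

text \<open>On \<open>G\<close> the program succeeds for every sequence of coin tosses, so the
  success event contains \<open>G \<times> space coin_measure\<close>. Monotonicity of the measure
  needs the success event to be measurable.\<close>

lemma success_probability:
  assumes G: "G \<in> sets P" "1 - \<epsilon> \<le> prob G"
    and disp: "\<And>s k \<sigma> i. s \<in> G \<Longrightarrow> k \<le> n \<Longrightarrow> optimal_order k (llr D s) \<sigma> \<Longrightarrow> i < k \<Longrightarrow>
      \<sigma> i < rank k \<pi> i + K * bits n \<and> rank k \<pi> i < \<sigma> i + K * bits n"
  shows "1 - \<epsilon> \<le> measure (P \<Otimes>\<^sub>M coin_measure) {(s, \<omega>) \<in> space (P \<Otimes>\<^sub>M coin_measure).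
     \<exists>t s'. exec (main (4 * K)) (init n (llr D s) \<omega>) t s' \<and> optimal_order n (llr D s) (outcome n s')}"
    (is "_ \<le> measure ?N ?E")
proof -
  interpret C: prob_space coin_measure by (rule prob_space_coin_measure)
  interpret PC: pair_prob_space P coin_measure ..
  let ?c = "main (4 * K)"
  let ?s = "\<lambda>z. init n (llr D (fst z)) (snd z)"
  have iff: "(\<exists>t s'. exec ?c s t s' \<and> Q s') \<longleftrightarrow> Q (final ?c s)" if "halts ?c s" for s Q
    using that final_eqI unfolding halts_def by metis
  have E: "?E = {z \<in> space ?N. optimal_order n (llr D (fst z)) (outcome n (final ?c (?s z)))}"
    by (auto simp: iff[OF halts_main])
  have llr: "(\<lambda>z. llr D (fst z) i j) \<in> borel_measurable ?N" if "i < n" "j < n" for i j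
    using measurable_compose[OF measurable_fst llr_measurable[OF that]] .
  have coin: "(\<lambda>z. snd z i) \<in> measurable ?N (count_space UNIV)" for i
    using measurable_compose[OF measurable_snd coin_measurable] .
  have meas: "?E \<in> sets ?N"
    unfolding E by (rule measurable_optimal_outcome[OF measurable_states_init[OF llr coin] halts_main llr])
  have sub: "G \<times> space coin_measure \<subseteq> ?E"
    unfolding E
  proof
    fix z assume z: "z \<in> G \<times> space coin_measure"
    then have "fst z \<in> G" by auto
    have "z \<in> space ?N" using z sets.sets_into_space[OF G(1)] by (auto simp: space_pair_measure)
    show "z \<in> {z \<in> space ?N. optimal_order n (llr D (fst z)) (outcome n (final ?c (?s z)))}"
    proof -
      have "optimal_order n (llr D (fst z)) (outcome n (final ?c (?s z)))"
        by (rule outcome_main_optimal[where \<pi> = \<pi>]) (rule disp[OF \<open>fst z \<in> G\<close>])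
      then show ?thesis using \<open>z \<in> space ?N\<close> by blast
    qed
  qed
  have "emeasure ?N (G \<times> space coin_measure) = emeasure P G"
    using C.emeasure_pair_measure_Times[OF G(1) sets.top] C.emeasure_space_1 by simp
  then have "prob G = measure ?N (G \<times> space coin_measure)"
    by (simp add: measure_def)
  also have "\<dots> \<le> measure ?N ?E"
    by (rule PC.finite_measure_mono[OF sub meas])
  finally show ?thesis using G(2) by linarith
qed

end

theorem theorem3:
  fixes A :: nat
  shows "\<exists>(C::real) (k::nat). \<forall>(\<gamma>::real)>0. \<forall>(\<alpha>::real)>0. \<exists>c::prog. \<forall>n::nat. n \<ge> 1 \<longrightarrow>
     (\<forall>q \<omega>. \<exists>t s. exec c (init n q \<omega>) t s \<and>
        real t \<le> C * real n powr soft_O C k ((\<alpha> + 1) * max 1 (1 / \<gamma> ^ 3))) \<and>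
     (\<forall>(M :: 's measure) D \<pi>.
        signal_densities n M D \<and> \<pi> permutes {..<n} \<and> strongly_biased A \<gamma> n M D \<pi> \<longrightarrow>
        measure (signal_measure n M D \<pi> \<Otimes>\<^sub>M coin_measure)
          {(s, \<omega>) \<in> space (signal_measure n M D \<pi> \<Otimes>\<^sub>M coin_measure).
             \<exists>t s'. exec c (init n (llr D s) \<omega>) t s' \<and> optimal_order n (llr D s) (outcome n s')}
        \<ge> 1 - real n powr (- \<alpha>))"
proof (intro exI[of _ "10 ^ 11 :: real"] exI[of _ "3 :: nat"] allI impI)
  fix \<gamma> \<alpha> :: real
  assume \<gamma>: "0 < \<gamma>" and \<alpha>: "0 < \<alpha>"
  \<comment> \<open>Capping \<gamma> at 1 corresponds to the maximum with 1 in the claimed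
    exponent.\<close>
  define \<gamma>' where "\<gamma>' = min \<gamma> 1"
  have \<gamma>': "0 < \<gamma>'" "\<gamma>' \<le> 1" "\<gamma>' \<le> \<gamma>" using \<gamma> by (auto simp: \<gamma>'_def)
  have max: "max 1 (1 / \<gamma> ^ 3) = 1 / \<gamma>' ^ 3"
  proof (cases "\<gamma> \<le> 1")
    case True
    then have "\<gamma> ^ 3 \<le> 1" using \<gamma> by (simp add: power_le_one)
    then show ?thesis using True \<gamma> by (simp add: \<gamma>'_def)
  next
    case False
    then have "1 \<le> \<gamma> ^ 3" by (simp add: one_le_power)
    then show ?thesis using False by (simp add: \<gamma>'_def)
  qed
  obtain \<Delta> C a b H R K :: nat where par:
    "256 \<le> \<gamma>' * \<Delta>" "(4 * ln \<Delta> + 5) / \<Delta> \<le> \<gamma>' * ln 2 / 2" "3 \<le> \<Delta>" "8 \<le> \<gamma>' * C" "\<alpha> + 5 \<le> a"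
    "H = C * \<Delta> * a" "17 * C * H \<le> 2 ^ b" "R = 2 * b + 20" "K = 6 * \<Delta> * H * R"
    and K: "4 + 16 * K \<le> soft_O (10 ^ 11) 3 ((\<alpha> + 1) * (1 / \<gamma>' ^ 3))"
    using parameters_exist[OF \<gamma>'(1,2) \<alpha>] by metis
  show "\<exists>c. \<forall>n::nat. n \<ge> 1 \<longrightarrow>
     (\<forall>q \<omega>. \<exists>t s. exec c (init n q \<omega>) t s \<and>
        real t \<le> 10 ^ 11 * real n powr soft_O (10 ^ 11) 3 ((\<alpha> + 1) * max 1 (1 / \<gamma> ^ 3))) \<and>
     (\<forall>(M :: 's measure) D \<pi>.
        signal_densities n M D \<and> \<pi> permutes {..<n} \<and> strongly_biased A \<gamma> n M D \<pi> \<longrightarrow>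
        measure (signal_measure n M D \<pi> \<Otimes>\<^sub>M coin_measure)
          {(s, \<omega>) \<in> space (signal_measure n M D \<pi> \<Otimes>\<^sub>M coin_measure).
             \<exists>t s'. exec c (init n (llr D s) \<omega>) t s' \<and> optimal_order n (llr D s) (outcome n s')}
        \<ge> 1 - real n powr (- \<alpha>))"
  proof (intro exI[of _ "main (4 * K)"] allI impI conjI)
    fix n :: nat and q :: "nat \<Rightarrow> nat \<Rightarrow> real" and \<omega> :: "nat \<Rightarrow> bool"
    assume n: "1 \<le> n"
    obtain t s where e: "exec (main (4 * K)) (init n q \<omega>) t s" "t \<le> main_time n (4 * K * bits n)"
      using wp_main[of "4 * K" n q \<omega>] unfolding wp_def by blast
    have "t \<le> 400 * n ^ (4 + 16 * K)" using e(2) main_time_le[OF n, of K] by (rule order_trans)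
    then have "real t \<le> real (400 * n ^ (4 + 16 * K))" by (simp only: of_nat_le_iff)
    also have "\<dots> = 400 * real n powr (4 + 16 * K)" using n by (simp add: powr_realpow[symmetric])
    also have "\<dots> \<le> 10 ^ 11 * real n powr soft_O (10 ^ 11) 3 ((\<alpha> + 1) * max 1 (1 / \<gamma> ^ 3))"
      unfolding max using K n by (intro mult_mono powr_mono) auto
    finally show "\<exists>t s. exec (main (4 * K)) (init n q \<omega>) t s \<and>
        real t \<le> 10 ^ 11 * real n powr soft_O (10 ^ 11) 3 ((\<alpha> + 1) * max 1 (1 / \<gamma> ^ 3))"
      using e(1) by blast
  next
    fix n :: nat and M :: "'s measure" and D :: "nat \<Rightarrow> nat \<Rightarrow> 's \<Rightarrow> real" and \<pi> :: "nat \<Rightarrow> nat"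
    assume n: "1 \<le> n"
      and *: "signal_densities n M D \<and> \<pi> permutes {..<n} \<and> strongly_biased A \<gamma> n M D \<pi>"
    show "1 - real n powr (- \<alpha>) \<le> measure (signal_measure n M D \<pi> \<Otimes>\<^sub>M coin_measure)
          {(s, \<omega>) \<in> space (signal_measure n M D \<pi> \<Otimes>\<^sub>M coin_measure).
             \<exists>t s'. exec (main (4 * K)) (init n (llr D s) \<omega>) t s' \<and> optimal_order n (llr D s) (outcome n s')}"
    \<comment> \<open>For \<open>n = 1\<close> the claimed lower bound is 0.\<close>
    proof (cases "n = 1")
      case True
      then show ?thesis by simp
    next
      case False
      then have n2: "2 \<le> n" using n by simp
      have biased: "strongly_biased A \<gamma>' n M D \<pi>"
        using strongly_biased_mono[OF _ \<gamma>'(1,3) n] * by blast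
      interpret noisy_signals n M D \<pi> \<gamma>' A
        by (rule noisy_signals.intro) (use * biased in simp_all)
      obtain G where "G \<in> sets P" "1 - n powr (- \<alpha>) \<le> prob G"
        "\<forall>s\<in>G. \<forall>k \<sigma> i. k \<le> n \<longrightarrow> optimal_order k (llr D s) \<sigma> \<longrightarrow> i < k \<longrightarrow>
           \<sigma> i < rank k \<pi> i + K * bits n \<and> rank k \<pi> i < \<sigma> i + K * bits n"
        using displacement_whp[OF n2 \<gamma>'(1) \<alpha> par] by blast
      then show ?thesis using success_probability[of G "n powr (- \<alpha>)" K] by blast
    qed
  qed
qed

end
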